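(* Fix the supertaxon set $\mathcal{L}=[n]$. For $\mathcal{L}$-networks $N_1,N_2$ define $d_\mu(N_1,N_2)=|\mu(N_1)\triangle\mu(N_2)|$, where $\triangle$ is the symmetric difference of multisets. Then $d_\mu$ is a distance on the class of (complete, binary) orchard $\mathcal{L}$-networks: it is non-negative, symmetric, satisfies the triangle inequality, and for orchard $\mathcal{L}$-networks $N_1,N_2$ one has $d_\mu(N_1,N_2)=0$ if and only if $N_1$ and $N_2$ are isomorphic.
   Context: Networks. A semidirected graph $N=(V,E)$ has a finite node set $V$ and a finite multiset of edges $E=E_U\sqcup E_D$ (parallel edges allowed); edges in $E_U$ are undirected, and each edge in $E_D$ is directed from its parent to its child, written $u\to v$. For $v\in V$, $\deg_i(v)$, $\deg_o(v)$, $\deg_u(v)$ are the numbers of directed edges with child $v$, directed edges with parent $v$, and undirected edges incident to $v$; $\deg(v)$ is their sum. A node $v$ is a root if $\deg_i(v)=\deg_u(v)=0$, a leaf if $\deg_o(v)=\deg_u(v)=0$, a tree node if $\deg_i(v)\le 1$, and a hybrid node if $\deg_i(v)>1$. A path (cycle) is semidirected if its undirected edges can be oriented to make it a directed path (cycle); all paths are semidirected. An SDAG is a semidirected graph with no semidirected cycle. $N$ is binary if roots have degree 0, 2 or 3, leaves have degree 0 or 1, and all other nodes have degree 3. An $\mathcal{L}$-network is an SDAG whose leaves are tree nodes, with an injective labelling of its leaves by $\mathcal{L}$ (not all labels need occur). Write $u\sim v$ if $u,v$ are joined by a path of undirected edges; $N/{\sim}$ is obtained by contracting all undirected edges. $N$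 is complete if every edge incident to a leaf is directed towards the leaf and no $\sim$-class with more than one node has an incoming directed edge in $N/{\sim}$. A root component is the subgraph induced by a $\sim$-class that is a root of $N/{\sim}$. It is trivial if it is a single node; it is resolved if it is trivial and its node has degree 0 or 2, and unresolved otherwise; a root $u$ with $\{u\}$ a root component is a resolved/unresolved root accordingly. For a root component $T$, $\mathrm{adm}(T)$ is the set of edges of $T$ together with all edges incident to a node of $T$. A trivial forest on $\mathcal{L}_0$ consists only of isolated nodes labelled bijectively by $\mathcal{L}_0$. Isomorphism: a bijection of nodes and edges preserving incidences, edge directions and leaf labels. Unless said otherwise, $\mathcal{L}$-networks are complete and binary. $m(u,x;e)$ denotes the number of semidirected paths from node $u$ to node $x$ not containing edge $e$. Orchard. Let $a\neq b$ be non-isolated leaves with parents $p_a,p_b$. $(a,b)$ is a tree cherry if $p_a=p_b$; a reticulate cherry if $p_a$ is hybrid and $p_b$ is a parent of $p_a$. A non-leaf node $v$ is suppressible if either $\deg(v)=2$ and $\{v\}$ is not a root component, or $\deg(v)=1$, $\{v\}$ is a root component and its child is a tree node; suppressing $v$ deletes $v$ and its edges and, if $\deg(v)=2$ with neighbours $u,w$, adds an edge $uw$, directed $u\to w$ if $v$ was incident to a directed edge $v\to w$, undirected otherwise. Reduction $N^{(a,b)}$: for a tree cherry, delete $a$ and its edge, then suppress $p_a$ if suppressible; for a reticulate cherry, delete $p_b\to p_a$, suppress $p_b$ if suppressible, then suppress $p_a$. $N$ is orchard if some sequence of cherry reductions (each pair a cherry of the current network) turns $N$ into a trivial forest. $\mu$-representation.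 Tags are four symbols $\mathsf{t},\mathsf{h},\mathsf{r},\mathsf{i}$. For an edge $e$ with endpoints $u,v$: $\mu_i(e,v)=m(v,i;e)$ for $i\in[n]$ (0 if $i$ is not a leaf), $\mu_0(e,v)=\sum_{h\text{ hybrid}}m(v,h;e)$, $\mu(e,v)=(\mu_0(e,v),\dots,\mu_n(e,v))$; similarly $\mu(e,u)$. A $\mu$-entry is a multiset of one or two pairs (vector, tag). $\delta_a$ is the $a$-th unit vector of $\mathbb{Z}^{n+1}$ (coordinates $0,\dots,n$). For a root component $T$: $\mu(T)=\{(\delta_a,\mathsf{r})\}$ if $T$ is an isolated node labelled $a$, otherwise $\mu(T)=\{(\mu(e,u)+\mu(e,v),\mathsf{r})\}$ for any $e=uv\in\mathrm{adm}(T)$ (independent of $e$); $\mu(T)$ also denotes this vector. For an edge $e$ with endpoints $u,v$: if $e$ is directed $u\to v$ and in $\mathrm{adm}(T)$ for no unresolved root component $T$, $\mu(e)=\{(\mu(e,v),\tau)\}$ with $\tau=\mathsf{h}$ if $v$ is hybrid, $\tau=\mathsf{t}$ otherwise; if $e$ is directed $u\to v$ and $e\in\mathrm{adm}(T)$ for an unresolved $T$, $\mu(e)=\{(\mu(e,v),\tau),(\mu(T)-\mu(e,u),\mathsf{i})\}$; if $e$ is undirected, $\mu(e)=\{(\mu(e,v),\mathsf{t}),(\mu(e,u),\mathsf{t})\}$. $\mu(N)$ is the multiset of the $\mu$-entries of all edges and all root components of $N$.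
   Formalization: For an edge u→v in adm(T), T an unresolved root component, the entry tagged i is taken as μ(T)−μ(e,v) instead of μ(T)−μ(e,u); the latter equals μ(e,v), and with it two non-isomorphic orchard networks have the same μ-representation. *)

theory Defs
  imports Complex_Main "HOL-Library.Multiset"
begin

section \<open>Semidirected graphs\<close>

text \<open>
  Edges are abstract identifiers, so that parallel edges are distinct objects.  A directed edge
  \<open>e\<close> goes from its parent \<open>tail N e\<close> to its child \<open>head N e\<close>; for an undirected edge the two
  fields only list the endpoints and their order is immaterial.
\<close>

record ('v, 'e) sd_graph =
  nodes :: "'v set"
  uedges :: "'e set"
  dedges :: "'e set"
  tail :: "'e \<Rightarrow> 'v"
  head :: "'e \<Rightarrow> 'v"

definition edges :: "('v, 'e, 'z) sd_graph_scheme \<Rightarrow> 'e set" where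
  "edges N = uedges N \<union> dedges N"

definition ends :: "('v, 'e, 'z) sd_graph_scheme \<Rightarrow> 'e \<Rightarrow> 'v set" where
  "ends N e = {tail N e, head N e}"

definition semidirected_graph :: "('v, 'e, 'z) sd_graph_scheme \<Rightarrow> bool" where
  "semidirected_graph N \<longleftrightarrow>
     finite (nodes N) \<and> finite (uedges N) \<and> finite (dedges N) \<and>
     uedges N \<inter> dedges N = {} \<and> (\<forall>e \<in> edges N. ends N e \<subseteq> nodes N)"

definition deg_i :: "('v, 'e, 'z) sd_graph_scheme \<Rightarrow> 'v \<Rightarrow> nat" where
  "deg_i N v = card {e \<in> dedges N. head N e = v}"

definition deg_o :: "('v, 'e, 'z) sd_graph_scheme \<Rightarrow> 'v \<Rightarrow> nat" where
  "deg_o N v = card {e \<in> dedges N. tail N e = v}"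

definition deg_u :: "('v, 'e, 'z) sd_graph_scheme \<Rightarrow> 'v \<Rightarrow> nat" where
  "deg_u N v = card {e \<in> uedges N. v \<in> ends N e}"

definition deg :: "('v, 'e, 'z) sd_graph_scheme \<Rightarrow> 'v \<Rightarrow> nat" where
  "deg N v = deg_i N v + deg_o N v + deg_u N v"

definition is_root :: "('v, 'e, 'z) sd_graph_scheme \<Rightarrow> 'v \<Rightarrow> bool" where
  "is_root N v \<longleftrightarrow> v \<in> nodes N \<and> deg_i N v = 0 \<and> deg_u N v = 0"

definition is_leaf :: "('v, 'e, 'z) sd_graph_scheme \<Rightarrow> 'v \<Rightarrow> bool" where
  "is_leaf N v \<longleftrightarrow> v \<in> nodes N \<and> deg_o N v = 0 \<and> deg_u N v = 0"

definition is_tree_node :: "('v, 'e, 'z) sd_graph_scheme \<Rightarrow> 'v \<Rightarrow> bool" where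
  "is_tree_node N v \<longleftrightarrow> v \<in> nodes N \<and> deg_i N v \<le> 1"

definition is_hybrid :: "('v, 'e, 'z) sd_graph_scheme \<Rightarrow> 'v \<Rightarrow> bool" where
  "is_hybrid N v \<longleftrightarrow> v \<in> nodes N \<and> deg_i N v > 1"

definition is_parent :: "('v, 'e, 'z) sd_graph_scheme \<Rightarrow> 'v \<Rightarrow> 'v \<Rightarrow> bool" where
  "is_parent N u v \<longleftrightarrow> (\<exists>e \<in> dedges N. tail N e = u \<and> head N e = v)"

definition incident_edges :: "('v, 'e, 'z) sd_graph_scheme \<Rightarrow> 'v \<Rightarrow> 'e set" where
  "incident_edges N v = {e \<in> edges N. v \<in> ends N e}"


section \<open>Semidirected paths and cycles\<close>

text \<open>\<open>e\<close>, suitably oriented if it is undirected, goes from \<open>x\<close> to \<open>y\<close>.\<close>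

definition traverses :: "('v, 'e, 'z) sd_graph_scheme \<Rightarrow> 'v \<Rightarrow> 'e \<Rightarrow> 'v \<Rightarrow> bool" where
  "traverses N x e y \<longleftrightarrow>
     (e \<in> dedges N \<and> tail N e = x \<and> head N e = y) \<or> (e \<in> uedges N \<and> ends N e = {x, y})"

definition sd_walk :: "('v, 'e, 'z) sd_graph_scheme \<Rightarrow> 'v list \<Rightarrow> 'e list \<Rightarrow> bool" where
  "sd_walk N vs es \<longleftrightarrow>
     length vs = Suc (length es) \<and> set vs \<subseteq> nodes N \<and>
     (\<forall>i < length es. traverses N (vs ! i) (es ! i) (vs ! Suc i))"

definition sd_path :: "('v, 'e, 'z) sd_graph_scheme \<Rightarrow> 'v list \<Rightarrow> 'e list \<Rightarrow> bool" where
  "sd_path N vs es \<longleftrightarrow> sd_walk N vs es \<and> distinct vs"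

definition sd_cycle :: "('v, 'e, 'z) sd_graph_scheme \<Rightarrow> 'v list \<Rightarrow> 'e list \<Rightarrow> bool" where
  "sd_cycle N vs es \<longleftrightarrow>
     sd_walk N vs es \<and> es \<noteq> [] \<and> hd vs = last vs \<and> distinct (tl vs) \<and> distinct es"

definition sdag :: "('v, 'e, 'z) sd_graph_scheme \<Rightarrow> bool" where
  "sdag N \<longleftrightarrow> semidirected_graph N \<and> \<not> (\<exists>vs es. sd_cycle N vs es)"

text \<open>\<open>num_paths N u x e\<close> is $m(u,x;e)$; the path of length 0 counts when \<open>u = x\<close>.\<close>

definition num_paths :: "('v, 'e, 'z) sd_graph_scheme \<Rightarrow> 'v \<Rightarrow> 'v \<Rightarrow> 'e \<Rightarrow> nat" where
  "num_paths N u x e =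
     card {(vs, es). sd_path N vs es \<and> hd vs = u \<and> last vs = x \<and> e \<notin> set es}"


section \<open>Contraction of undirected edges and root components\<close>

definition undir_rel :: "('v, 'e, 'z) sd_graph_scheme \<Rightarrow> ('v \<times> 'v) set" where
  "undir_rel N = {(x, y). \<exists>e \<in> uedges N. ends N e = {x, y}}"

definition undir_class :: "('v, 'e, 'z) sd_graph_scheme \<Rightarrow> 'v \<Rightarrow> 'v set" where
  "undir_class N v = {w. (v, w) \<in> (undir_rel N)\<^sup>*}"

definition contraction :: "('v, 'e, 'z) sd_graph_scheme \<Rightarrow> ('v set, 'e) sd_graph" where
  "contraction N =
     \<lparr> nodes = undir_class N ` nodes N, uedges = {}, dedges = dedges N,
       tail = (\<lambda>e. undir_class N (tail N e)), head = (\<lambda>e. undir_class N (head N e)) \<rparr>"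

text \<open>A root component, an induced subgraph, is represented by its set of nodes.\<close>

definition root_components :: "('v, 'e, 'z) sd_graph_scheme \<Rightarrow> 'v set set" where
  "root_components N = {T. is_root (contraction N) T}"

definition resolved :: "('v, 'e, 'z) sd_graph_scheme \<Rightarrow> 'v set \<Rightarrow> bool" where
  "resolved N T \<longleftrightarrow> (\<exists>v. T = {v} \<and> deg N v \<in> {0, 2})"

definition adm :: "('v, 'e, 'z) sd_graph_scheme \<Rightarrow> 'v set \<Rightarrow> 'e set" where
  "adm N T = {e \<in> edges N. ends N e \<subseteq> T} \<union> {e \<in> edges N. ends N e \<inter> T \<noteq> {}}"

definition complete_graph :: "('v, 'e, 'z) sd_graph_scheme \<Rightarrow> bool" where
  "complete_graph N \<longleftrightarrow>
     (\<forall>v e. is_leaf N v \<and> e \<in> incident_edges N v \<longrightarrow> e \<in> dedges N \<and> head N e = v) \<and>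
     (\<forall>C \<in> nodes (contraction N). card C > 1 \<longrightarrow> deg_i (contraction N) C = 0)"

definition binary_graph :: "('v, 'e, 'z) sd_graph_scheme \<Rightarrow> bool" where
  "binary_graph N \<longleftrightarrow>
     (\<forall>v \<in> nodes N.
        (is_root N v \<longrightarrow> deg N v \<in> {0, 2, 3}) \<and>
        (is_leaf N v \<longrightarrow> deg N v \<in> {0, 1}) \<and>
        (\<not> is_root N v \<and> \<not> is_leaf N v \<longrightarrow> deg N v = 3))"


section \<open>Networks and isomorphism\<close>

text \<open>Only the labels of leaves are meaningful.\<close>

record ('v, 'e) sd_net = "('v, 'e) sd_graph" +
  label :: "'v \<Rightarrow> nat"

definition L_network :: "nat set \<Rightarrow> ('v, 'e) sd_net \<Rightarrow> bool" where
  "L_network L N \<longleftrightarrow>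
     sdag N \<and> (\<forall>v. is_leaf N v \<longrightarrow> is_tree_node N v) \<and>
     inj_on (label N) {v. is_leaf N v} \<and> label N ` {v. is_leaf N v} \<subseteq> L"

definition isomorphic :: "('v, 'e) sd_net \<Rightarrow> ('w, 'f) sd_net \<Rightarrow> bool" where
  "isomorphic N M \<longleftrightarrow>
     (\<exists>f g. bij_betw f (nodes N) (nodes M) \<and>
        bij_betw g (uedges N) (uedges M) \<and> bij_betw g (dedges N) (dedges M) \<and>
        (\<forall>e \<in> uedges N. ends M (g e) = f ` ends N e) \<and>
        (\<forall>e \<in> dedges N. tail M (g e) = f (tail N e) \<and> head M (g e) = f (head N e)) \<and>
        (\<forall>v. is_leaf N v \<longrightarrow> label M (f v) = label N v))"


section \<open>Cherry reductions and orchard networks\<close>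

definition nonisolated_leaf :: "('v, 'e) sd_net \<Rightarrow> 'v \<Rightarrow> bool" where
  "nonisolated_leaf N v \<longleftrightarrow> is_leaf N v \<and> deg N v \<noteq> 0"

definition tree_cherry :: "('v, 'e) sd_net \<Rightarrow> 'v \<Rightarrow> 'v \<Rightarrow> 'v \<Rightarrow> bool" where
  "tree_cherry N a b p \<longleftrightarrow>
     a \<noteq> b \<and> nonisolated_leaf N a \<and> nonisolated_leaf N b \<and> is_parent N p a \<and> is_parent N p b"

definition reticulate_cherry :: "('v, 'e) sd_net \<Rightarrow> 'v \<Rightarrow> 'v \<Rightarrow> 'v \<Rightarrow> 'v \<Rightarrow> bool" where
  "reticulate_cherry N a b pa pb \<longleftrightarrow>
     a \<noteq> b \<and> nonisolated_leaf N a \<and> nonisolated_leaf N b \<and> is_parent N pa a \<and> is_parent N pb b \<and>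
     is_hybrid N pa \<and> is_parent N pb pa"

definition delete_edge :: "('v, 'e) sd_net \<Rightarrow> 'e \<Rightarrow> ('v, 'e) sd_net" where
  "delete_edge N e = N\<lparr>uedges := uedges N - {e}, dedges := dedges N - {e}\<rparr>"

definition delete_node :: "('v, 'e) sd_net \<Rightarrow> 'v \<Rightarrow> ('v, 'e) sd_net" where
  "delete_node N v =
     N\<lparr>nodes := nodes N - {v},
       uedges := uedges N - incident_edges N v, dedges := dedges N - incident_edges N v\<rparr>"

definition add_dedge :: "('v, 'e) sd_net \<Rightarrow> 'e \<Rightarrow> 'v \<Rightarrow> 'v \<Rightarrow> ('v, 'e) sd_net" where
  "add_dedge N f u w =
     N\<lparr>dedges := insert f (dedges N), tail := (tail N)(f := u), head := (head N)(f := w)\<rparr>"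

definition add_uedge :: "('v, 'e) sd_net \<Rightarrow> 'e \<Rightarrow> 'v \<Rightarrow> 'v \<Rightarrow> ('v, 'e) sd_net" where
  "add_uedge N f u w =
     N\<lparr>uedges := insert f (uedges N), tail := (tail N)(f := u), head := (head N)(f := w)\<rparr>"

definition suppressible :: "('v, 'e) sd_net \<Rightarrow> 'v \<Rightarrow> bool" where
  "suppressible N v \<longleftrightarrow>
     v \<in> nodes N \<and> \<not> is_leaf N v \<and>
     (deg N v = 2 \<and> {v} \<notin> root_components N \<or>
      deg N v = 1 \<and> {v} \<in> root_components N \<and> (\<exists>c. is_parent N v c \<and> is_tree_node N c))"

text \<open>
  Suppression is a relation because the identifier \<open>f\<close> of the new edge is arbitrary.  It may be
  that of a deleted edge, so a result exists even if the type of edges is finite.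
\<close>

inductive suppress :: "('v, 'e) sd_net \<Rightarrow> 'v \<Rightarrow> ('v, 'e) sd_net \<Rightarrow> bool"
  for N :: "('v, 'e) sd_net" and v :: 'v where
  suppress_deg1: "deg N v = 1 \<Longrightarrow> suppress N v (delete_node N v)"
| suppress_directed:
    "\<lbrakk>deg N v = 2; incident_edges N v = {e1, e2}; e1 \<noteq> e2; ends N e1 = {u, v};
      e2 \<in> dedges N; tail N e2 = v; head N e2 = w; f \<notin> edges (delete_node N v)\<rbrakk>
     \<Longrightarrow> suppress N v (add_dedge (delete_node N v) f u w)"
| suppress_undirected:
    "\<lbrakk>deg N v = 2; incident_edges N v = {e1, e2}; e1 \<noteq> e2; ends N e1 = {u, v}; ends N e2 = {v, w};
      \<not> (\<exists>e \<in> dedges N. tail N e = v); f \<notin> edges (delete_node N v)\<rbrakk>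
     \<Longrightarrow> suppress N v (add_uedge (delete_node N v) f u w)"

definition suppress_if_suppressible :: "('v, 'e) sd_net \<Rightarrow> 'v \<Rightarrow> ('v, 'e) sd_net \<Rightarrow> bool" where
  "suppress_if_suppressible N v N' \<longleftrightarrow>
     (if suppressible N v then suppress N v N' else N' = N)"

text \<open>
  If \<open>pb\<close> and \<open>pa\<close> are joined by parallel edges, deleting either of them gives isomorphic results.
\<close>

inductive cherry_reduction :: "('v, 'e) sd_net \<Rightarrow> 'v \<Rightarrow> 'v \<Rightarrow> ('v, 'e) sd_net \<Rightarrow> bool"
  for N :: "('v, 'e) sd_net" and a b :: 'v where
  reduce_tree_cherry:
    "\<lbrakk>tree_cherry N a b p; suppress_if_suppressible (delete_node N a) p N'\<rbrakk>
     \<Longrightarrow> cherry_reduction N a b N'"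
| reduce_reticulate_cherry:
    "\<lbrakk>reticulate_cherry N a b pa pb; e \<in> dedges N; tail N e = pb; head N e = pa;
      suppress_if_suppressible (delete_edge N e) pb M; suppress M pa N'\<rbrakk>
     \<Longrightarrow> cherry_reduction N a b N'"

definition trivial_forest :: "nat set \<Rightarrow> ('v, 'e) sd_net \<Rightarrow> bool" where
  "trivial_forest L N \<longleftrightarrow> edges N = {} \<and> bij_betw (label N) (nodes N) L"

definition orchard :: "('v, 'e) sd_net \<Rightarrow> bool" where
  "orchard N \<longleftrightarrow>
     (\<exists>F L. (\<lambda>M M'. \<exists>a b. cherry_reduction M a b M')\<^sup>*\<^sup>* N F \<and> trivial_forest L F)"

definition orchard_network :: "nat \<Rightarrow> ('v, 'e) sd_net \<Rightarrow> bool" where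
  "orchard_network n N \<longleftrightarrow>
     L_network {1..n} N \<and> complete_graph N \<and> binary_graph N \<and> orchard N"


section \<open>The \<mu>-representation\<close>

text \<open>Vectors of $\mathbb{Z}^{n+1}$ are functions that vanish outside the coordinates \<open>0, \<dots>, n\<close>.\<close>

type_synonym mu_vector = "nat \<Rightarrow> int"

datatype mu_tag = Tag_t | Tag_h | Tag_r | Tag_i

type_synonym mu_entry = "(mu_vector \<times> mu_tag) multiset"

definition unit_vector :: "nat \<Rightarrow> mu_vector" where
  "unit_vector a = (\<lambda>i. if i = a then 1 else 0)"

definition mu_vec :: "nat \<Rightarrow> ('v, 'e) sd_net \<Rightarrow> 'e \<Rightarrow> 'v \<Rightarrow> mu_vector" where
  "mu_vec n N e v =
     (\<lambda>i. if i = 0 then (\<Sum>h | is_hybrid N h. int (num_paths N v h e))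
          else if i \<le> n then (\<Sum>x | is_leaf N x \<and> label N x = i. int (num_paths N v x e))
          else 0)"

text \<open>
  For complete networks the sum below is the same for all edges of \<open>adm N T\<close>, so the choice of \<open>e\<close>
  is immaterial.
\<close>

definition mu_root_vec :: "nat \<Rightarrow> ('v, 'e) sd_net \<Rightarrow> 'v set \<Rightarrow> mu_vector" where
  "mu_root_vec n N T =
     (if \<exists>v. T = {v} \<and> deg N v = 0 then unit_vector (label N (the_elem T))
      else let e = (SOME e. e \<in> adm N T)
           in (\<lambda>i. mu_vec n N e (tail N e) i + mu_vec n N e (head N e) i))"

definition mu_root :: "nat \<Rightarrow> ('v, 'e) sd_net \<Rightarrow> 'v set \<Rightarrow> mu_entry" where
  "mu_root n N T = {# (mu_root_vec n N T, Tag_r) #}"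

definition unresolved_adm :: "('v, 'e) sd_net \<Rightarrow> 'e \<Rightarrow> 'v set \<Rightarrow> bool" where
  "unresolved_adm N e T \<longleftrightarrow> T \<in> root_components N \<and> \<not> resolved N T \<and> e \<in> adm N T"

text \<open>
  The vector tagged \<open>Tag_i\<close> is $\mu(T) - \mu(e,v) = \mu(e,u)$, where $u \to v$ is the edge.  Subtracting
  $\mu(e,u)$ instead would just repeat $\mu(e,v)$, and the resulting multiset would not determine an
  orchard network: let \<open>R \<rightarrow> h3 \<rightarrow> h1 \<rightarrow> a\<close>, \<open>R \<rightarrow> h2 \<rightarrow> h4 \<rightarrow> b\<close>, \<open>S \<rightarrow> p\<close>, \<open>T \<rightarrow> q\<close>, and let \<open>S\<close>, \<open>T\<close> be
  parents of \<open>h1, h2\<close> and \<open>h3, h4\<close> respectively, or the other way round.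
\<close>

definition mu_edge :: "nat \<Rightarrow> ('v, 'e) sd_net \<Rightarrow> 'e \<Rightarrow> mu_entry" where
  "mu_edge n N e =
     (let u = tail N e; v = head N e; \<tau> = (if is_hybrid N v then Tag_h else Tag_t)
      in if e \<in> uedges N then {# (mu_vec n N e v, Tag_t), (mu_vec n N e u, Tag_t) #}
         else if \<exists>T. unresolved_adm N e T
         then {# (mu_vec n N e v, \<tau>),
                 (\<lambda>i. mu_root_vec n N (THE T. unresolved_adm N e T) i - mu_vec n N e v i, Tag_i) #}
         else {# (mu_vec n N e v, \<tau>) #})"

definition mu_rep :: "nat \<Rightarrow> ('v, 'e) sd_net \<Rightarrow> mu_entry multiset" where
  "mu_rep n N =
     image_mset (mu_edge n N) (mset_set (edges N)) +
     image_mset (mu_root n N) (mset_set (root_components N))"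

definition multiset_sym_diff :: "'a multiset \<Rightarrow> 'a multiset \<Rightarrow> 'a multiset" where
  "multiset_sym_diff A B = (A - B) + (B - A)"

definition d_mu :: "nat \<Rightarrow> ('v, 'e) sd_net \<Rightarrow> ('w, 'f) sd_net \<Rightarrow> real" where
  "d_mu n N M = real (size (multiset_sym_diff (mu_rep n N) (mu_rep n M)))"

end

theory Submission
  imports Defs "HOL-Library.Function_Algebras"
begin

text \<open>
  An orchard network is rebuilt from its \<mu>-entries by following its cherry reductions
  backwards. It suffices that one of the two networks is orchard: a cherry of it can be read off
  the entries, hence is a cherry of every network with the same entries; the entries after the
  reduction are a linear function of those before it; and the reduction can be undone.

  Reductions are not performed on graphs. The leaves are cut off, so that the edges leading to
  them dangle and carry a label, and reducing a cherry merely moves labels to edges further up;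
  no edge is ever created, and degree-2 nodes do not have to be suppressed. Reducing a
  reticulate cherry becomes a composition: its hybrid node is split, whereby one of the two
  incoming edges is cut and gets a fresh label, and the tree cherry that results is reduced.

  Instead of counting paths in the reduced networks, we carry along vectors that satisfy the
  local recursion of path counts.
\<close>

section \<open>States\<close>

text \<open>
  The end of an arc: a leaf, given by its label, the child of a directed edge, or the other end
  of an undirected edge. An undirected edge is represented by two arcs of the last kind, one in
  each direction.
\<close>

datatype 'v target = Lf nat | Nd 'v | Ud 'v

type_synonym 'v arc = "'v \<times> 'v target"

definition outs :: "'v arc multiset \<Rightarrow> 'v \<Rightarrow> 'v arc multiset" where
  "outs D v = {#e \<in># D. fst e = v#}"

definition ins :: "'v arc multiset \<Rightarrow> 'v \<Rightarrow> nat" where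
  "ins D v = size {#e \<in># D. snd e = Nd v#}"

definition leaf_count :: "'v arc multiset \<Rightarrow> nat \<Rightarrow> nat" where
  "leaf_count D i = size {#e \<in># D. snd e = Lf i#}"

lemma outs_simps [simp]:
  "outs {#} v = {#}"
  "outs (add_mset e D) v = (if fst e = v then add_mset e (outs D v) else outs D v)"
  "outs (D + D') v = outs D v + outs D' v"
  by (auto simp: outs_def)

lemma ins_simps [simp]:
  "ins {#} v = 0"
  "ins (add_mset e D) v = (if snd e = Nd v then Suc (ins D v) else ins D v)"
  "ins (D + D') v = ins D v + ins D' v"
  by (auto simp: ins_def)

lemma leaf_count_simps [simp]:
  "leaf_count {#} i = 0"
  "leaf_count (add_mset e D) i = (if snd e = Lf i then Suc (leaf_count D i) else leaf_count D i)"
  "leaf_count (D + D') i = leaf_count D i + leaf_count D' i"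
  by (auto simp: leaf_count_def)

lemma in_outs_iff [simp]: "e \<in># outs D v \<longleftrightarrow> e \<in># D \<and> fst e = v"
  by (auto simp: outs_def)

lemma ins_0_iff: "ins D v = 0 \<longleftrightarrow> (\<forall>u. (u, Nd v) \<notin># D)"
  by (auto simp: ins_def filter_mset_eq_conv)

lemma leaf_count_0_iff: "leaf_count D i = 0 \<longleftrightarrow> (\<forall>u. (u, Lf i) \<notin># D)"
  by (auto simp: leaf_count_def filter_mset_eq_conv)

lemma outs_empty_iff: "outs D v = {#} \<longleftrightarrow> (\<forall>x. (v, x) \<notin># D)"
  by (auto simp: outs_def filter_mset_eq_conv)

text \<open>
  Acyclicity. A walk may follow one \<open>Ud\<close> arc by another, but not by its reverse.
\<close>

definition ranked :: "'v arc multiset \<Rightarrow> ('v arc \<Rightarrow> nat) \<Rightarrow> bool" where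
  "ranked D \<rho> \<longleftrightarrow>
     (\<forall>u v y. (u, Nd v) \<in># D \<and> (v, y) \<in># D \<and> (\<forall>i. y \<noteq> Lf i) \<longrightarrow> \<rho> (v, y) < \<rho> (u, Nd v)) \<and>
     (\<forall>u v y. (u, Ud v) \<in># D \<and> (v, y) \<in># D \<and> (\<forall>i. y \<noteq> Lf i) \<and> y \<noteq> Ud u \<longrightarrow>
        \<rho> (v, y) < \<rho> (u, Ud v))"

lemma ranked_mono:
  assumes "ranked D \<rho>" and "\<And>u x. (u, x) \<in># D' \<Longrightarrow> (\<forall>i. x \<noteq> Lf i) \<Longrightarrow> (u, x) \<in># D"
  shows "ranked D' \<rho>"
  using assms unfolding ranked_def by (metis target.distinct)

lemma ex_ranked_mono:
  assumes "\<exists>\<rho>. ranked D \<rho>" and "\<And>u x. (u, x) \<in># D' \<Longrightarrow> (\<forall>i. x \<noteq> Lf i) \<Longrightarrow> (u, x) \<in># D"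
  shows "\<exists>\<rho>. ranked D' \<rho>"
  using assms ranked_mono by metis

text \<open>
  In a state \<open>L\<close> contains all labels in use, \<open>W\<close> the nodes that are
  not leaves, \<open>D\<close> the arcs and \<open>I\<close> the labels of the isolated leaves.
  The pairs of degrees are those of hybrid nodes, tree nodes, resolved roots and nodes of
  unresolved root components, where each undirected edge counts as an outgoing arc.
\<close>

definition wf_state :: "nat set \<Rightarrow> 'v set \<Rightarrow> 'v arc multiset \<Rightarrow> nat set \<Rightarrow> bool" where
  "wf_state L W D I \<longleftrightarrow>
     finite W \<and> finite L \<and> 0 \<notin> L \<and> I \<subseteq> L \<and>
     (\<forall>u x. (u, x) \<in># D \<longrightarrow> u \<in> W) \<and>
     (\<forall>u i. (u, Lf i) \<in># D \<longrightarrow> i \<in> L \<and> i \<notin> I) \<and>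
     (\<forall>u v. (u, Nd v) \<in># D \<longrightarrow> v \<in> W) \<and>
     (\<forall>u v. (u, Ud v) \<in># D \<longrightarrow> (v, Ud u) \<in># D \<and> u \<noteq> v \<and> count D (u, Ud v) = 1 \<and>
        ins D u = 0 \<and> size (outs D u) = 3) \<and>
     (\<forall>i. leaf_count D i \<le> 1) \<and>
     (\<forall>v \<in> W. (ins D v, size (outs D v)) \<in> {(2, 1), (1, 2), (0, 2), (0, 3)}) \<and>
     (\<exists>\<rho>. ranked D \<rho>)"

lemma wf_stateD:
  assumes "wf_state L W D I"
  shows "finite W" "finite L" "0 \<notin> L" "I \<subseteq> L"
    "(u, x) \<in># D \<Longrightarrow> u \<in> W"
    "(u, Lf i) \<in># D \<Longrightarrow> i \<in> L" "(u, Lf i) \<in># D \<Longrightarrow> i \<notin> I"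
    "(u, Nd v) \<in># D \<Longrightarrow> v \<in> W"
    "(u, Ud v) \<in># D \<Longrightarrow> (v, Ud u) \<in># D" "(u, Ud v) \<in># D \<Longrightarrow> u \<noteq> v"
    "(u, Ud v) \<in># D \<Longrightarrow> count D (u, Ud v) = 1"
    "(u, Ud v) \<in># D \<Longrightarrow> ins D u = 0" "(u, Ud v) \<in># D \<Longrightarrow> size (outs D u) = 3"
    "leaf_count D i \<le> 1"
    "v \<in> W \<Longrightarrow> (ins D v, size (outs D v)) \<in> {(2, 1), (1, 2), (0, 2), (0, 3)}"
    "\<exists>\<rho>. ranked D \<rho>"
  using assms unfolding wf_state_def by blast+

text \<open>
  The first four rules reduce a tree cherry; they differ in the kind of the common parent
  \<open>p\<close>. The last one is the first half of the reduction of a reticulate cherry: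
  afterwards \<open>c\<close> and \<open>b\<close> form a tree cherry.
\<close>

inductive step :: "nat set \<times> 'v set \<times> 'v arc multiset \<times> nat set \<Rightarrow>
    nat set \<times> 'v set \<times> 'v arc multiset \<times> nat set \<Rightarrow> bool" where
  step_tree: "step (L, W, {#(u, Nd p), (p, Lf a), (p, Lf b)#} + D, I)
      (L, W - {p}, {#(u, Lf b)#} + D, I)"
| step_root2: "\<lbrakk>outs D p = {#}; ins D p = 0\<rbrakk> \<Longrightarrow>
    step (L, W, {#(p, Lf a), (p, Lf b)#} + D, I) (L, W - {p}, D, insert b I)"
| step_root3: "\<lbrakk>outs D p = {#(p, x)#}; \<forall>v. x \<noteq> Ud v\<rbrakk> \<Longrightarrow>
    step (L, W, {#(p, Lf a), (p, Lf b)#} + D, I) (L, W, {#(p, Lf b)#} + D, I)"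
| step_undir: "step (L, W, {#(u, Ud p), (p, Ud u), (p, Lf a), (p, Lf b)#} + D, I)
      (L, W - {p}, {#(u, Lf b)#} + D, I)"
| step_split: "\<lbrakk>c \<notin> L; c \<noteq> 0\<rbrakk> \<Longrightarrow>
    step (L, W, {#(p, Lf b), (p, Nd h), (q, Nd h), (h, Lf a)#} + D, I)
      (insert c L, W - {h}, {#(p, Lf b), (p, Lf c), (q, Lf a)#} + D, I)"

lemma wf_step_tree:
  assumes wf: "wf_state L W ({#(u, Nd p), (p, Lf a), (p, Lf b)#} + D) I" (is "wf_state _ _ ?D _")
  shows "u \<noteq> p" "outs D p = {#}" "ins D p = 0" "a \<noteq> b" "leaf_count D a = 0" "leaf_count D b = 0"
      "p \<in> W" "u \<in> W"
    "a \<in> L" "b \<in> L" "a \<notin> I" "b \<notin> I" "(p, Ud v) \<notin># D" "(v, Ud p) \<notin># D"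
    "wf_state L (W - {p}) ({#(u, Lf b)#} + D) I"
proof -
  note d = wf_stateD[OF wf]
  show pW: "p \<in> W" using d(5)[of p "Lf a"] by simp
  show "u \<in> W" using d(5)[of u "Nd p"] by simp
  note t = d(15)[OF pW]
  show up: "u \<noteq> p" using t by auto
  show o: "outs D p = {#}" and i: "ins D p = 0" using t up by (auto split: if_splits)
  show ab: "a \<noteq> b" using d(14)[of a] by (auto split: if_splits)
  show la: "leaf_count D a = 0" using d(14)[of a] by (auto split: if_splits)
  show lb: "leaf_count D b = 0" using d(14)[of b] by (auto split: if_splits)
  show "a \<in> L" "b \<in> L" "a \<notin> I" "b \<notin> I" using d(6,7)[of p a] d(6,7)[of p b] by auto
  have np: "(p, x) \<notin># D" "(x', Nd p) \<notin># D" for x x' using o i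
      by (auto simp: outs_empty_iff ins_0_iff)
  show un: "(p, Ud v) \<notin># D" "(v, Ud p) \<notin># D" for v
    using np d(9)[of v p] by (auto)
  show "wf_state L (W - {p}) ({#(u, Lf b)#} + D) I"
    unfolding wf_state_def
  proof (intro conjI allI impI ballI)
    show "\<exists>\<rho>. ranked ({#(u, Lf b)#} + D) \<rho>"
      by (rule ex_ranked_mono[OF d(16)]) auto
  next
    fix v assume v: "v \<in> W - {p}"
    show "(ins ({#(u, Lf b)#} + D) v, size (outs ({#(u, Lf b)#} +
        D) v)) \<in> {(2, 1), (1, 2), (0, 2), (0, 3)}"
      using d(15)[of v] v by (auto split: if_splits)
  next
    fix w v assume A: "(w, Ud v) \<in># {#(u, Lf b)#} + D"
    then have A: "(w, Ud v) \<in># ?D" and wp: "w \<noteq> p" using un by auto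
    show "(v, Ud w) \<in># {#(u, Lf b)#} + D" "w \<noteq> v" "count ({#(u, Lf b)#} + D) (w, Ud v) = 1"
       "ins ({#(u, Lf b)#} + D) w = 0" "size (outs ({#(u, Lf b)#} + D) w) = 3"
      using d(9-13)[OF A] wp by (auto split: if_splits)
  next
    fix w i assume "(w, Lf i) \<in># {#(u, Lf b)#} + D"
    then show "i \<in> L" "i \<notin> I"
      using d(6,7)[of w i] \<open>a \<in> L\<close> \<open>b \<in> L\<close> \<open>a \<notin> I\<close> \<open>b \<notin> I\<close> lb by (auto simp: leaf_count_0_iff)
  next
    fix w x assume "(w, x) \<in># {#(u, Lf b)#} + D"
    then show "w \<in> W - {p}" using d(5)[of w x] up np \<open>u \<in> W\<close> by auto
  next
    fix w v assume "(w, Nd v) \<in># {#(u, Lf b)#} + D"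
    then show "v \<in> W - {p}" using d(8)[of w v] up np \<open>u \<in> W\<close> by auto
  next
    fix i show "leaf_count ({#(u, Lf b)#} + D) i \<le> 1"
      using d(14)[of i] lb by (auto split: if_splits)
  qed (use d(1-4) \<open>b \<in> L\<close> in auto)
qed

lemma wf_step_root2:
  assumes wf: "wf_state L W ({#(p, Lf a), (p, Lf b)#} + D) I" (is "wf_state _ _ ?D _")
    and o: "outs D p = {#}" and i: "ins D p = 0"
  shows "a \<noteq> b" "leaf_count D a = 0" "leaf_count D b = 0" "p \<in> W"
    "a \<in> L" "b \<in> L" "a \<notin> I" "b \<notin> I" "(p, Ud v) \<notin># D" "(v, Ud p) \<notin># D"
    "wf_state L (W - {p}) D (insert b I)"
proof -
  note d = wf_stateD[OF wf]
  show pW: "p \<in> W" using d(5)[of p "Lf a"] by simp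
  show ab: "a \<noteq> b" using d(14)[of a] by (auto split: if_splits)
  show la: "leaf_count D a = 0" using d(14)[of a] by (auto split: if_splits)
  show lb: "leaf_count D b = 0" using d(14)[of b] by (auto split: if_splits)
  show "a \<in> L" "b \<in> L" "a \<notin> I" "b \<notin> I" using d(6,7)[of p a] d(6,7)[of p b] by auto
  have np: "(p, x) \<notin># D" "(x', Nd p) \<notin># D" for x x' using o i
      by (auto simp: outs_empty_iff ins_0_iff)
  show un: "(p, Ud v) \<notin># D" "(v, Ud p) \<notin># D" for v
    using np d(9)[of v p] by (auto)
  show "wf_state L (W - {p}) D (insert b I)"
    unfolding wf_state_def
  proof (intro conjI allI impI ballI)
    show "\<exists>\<rho>. ranked D \<rho>"
      by (rule ex_ranked_mono[OF d(16)]) auto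
  next
    fix v assume v: "v \<in> W - {p}"
    show "(ins D v, size (outs D v)) \<in> {(2, 1), (1, 2), (0, 2), (0, 3)}"
      using d(15)[of v] v by (auto split: if_splits)
  next
    fix w v assume A: "(w, Ud v) \<in># D"
    then have A: "(w, Ud v) \<in># ?D" and wp: "w \<noteq> p" using un by auto
    show "(v, Ud w) \<in># D" "w \<noteq> v" "count D (w, Ud v) = 1"
       "ins D w = 0" "size (outs D w) = 3"
      using d(9-13)[OF A] wp by (auto split: if_splits)
  next
    fix w i assume "(w, Lf i) \<in># D"
    then show "i \<in> L" "i \<notin> insert b I"
      using d(6,7)[of w i] \<open>a \<in> L\<close> \<open>b \<in> L\<close> \<open>a \<notin> I\<close> \<open>b \<notin> I\<close> lb by (auto simp: leaf_count_0_iff)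
  next
    fix w x assume "(w, x) \<in># D"
    then show "w \<in> W - {p}" using d(5)[of w x] np by auto
  next
    fix w v assume "(w, Nd v) \<in># D"
    then show "v \<in> W - {p}" using d(8)[of w v] np by auto
  next
    fix i show "leaf_count (D) i \<le> 1"
      using d(14)[of i] lb by (auto split: if_splits)
  qed (use d(1-4) \<open>b \<in> L\<close> in auto)
qed

lemma wf_step_root3:
  assumes wf: "wf_state L W ({#(p, Lf a), (p, Lf b)#} + D) I" (is "wf_state _ _ ?D _")
    and o: "outs D p = {#(p, x)#}" and x: "\<forall>v. x \<noteq> Ud v"
  shows "a \<noteq> b" "leaf_count D a = 0" "leaf_count D b = 0" "p \<in> W" "ins D p = 0"
    "a \<in> L" "b \<in> L" "a \<notin> I" "b \<notin> I" "(p, Ud v) \<notin># D" "(v, Ud p) \<notin># D"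
    "wf_state L W ({#(p, Lf b)#} + D) I"
proof -
  note d = wf_stateD[OF wf]
  show pW: "p \<in> W" using d(5)[of p "Lf a"] by simp
  note t = d(15)[OF pW]
  show ab: "a \<noteq> b" using d(14)[of a] by (auto split: if_splits)
  show i: "ins D p = 0" using t o by auto
  show la: "leaf_count D a = 0" using d(14)[of a] by (auto split: if_splits)
  show lb: "leaf_count D b = 0" using d(14)[of b] by (auto split: if_splits)
  show "a \<in> L" "b \<in> L" "a \<notin> I" "b \<notin> I" using d(6,7)[of p a] d(6,7)[of p b] by auto
  show un1: "(p, Ud v) \<notin># D" for v
  proof
    assume "(p, Ud v) \<in># D"
    then have "(p, Ud v) \<in># outs D p" by simp
    then show False using x by (auto simp: o)
  qed
  then show un2: "(v, Ud p) \<notin># D" for v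
    using d(9)[of v p] by auto
  show "wf_state L W ({#(p, Lf b)#} + D) I"
    unfolding wf_state_def
  proof (intro conjI allI impI ballI)
    show "\<exists>\<rho>. ranked ({#(p, Lf b)#} + D) \<rho>"
      by (rule ex_ranked_mono[OF d(16)]) auto
  next
    fix v assume v: "v \<in> W"
    show "(ins ({#(p, Lf b)#} + D) v, size (outs ({#(p, Lf b)#} +
        D) v)) \<in> {(2, 1), (1, 2), (0, 2), (0, 3)}"
      using d(15)[of v] v o i by (auto split: if_splits)
  next
    fix w v assume A: "(w, Ud v) \<in># {#(p, Lf b)#} + D"
    then have A: "(w, Ud v) \<in># ?D" and wp: "w \<noteq> p" using un1 by auto
    show "(v, Ud w) \<in># {#(p, Lf b)#} + D" "w \<noteq> v" "count ({#(p, Lf b)#} + D) (w, Ud v) = 1"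
       "ins ({#(p, Lf b)#} + D) w = 0" "size (outs ({#(p, Lf b)#} + D) w) = 3"
      using d(9-13)[OF A] wp by (auto split: if_splits)
  next
    fix w i assume "(w, Lf i) \<in># {#(p, Lf b)#} + D"
    then show "i \<in> L" "i \<notin> I"
      using d(6,7)[of w i] \<open>a \<in> L\<close> \<open>b \<in> L\<close> \<open>a \<notin> I\<close> \<open>b \<notin> I\<close> lb by (auto simp: leaf_count_0_iff)
  next
    fix w x assume "(w, x) \<in># {#(p, Lf b)#} + D"
    then show "w \<in> W" using d(5)[of w x] pW by auto
  next
    fix w v assume "(w, Nd v) \<in># {#(p, Lf b)#} + D"
    then show "v \<in> W" using d(8)[of w v] pW by auto
  next
    fix i show "leaf_count ({#(p, Lf b)#} + D) i \<le> 1"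
      using d(14)[of i] lb by (auto split: if_splits)
  qed (use d(1-4) \<open>b \<in> L\<close> in auto)
qed

lemma wf_step_undir:
  assumes wf: "wf_state L W ({#(u, Ud p), (p, Ud u), (p, Lf a), (p, Lf b)#} + D) I" (is
      "wf_state _ _ ?D _")
  shows "u \<noteq> p" "outs D p = {#}" "ins D p = 0" "a \<noteq> b" "leaf_count D a = 0" "leaf_count D b = 0"
      "p \<in> W" "u \<in> W"
    "a \<in> L" "b \<in> L" "a \<notin> I" "b \<notin> I" "(p, Ud v) \<notin># D" "(v, Ud p) \<notin># D" "ins D u = 0"
    "size (outs D u) = 2"
    "wf_state L (W - {p}) ({#(u, Lf b)#} + D) I"
proof -
  note d = wf_stateD[OF wf]
  show pW: "p \<in> W" using d(5)[of p "Lf a"] by simp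
  show "u \<in> W" using d(5)[of u "Ud p"] by simp
  note t = d(15)[OF pW]
  show up: "u \<noteq> p" using d(10)[of u p] by auto
  show o: "outs D p = {#}" and i: "ins D p = 0" using t up by (auto split: if_splits)
  show iu: "ins D u = 0" using d(12)[of u p] up by simp
  show ou: "size (outs D u) = 2" using d(13)[of u p] up by simp
  show ab: "a \<noteq> b" using d(14)[of a] by (auto split: if_splits)
  show la: "leaf_count D a = 0" using d(14)[of a] by (auto split: if_splits)
  show lb: "leaf_count D b = 0" using d(14)[of b] by (auto split: if_splits)
  show "a \<in> L" "b \<in> L" "a \<notin> I" "b \<notin> I" using d(6,7)[of p a] d(6,7)[of p b] by auto
  have np: "(p, x) \<notin># D" "(x', Nd p) \<notin># D" for x x' using o i
      by (auto simp: outs_empty_iff ins_0_iff)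
  show un: "(p, Ud v) \<notin># D" "(v, Ud p) \<notin># D" for v
  proof -
    show "(p, Ud v) \<notin># D" by (rule np)
    show "(v, Ud p) \<notin># D"
    proof (cases "v = u")
      case True
      have "count ?D (u, Ud p) = 1" using d(11)[of u p] by simp
      then have "count D (u, Ud p) = 0" using up by simp
      then show ?thesis using True by (simp add: not_in_iff)
    next
      case False
      then show ?thesis using np(1)[of "Ud v"] d(9)[of v p] up by auto
    qed
  qed
  show "wf_state L (W - {p}) ({#(u, Lf b)#} + D) I"
    unfolding wf_state_def
  proof (intro conjI allI impI ballI)
    show "\<exists>\<rho>. ranked ({#(u, Lf b)#} + D) \<rho>"
      by (rule ex_ranked_mono[OF d(16)]) auto
  next
    fix v assume v: "v \<in> W - {p}"
    show "(ins ({#(u, Lf b)#} + D) v, size (outs ({#(u, Lf b)#} +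
        D) v)) \<in> {(2, 1), (1, 2), (0, 2), (0, 3)}"
      using d(15)[of v] v by (auto split: if_splits)
  next
    fix w v assume "(w, Ud v) \<in># {#(u, Lf b)#} + D"
    then have A: "(w, Ud v) \<in># ?D" and wp: "w \<noteq> p" "v \<noteq> p" using un by auto
    show "(v, Ud w) \<in># {#(u, Lf b)#} + D" "w \<noteq> v" "count ({#(u, Lf b)#} + D) (w, Ud v) = 1"
       "ins ({#(u, Lf b)#} + D) w = 0" "size (outs ({#(u, Lf b)#} + D) w) = 3"
      using d(9-13)[OF A] wp by (auto split: if_splits)
  next
    fix w i assume "(w, Lf i) \<in># {#(u, Lf b)#} + D"
    then show "i \<in> L" "i \<notin> I"
      using d(6,7)[of w i] \<open>a \<in> L\<close> \<open>b \<in> L\<close> \<open>a \<notin> I\<close> \<open>b \<notin> I\<close> lb by (auto simp: leaf_count_0_iff)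
  next
    fix w x assume "(w, x) \<in># {#(u, Lf b)#} + D"
    then show "w \<in> W - {p}" using d(5)[of w x] up np \<open>u \<in> W\<close> by auto
  next
    fix w v assume "(w, Nd v) \<in># {#(u, Lf b)#} + D"
    then show "v \<in> W - {p}" using d(8)[of w v] up np \<open>u \<in> W\<close> by auto
  next
    fix i show "leaf_count ({#(u, Lf b)#} + D) i \<le> 1"
      using d(14)[of i] lb by (auto split: if_splits)
  qed (use d(1-4) \<open>b \<in> L\<close> in auto)
qed

lemma wf_step_split:
  assumes wf: "wf_state L W ({#(p, Lf b), (p, Nd h), (q, Nd h), (h, Lf a)#} + D) I" (is
      "wf_state _ _ ?D _")
    and c: "c \<notin> L" "c \<noteq> 0"
  shows "p \<noteq> h" "q \<noteq> h" "outs D h = {#}" "ins D h = 0" "a \<noteq> b" "leaf_count D a = 0"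
      "leaf_count D b = 0" "leaf_count D c = 0"
    "p \<in> W" "q \<in> W" "h \<in> W"
    "a \<in> L" "b \<in> L" "a \<notin> I" "b \<notin> I" "c \<notin> I" "(h, Ud v) \<notin># D" "(v, Ud h) \<notin># D"
    "wf_state (insert c L) (W - {h}) ({#(p, Lf b), (p, Lf c), (q, Lf a)#} + D) I" (is
        "wf_state _ _ ?D' _")
proof -
  note d = wf_stateD[OF wf]
  show hW: "h \<in> W" using d(5)[of h "Lf a"] by simp
  show pW: "p \<in> W" and qW: "q \<in> W" using d(5)[of p "Nd h"] d(5)[of q "Nd h"] by simp_all
  note t = d(15)[OF hW]
  show ph: "p \<noteq> h" and qh: "q \<noteq> h" using t by (auto split: if_splits)
  show o: "outs D h = {#}" and i: "ins D h = 0" using t ph qh by (auto split: if_splits)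
  show ab: "a \<noteq> b" using d(14)[of a] by (auto split: if_splits)
  show la: "leaf_count D a = 0" using d(14)[of a] by (auto split: if_splits)
  show lb: "leaf_count D b = 0" using d(14)[of b] by (auto split: if_splits)
  show lc: "leaf_count D c = 0" using c d(6)[of _ c] by (auto simp: leaf_count_0_iff)
  show "a \<in> L" "b \<in> L" "a \<notin> I" "b \<notin> I" using d(6,7)[of p b] d(6,7)[of h a] by auto
  show cI: "c \<notin> I" using c d(4) by auto
  have np: "(h, x) \<notin># D" "(x', Nd h) \<notin># D" for x x' using o i
      by (auto simp: outs_empty_iff ins_0_iff)
  show un: "(h, Ud v) \<notin># D" "(v, Ud h) \<notin># D" for v
    using np d(9)[of v h] by (auto)
  show "wf_state (insert c L) (W - {h}) ?D' I"
    unfolding wf_state_def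
  proof (intro conjI allI impI ballI)
    show "\<exists>\<rho>. ranked ?D' \<rho>"
      by (rule ex_ranked_mono[OF d(16)]) auto
  next
    fix v assume v: "v \<in> W - {h}"
    show "(ins ?D' v, size (outs ?D' v)) \<in> {(2, 1), (1, 2), (0, 2), (0, 3)}"
      using d(15)[of v] v by (auto split: if_splits)
  next
    fix w v assume "(w, Ud v) \<in># ?D'"
    then have A: "(w, Ud v) \<in># ?D" and wp: "w \<noteq> h" using un by auto
    show "(v, Ud w) \<in># ?D'" "w \<noteq> v" "count ?D' (w, Ud v) = 1"
       "ins ?D' w = 0" "size (outs ?D' w) = 3"
      using d(9-13)[OF A] wp by (auto split: if_splits)
  next
    fix w i assume "(w, Lf i) \<in># ?D'"
    then show "i \<in> insert c L" "i \<notin> I"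
      using d(6,7)[of w i] \<open>a \<in> L\<close> \<open>b \<in> L\<close> \<open>a \<notin> I\<close> \<open>b \<notin> I\<close> lb cI by (auto simp: leaf_count_0_iff)
  next
    fix w x assume "(w, x) \<in># ?D'"
    then show "w \<in> W - {h}" using d(5)[of w x] np ph qh pW qW by auto
  next
    fix w v assume "(w, Nd v) \<in># ?D'"
    then show "v \<in> W - {h}" using d(8)[of w v] np ph qh pW qW by auto
  next
    fix i show "leaf_count (?D') i \<le> 1"
      using d(14)[of i] lb la lc c d(6)[of p b] d(6)[of h a] by (auto split: if_splits)
  qed (use d(1-4) c in auto)
qed

section \<open>Valuations\<close>

text \<open>
  These rules would turn sums of vectors into abstractions as soon as a goal is eta-expanded.
\<close>

declare plus_fun_apply [simp del] zero_fun_apply [simp del]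

lemmas fun_apply = plus_fun_apply zero_fun_apply

definition arc_vec :: "('v \<Rightarrow> mu_vector) \<Rightarrow> ('v \<Rightarrow> 'v \<Rightarrow> mu_vector) \<Rightarrow> 'v arc \<Rightarrow> mu_vector" where
  "arc_vec P Q e = (case snd e of Lf i \<Rightarrow> unit_vector i | Nd v \<Rightarrow> P v | Ud v \<Rightarrow> Q (fst e) v)"

lemma arc_vec_simps [simp]:
  "arc_vec P Q (u, Lf i) = unit_vector i" "arc_vec P Q (u, Nd v) = P v"
      "arc_vec P Q (u, Ud v) = Q u v"
  by (simp_all add: arc_vec_def)

definition hyb :: "'v arc multiset \<Rightarrow> 'v \<Rightarrow> mu_vector" where
  "hyb D v = (if ins D v = 2 then unit_vector 0 else 0)"

text \<open>
  \<open>P v\<close> stands for the vector of path counts from \<open>v\<close>, and \<open>Q u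
  v\<close> that of the paths from \<open>v\<close> that avoid the undirected edge
  \<open>uv\<close>.
\<close>

definition valued :: "'v set \<Rightarrow> 'v arc multiset \<Rightarrow> ('v \<Rightarrow> mu_vector) \<Rightarrow> ('v \<Rightarrow> 'v \<Rightarrow> mu_vector) \<Rightarrow> bool"
    where
  "valued W D P Q \<longleftrightarrow>
     (\<forall>v \<in> W. P v = hyb D v + (\<Sum>e \<in># outs D v. arc_vec P Q e)) \<and>
     (\<forall>u v. (u, Ud v) \<in># D \<longrightarrow> P u = P v \<and> P u = Q u v + Q v u)"

definition wt :: "nat set \<Rightarrow> mu_vector \<Rightarrow> int" where
  "wt L x = (\<Sum>i \<in> L. x i)"

lemma wt_add [simp]: "wt L (x + y) = wt L x + wt L y"
  by (simp add: wt_def sum.distrib fun_apply)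

lemma wt_0 [simp]: "wt L 0 = 0"
  by (simp add: wt_def fun_apply)

lemma wt_sum_mset: "wt L (\<Sum>e \<in># A. f e) = (\<Sum>e \<in># A. wt L (f e))"
  by (induction A) simp_all

lemma wt_unit: "finite L \<Longrightarrow> wt L (unit_vector i) = (if i \<in> L then 1 else 0)"
  by (simp add: wt_def unit_vector_def)

lemma unit_vector_inject [simp]: "unit_vector i = unit_vector j \<longleftrightarrow> i = j"
  by (metis unit_vector_def zero_neq_one)

lemma unit_vector_apply: "unit_vector i j = (if j = i then 1 else 0)"
  by (simp add: unit_vector_def)

lemma unit_vector_nonneg: "0 \<le> unit_vector i j"
  by (simp add: unit_vector_def)

lemma sum_mset_fun_apply: "(\<Sum>e \<in># A. f e) i = (\<Sum>e \<in># A. f e i)"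
  for f :: "'a \<Rightarrow> mu_vector"
  by (induction A) (auto simp: fun_apply)

lemma sum_mset_ge_size:
  fixes f :: "'a \<Rightarrow> int"
  assumes "\<And>e. e \<in># A \<Longrightarrow> 1 \<le> f e"
  shows "int (size A) \<le> (\<Sum>e \<in># A. f e)"
  using assms by (induction A) force+

lemma sum_mset_nonneg_int:
  fixes f :: "'a \<Rightarrow> int"
  assumes "\<And>e. e \<in># A \<Longrightarrow> 0 \<le> f e"
  shows "0 \<le> (\<Sum>e \<in># A. f e)"
  using assms by (induction A) auto

locale valued_state =
  fixes L :: "nat set" and W :: "'v set" and D :: "'v arc multiset" and I :: "nat set"
    and P :: "'v \<Rightarrow> mu_vector" and Q :: "'v \<Rightarrow> 'v \<Rightarrow> mu_vector"
  assumes wf: "wf_state L W D I" and valued: "valued W D P Q"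
begin

lemmas wfD = wf_stateD[OF wf]

abbreviation vl :: "'v arc \<Rightarrow> mu_vector" where "vl \<equiv> arc_vec P Q"

lemma P_eq: "v \<in> W \<Longrightarrow> P v = hyb D v + (\<Sum>e \<in># outs D v. vl e)"
  using valued by (simp add: valued_def)

lemma Ud_eq: "(u, Ud v) \<in># D \<Longrightarrow> P u = P v" "(u, Ud v) \<in># D \<Longrightarrow> P u = Q u v + Q v u"
  using valued unfolding valued_def by blast+

lemma Q_eq:
  assumes "(u, Ud v) \<in># D"
  shows "Q u v = (\<Sum>e \<in># outs D v - {#(v, Ud u)#}. vl e)" "size (outs D v - {#(v, Ud u)#}) = 2"
proof -
  have 1: "(v, Ud u) \<in># D" using wfD(9)[OF assms] .
  then have 2: "v \<in> W" "ins D v = 0" "size (outs D v) = 3" using wfD(5,12,13) by blast+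
  have 3: "outs D v = add_mset (v, Ud u) (outs D v - {#(v, Ud u)#})" using 1 by simp
  have "P v = Q v u + (\<Sum>e \<in># outs D v - {#(v, Ud u)#}. vl e)"
    using P_eq[OF 2(1)] 2(2) by (subst (asm) 3) (simp add: hyb_def)
  moreover have "P v = Q v u + Q u v" using Ud_eq(2)[OF 1] .
  ultimately show "Q u v = (\<Sum>e \<in># outs D v - {#(v, Ud u)#}. vl e)" by simp
  show "size (outs D v - {#(v, Ud u)#}) = 2" using 1 2(3) by (simp add: size_Diff_singleton)
qed

lemma Ud_outs:
  assumes "(u, Ud v) \<in># D" "e \<in># outs D v - {#(v, Ud u)#}"
  shows "e \<in># D" "e \<noteq> (v, Ud u)" "fst e = v"
proof -
  show "e \<in># D" "fst e = v" using in_diffD[OF assms(2)] by auto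
  have 1: "(v, Ud u) \<in># D" using wfD(9)[OF assms(1)] .
  have "count (outs D v) (v, Ud u) = 1" using wfD(11)[OF 1] by (simp add: outs_def)
  then show "e \<noteq> (v, Ud u)" using assms(2) by (auto simp: in_diff_count)
qed

lemma arc_cases:
  assumes "e \<in># D"
  obtains (leaf) u i where "e = (u, Lf i)" "i \<in> L"
  | (tree) u v where "e = (u, Nd v)" "v \<in> W" "ins D v = 1" "size (outs D v) = 2"
  | (hybrid) u v where "e = (u, Nd v)" "v \<in> W" "ins D v = 2" "size (outs D v) = 1"
  | (undir) u v where "e = (u, Ud v)"
proof -
  obtain u x where e: "e = (u, x)" by (cases e)
  show thesis
  proof (cases x)
    case (Lf i) then show thesis using leaf e wfD(6)[of u i] assms by auto
  next
    case (Nd v)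
    then have v: "v \<in> W" "ins D v \<noteq> 0" using e assms wfD(8) by (auto simp: ins_0_iff)
    then show thesis using tree hybrid wfD(15)[OF v(1)] e Nd by auto
  next
    case (Ud v) then show thesis using undir e by auto
  qed
qed

lemma arc_vec_pos: "e \<in># D \<Longrightarrow> 1 \<le> wt L (vl e) \<and> (\<forall>i. 0 \<le> vl e i)"
proof -
  obtain \<rho> where \<rho>: "ranked D \<rho>" using wfD(16) by blast
  show "e \<in># D \<Longrightarrow> ?thesis"
  proof (induction "\<rho> e" arbitrary: e rule: less_induct)
    case less
    have node: "1 \<le> wt L (P v) \<and> (\<forall>i. 0 \<le> P v i)" if e: "e = (u, Nd v)" "v \<in> W"
        "size (outs D v) \<ge> 1" for u v
    proof -
      have IH: "1 \<le> wt L (vl f) \<and> (\<forall>i. 0 \<le> vl f i)" if f: "f \<in># outs D v" for f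
      proof (cases "\<exists>i. snd f = Lf i")
        case True
        then show ?thesis using wfD(2,6) f
          by (cases f) (auto simp: wt_unit unit_vector_nonneg)
      next
        case False
        then have "\<rho> f < \<rho> e" using \<rho> f less.prems e unfolding ranked_def by (cases f) auto
        then show ?thesis using less.hyps f by auto
      qed
      have h: "0 \<le> wt L (hyb D v)" "0 \<le> hyb D v i" for i
        using wfD(2) by (auto simp: hyb_def wt_unit unit_vector_nonneg fun_apply)
      have "1 \<le> wt L (P v)"
        using sum_mset_ge_size[of "outs D v" "\<lambda>e. wt L (vl e)"] IH P_eq[OF e(2)] e(3) h(1)
        by (auto simp: wt_sum_mset)
      moreover have "0 \<le> P v i" for i
        unfolding P_eq[OF e(2)] fun_apply sum_mset_fun_apply
        by (intro add_nonneg_nonneg sum_mset_nonneg_int) (use IH h(2) in auto)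
      ultimately show ?thesis by simp
    qed
    from less.prems show ?case
    proof (cases rule: arc_cases)
      case (leaf u i)
      then show ?thesis using wfD(2) by (simp add: wt_unit unit_vector_nonneg)
    next
      case (undir u v)
      then have a: "(u, Ud v) \<in># D" using less.prems by simp
      have IH: "1 \<le> wt L (vl f) \<and> (\<forall>i. 0 \<le> vl f i)" if f: "f \<in># outs D v - {#(v, Ud u)#}" for f
      proof (cases "\<exists>i. snd f = Lf i")
        case True
        then show ?thesis using wfD(2,6) Ud_outs[OF a f]
          by (cases f) (auto simp: wt_unit unit_vector_nonneg)
      next
        case False
        then have "\<rho> f < \<rho> e" using \<rho> Ud_outs[OF a f] a undir unfolding ranked_def by (cases f) auto
        then show ?thesis using less.hyps Ud_outs[OF a f] by blast
      qed
      have "1 \<le> wt L (Q u v)"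
        using sum_mset_ge_size[of "outs D v - {#(v, Ud u)#}" "\<lambda>e. wt L (vl e)"] IH Q_eq[OF a]
        by (auto simp: wt_sum_mset)
      moreover have "0 \<le> Q u v i" for i
        using IH unfolding Q_eq[OF a] sum_mset_fun_apply by (intro sum_mset_nonneg_int) auto
      ultimately show ?thesis using undir by simp
    next
      case (tree u v)
      then show ?thesis using node[of u v] by simp
    next
      case (hybrid u v)
      then show ?thesis using node[of u v] by simp
    qed
  qed
qed

lemma wt_val: "e \<in># D \<Longrightarrow> 1 \<le> wt L (vl e)" and arc_vec_nonneg: "e \<in># D \<Longrightarrow> 0 \<le> vl e i"
  using arc_vec_pos by auto

lemma wt_outs_ge: "int (size (outs D v)) \<le> wt L (\<Sum>e \<in># outs D v. vl e)"
  using wt_val by (auto simp: wt_sum_mset intro!: sum_mset_ge_size)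

lemma wt_tree_ge: "v \<in> W \<Longrightarrow> int (size (outs D v)) \<le> wt L (P v)"
  using wt_outs_ge[of v] P_eq wfD(2,3) by (auto simp: hyb_def wt_unit)

lemma wt_Ud_ge:
  assumes "(u, Ud v) \<in># D"
  shows "2 \<le> wt L (Q u v)"
proof -
  have "int (size (outs D v - {#(v, Ud u)#})) \<le> (\<Sum>e \<in># outs D v - {#(v, Ud u)#}. wt L (vl e))"
    by (rule sum_mset_ge_size) (use Ud_outs(1)[OF assms] wt_val in blast)
  then show ?thesis unfolding Q_eq(1)[OF assms] Q_eq(2)[OF assms] wt_sum_mset by simp
qed

lemma hyb_val_0: "(u, Nd v) \<in># D \<Longrightarrow> ins D v = 2 \<Longrightarrow> 1 \<le> P v 0"
  using P_eq[of v] wfD(8)[of u v] sum_mset_nonneg_int[of "outs D v" "\<lambda>e. vl e 0"] arc_vec_nonneg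
  by (auto simp: hyb_def sum_mset_fun_apply unit_vector_apply fun_apply)

lemma weight_1_leaf:
  assumes "e \<in># D" "wt L (vl e) = 1" "vl e 0 = 0"
  obtains u i where "e = (u, Lf i)"
  using assms(1)
proof (cases rule: arc_cases)
  case (tree u v) then show ?thesis using wt_tree_ge[of v] assms by simp
next
  case (hybrid u v) then show ?thesis using hyb_val_0[of u v] assms by simp
next
  case (undir u v) then show ?thesis using wt_Ud_ge[of u v] assms by simp
qed (use that in auto)

lemma weight_1_hybrid:
  assumes "e \<in># D" "wt L (vl e) = 1" "vl e 0 = 1"
  obtains u h i where "e = (u, Nd h)" "ins D h = 2" "outs D h = {#(h, Lf i)#}"
    "P h = unit_vector 0 + unit_vector i"
  using assms(1)
proof (cases rule: arc_cases)
  case (leaf u i) then show ?thesis using wfD(3) assms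
      by (auto simp: unit_vector_apply split: if_splits)
next
  case (tree u v) then show ?thesis using wt_tree_ge[of v] assms by simp
next
  case (hybrid u v)
  then obtain f where f: "outs D v = {#f#}" by (metis size_1_singleton_mset)
  have f': "f \<in># D" "fst f = v" using f in_outs_iff[of f D v] by auto
  have "P v = unit_vector 0 + vl f" using P_eq[OF hybrid(2)] hybrid f by (simp add: hyb_def)
  then have "wt L (P v) = wt L (vl f)" "P v 0 = 1 + vl f 0"
    using wfD(2,3) by (simp_all add: wt_unit unit_vector_apply fun_apply)
  then have "wt L (vl f) = 1" "vl f 0 = 0" using assms hybrid by simp_all
  then obtain u' i where "f = (u', Lf i)" using weight_1_leaf f' by blast
  then show ?thesis using that[of u v i] hybrid f f' \<open>P v = _\<close> by auto
next
  case (undir u v) then show ?thesis using wt_Ud_ge[of u v] assms by simp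
qed

lemma arc_vec_unit_leaf:
  assumes "e \<in># D" "vl e = unit_vector b" "b \<in> L"
  shows "e = (fst e, Lf b)"
proof -
  have "b \<noteq> 0" using assms(3) wfD(3) by metis
  then have "wt L (vl e) = 1" "vl e 0 = 0" using assms wfD(2)
      by (simp_all add: wt_unit unit_vector_apply)
  then obtain u i where "e = (u, Lf i)" using weight_1_leaf assms(1) by blast
  then show ?thesis using assms by simp
qed

lemma Lf_unique:
  assumes "(u, Lf i) \<in># D" "(v, Lf i) \<in># D"
  shows "u = v"
proof (rule ccontr)
  assume "u \<noteq> v"
  obtain D' where D': "D = add_mset (u, Lf i) D'" using assms(1) by (metis insert_DiffM)
  then have "(v, Lf i) \<in># D'" using assms(2) \<open>u \<noteq> v\<close> by auto
  then obtain D'' where "D' = add_mset (v, Lf i) D''" by (metis insert_DiffM)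
  then show False using wfD(14)[of i] D' by simp
qed

end

section \<open>Recognising cherries from the entries\<close>

text \<open>\<open>Tag_i\<close> is used to mark the two arcs of an undirected edge.\<close>

definition arc_tag :: "'v arc multiset \<Rightarrow> 'v arc \<Rightarrow> mu_tag" where
  "arc_tag D e = (case snd e of Lf _ \<Rightarrow> Tag_t | Nd v \<Rightarrow>
      if ins D v = 2 then Tag_h else Tag_t | Ud _ \<Rightarrow> Tag_i)"

lemma arc_tag_simps [simp]:
  "arc_tag D (u, Lf i) = Tag_t" "arc_tag D (u, Nd v) = (if ins D v = 2 then Tag_h else Tag_t)"
      "arc_tag D (u, Ud v) = Tag_i"
  by (simp_all add: arc_tag_def)

type_synonym arc_entry = "mu_vector \<times> mu_tag \<times> mu_vector option"

text \<open>
  The third component records $\mu(T)$ if the arc starts in an unresolved root component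
  \<open>T\<close>; this is the sum of the two vectors of the \<mu>-entry of the edge.
\<close>

definition entry_of :: "'v arc multiset \<Rightarrow> ('v \<Rightarrow> mu_vector) \<Rightarrow> ('v \<Rightarrow> 'v \<Rightarrow> mu_vector) \<Rightarrow> 'v arc \<Rightarrow>
    arc_entry" where
  "entry_of D P Q e = (arc_vec P Q e, arc_tag D e,
      if size (outs D (fst e)) = 3 then Some (P (fst e)) else None)"

definition arc_entries :: "'v arc multiset \<Rightarrow> ('v \<Rightarrow> mu_vector) \<Rightarrow> ('v \<Rightarrow> 'v \<Rightarrow> mu_vector) \<Rightarrow> arc_entry
    multiset" where
  "arc_entries D P Q = image_mset (entry_of D P Q) D"

text \<open>
  A set is enough: the multiplicities of the root entries are not used in the reconstruction.
\<close>

definition root_vectors :: "'v set \<Rightarrow> 'v arc multiset \<Rightarrow> nat set \<Rightarrow> ('v \<Rightarrow> mu_vector) \<Rightarrow> mu_vector set"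
    where
  "root_vectors W D I P = P ` {v \<in> W. ins D v = 0} \<union> unit_vector ` I"

lemma unit_sum_eq:
  assumes "unit_vector i + unit_vector j = unit_vector a + unit_vector b"
  shows "i = a \<and> j = b \<or> i = b \<and> j = a"
  using fun_cong[OF assms, of i] fun_cong[OF assms, of j] fun_cong[OF assms, of a]
      fun_cong[OF assms, of b]
  by (auto simp: unit_vector_apply fun_apply split: if_splits)

lemma mset_size_2: "size A = 2 \<Longrightarrow> \<exists>x y. A = {#x, y#}"
  by (metis Suc_1 size_1_singleton_mset size_eq_Suc_imp_eq_union One_nat_def add_mset_add_single
      Suc_eq_plus1 size_Suc_Diff1 add_diff_cancel_right' size_add_mset)

context valued_state
begin

lemma P_nonhybrid: "v \<in> W \<Longrightarrow> size (outs D v) \<noteq> 1 \<Longrightarrow> P v = (\<Sum>e \<in># outs D v. vl e)"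
  using P_eq[of v] wfD(15)[of v] by (auto simp: hyb_def)

lemma pair_weight_1:
  assumes "e1 \<in># D" "e2 \<in># D" "wt L (vl e1 + vl e2) = 2"
  shows "wt L (vl e1) = 1" "wt L (vl e2) = 1"
  using wt_val[OF assms(1)] wt_val[OF assms(2)] assms(3) by auto

lemma tree_cherry_arcs:
  assumes e: "e1 \<in># D" "e2 \<in># D" "fst e1 = p" "fst e2 = p"
    and s: "vl e1 + vl e2 = unit_vector a + unit_vector b" and ab: "a \<in> L" "b \<in> L"
  shows "{#e1, e2#} = {#(p, Lf a), (p, Lf b)#}"
proof -
  have nz: "a \<noteq> 0" "b \<noteq> 0" using ab wfD(3) by metis+
  have w: "wt L (vl e1) = 1" "wt L (vl e2) = 1"
    using pair_weight_1[OF e(1,2)] ab wfD(2) by (simp_all add: s wt_unit del: wt_add) (simp_all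
        add: wt_unit)
  have "vl e1 0 + vl e2 0 = 0" using fun_cong[OF s, of 0] nz
      by (simp add: unit_vector_apply fun_apply)
  then have z: "vl e1 0 = 0" "vl e2 0 = 0" using arc_vec_nonneg[OF e(1), of 0]
      arc_vec_nonneg[OF e(2), of 0] by auto
  obtain u i where 1: "e1 = (u, Lf i)" using weight_1_leaf[OF e(1) w(1) z(1)] .
  obtain v j where 2: "e2 = (v, Lf j)" using weight_1_leaf[OF e(2) w(2) z(2)] .
  have "i = a \<and> j = b \<or> i = b \<and> j = a" using unit_sum_eq s by (simp add: 1 2)
  then show ?thesis using 1 2 e by auto
qed

lemma hybrid_arc:
  assumes "e \<in># D" "vl e = unit_vector 0 + unit_vector a" "a \<in> L"
  obtains u h where "e = (u, Nd h)" "ins D h = 2" "outs D h = {#(h, Lf a)#}"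
proof -
  have nz: "a \<noteq> 0" using assms(3) wfD(3) by metis
  have "wt L (vl e) = 1" "vl e 0 = 1" using assms nz wfD(2,3)
      by (simp_all add: wt_unit unit_vector_apply fun_apply)
  then obtain u h i where *: "e = (u, Nd h)" "ins D h = 2" "outs D h = {#(h, Lf i)#}"
    "P h = unit_vector 0 + unit_vector i" using weight_1_hybrid assms(1) by blast
  then have "i = a" using assms(2) by simp
  then show ?thesis using that * by blast
qed

lemma reticulate_cherry_arcs:
  assumes e: "e1 \<in># D" "e2 \<in># D" "fst e1 = p" "fst e2 = p"
    and s: "vl e1 + vl e2 = unit_vector 0 + unit_vector a + unit_vector b" and ab: "a \<in> L" "b \<in> L"
  obtains h where "ins D h = 2"
    "{#e1, e2#} = {#(p, Lf b), (p, Nd h)#} \<and> (h, Lf a) \<in># D \<or> {#e1, e2#} = {#(p, Lf a), (p, Nd h)#}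
        \<and> (h, Lf b) \<in># D"
proof -
  note result = that
  have nz: "a \<noteq> 0" "b \<noteq> 0" using ab wfD(3) by metis+
  have w: "wt L (vl e1) = 1" "wt L (vl e2) = 1"
    using pair_weight_1[OF e(1,2)] ab wfD(2,3) by (simp_all add: s wt_unit del: wt_add) (simp_all
        add: wt_unit)
  have z: "vl e1 0 + vl e2 0 = 1" using fun_cong[OF s, of 0] nz
      by (simp add: unit_vector_apply fun_apply)
  have key: thesis if f: "f1 \<in># D" "f2 \<in># D" "fst f1 = p" "fst f2 = p" "{#e1, e2#} = {#f1, f2#}"
      "vl f1 + vl f2 = unit_vector 0 + unit_vector a + unit_vector b"
      "wt L (vl f1) = 1" "wt L (vl f2) = 1" "vl f1 0 = 0" "vl f2 0 = 1" for f1 f2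
  proof -
    obtain u i where 1: "f1 = (u, Lf i)" using weight_1_leaf[OF f(1) f(7) f(9)] .
    obtain v h j where 2: "f2 = (v, Nd h)" "ins D h = 2" "outs D h = {#(h, Lf j)#}"
      "P h = unit_vector 0 + unit_vector j" using weight_1_hybrid[OF f(2) f(8) f(10)] .
    have "unit_vector i + unit_vector j = unit_vector a + unit_vector b"
      using f(6) unfolding 1 2(1) by (simp add: 2(4) algebra_simps)
    then have "i = a \<and> j = b \<or> i = b \<and> j = a" using unit_sum_eq by blast
    moreover have "(h, Lf j) \<in># D" using in_outs_iff[of "(h, Lf j)" D h] 2(3) by simp
    ultimately show thesis using result[OF 2(2)] 1 2(1) f(3-5) by auto
  qed
  show thesis
  proof (cases "vl e1 0 = 0")
    case True
    show thesis by (rule key[of e1 e2]) (use e s w z True in auto)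
  next
    case False
    then have "vl e2 0 = 0" "vl e1 0 = 1"
      using z arc_vec_nonneg[OF e(1), of 0] arc_vec_nonneg[OF e(2), of 0] by auto
    show thesis
      by (rule key[of e2 e1]) (use e s w \<open>vl e2 0 = 0\<close> \<open>vl e1 0 = 1\<close> in \<open>auto simp: add.commute\<close>)
  qed
qed

end

lemma pair_transfer:
  assumes 1: "valued_state L W1 D1 I1 P1 Q1" and 2: "valued_state L W2 D2 I2 P2 Q2"
    and arc_entries: "arc_entries D1 P1 Q1 = arc_entries D2 P2 Q2"
        and root_vectors: "root_vectors W1 D1 I1 P1 = root_vectors W2 D2 I2 P2"
    and p: "p \<in> W1" "outs D1 p = {#e1, e2#} + R"
    and c: "arc_vec P1 Q1 e1 + arc_vec P1 Q1 e2 = c" "wt L c = 2"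
  obtains p2 f1 f2 R2 where "p2 \<in> W2" "outs D2 p2 = {#f1, f2#} + R2" "arc_vec P2 Q2 f1 +
      arc_vec P2 Q2 f2 = c"
    "ins D2 p2 = ins D1 p" "image_mset (entry_of D2 P2 Q2) R2 = image_mset (entry_of D1 P1 Q1) R"
proof -
  interpret A: valued_state L W1 D1 I1 P1 Q1 by fact
  interpret B: valued_state L W2 D2 I2 P2 Q2 by fact
  have Pp: "P1 p = c + (\<Sum>e \<in># R. arc_vec P1 Q1 e)"
    using A.P_nonhybrid[OF p(1)] p(2) c(1) by (simp add: add.assoc)
  from A.wfD(15)[OF p(1)] p(2)
  consider (tree) "ins D1 p = 1" "R = {#}" | (root2) "ins D1 p = 0" "R = {#}" | (root3)
      "ins D1 p = 0" "size R = 1"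
    by auto
  then show thesis
  proof cases
    case tree
    then obtain u where u: "(u, Nd p) \<in># D1" using ins_0_iff[of D1 p] by auto
    then have "entry_of D1 P1 Q1 (u, Nd p) \<in># arc_entries D2 P2 Q2" unfolding arc_entries[symmetric]
        by (auto simp: arc_entries_def)
    then obtain e where e: "e \<in># D2" "entry_of D2 P2 Q2 e = entry_of D1 P1 Q1 (u, Nd p)"
        by (auto simp: arc_entries_def)
    then have e': "arc_vec P2 Q2 e = c" "arc_tag D2 e = Tag_t" using tree Pp
        by (auto simp: entry_of_def)
    from e(1) show thesis
    proof (cases rule: B.arc_cases)
      case (leaf u i)
      then show ?thesis using e' c(2) A.wfD(2) by (auto simp: wt_unit)
    next
      case (tree w v)
      then obtain f1 f2 where f: "outs D2 v = {#f1, f2#}" using mset_size_2 by blast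
      then have "arc_vec P2 Q2 f1 + arc_vec P2 Q2 f2 = c" using B.P_nonhybrid[OF tree(2)] tree e'
          by simp
      then show thesis using that[of v f1 f2 "{#}"] tree f \<open>ins D1 p = 1\<close> \<open>R = {#}\<close> by simp
    qed (use e' in auto)
  next
    case root2
    then have "c \<in> root_vectors W2 D2 I2 P2" unfolding root_vectors[symmetric] using Pp p(1)
        by (auto simp: root_vectors_def)
    moreover have "c \<noteq> unit_vector i" for i using c(2) wt_unit[OF A.wfD(2), of i]
        by (auto split: if_splits)
    ultimately obtain v where v: "v \<in> W2" "ins D2 v = 0" "P2 v = c" by (auto simp: root_vectors_def)
    then have "size (outs D2 v) = 2" using B.wt_tree_ge[of v] B.wfD(15)[of v] c(2) by auto
    then obtain f1 f2 where f: "outs D2 v = {#f1, f2#}" using mset_size_2 by blast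
    then have "arc_vec P2 Q2 f1 + arc_vec P2 Q2 f2 = c" using B.P_nonhybrid[OF v(1)] v by simp
    then show thesis using that[of v f1 f2 "{#}"] v f root2 by simp
  next
    case root3
    then obtain e3 where R: "R = {#e3#}" by (metis size_1_singleton_mset)
    have e3: "e3 \<in># D1" "fst e3 = p" using p(2) in_outs_iff[of e3 D1 p] by (auto simp: R)
    then have "entry_of D1 P1 Q1 e3 \<in># arc_entries D2 P2 Q2" unfolding arc_entries[symmetric]
        by (auto simp: arc_entries_def)
    then obtain e where e: "e \<in># D2" "entry_of D2 P2 Q2 e = entry_of D1 P1 Q1 e3"
        by (auto simp: arc_entries_def)
    have "size (outs D1 p) = 3" using p(2) R by simp
    then have e': "arc_vec P2 Q2 e = arc_vec P1 Q1 e3" "size (outs D2 (fst e)) = 3"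
        "P2 (fst e) = P1 p"
      using e(2) e3 by (auto simp: entry_of_def split: if_splits)
    define p2 where "p2 = fst e"
    have p2: "p2 \<in> W2" using B.wfD(5)[of p2 "snd e"] e(1) by (simp add: p2_def)
    have o: "outs D2 p2 = add_mset e (outs D2 p2 - {#e#})" using e(1) by (simp add: p2_def)
    then have "size (outs D2 p2 - {#e#}) = 2" using e'(2) e(1)
        by (simp add: p2_def size_Diff_singleton)
    then obtain f1 f2 where f: "outs D2 p2 - {#e#} = {#f1, f2#}" using mset_size_2 by blast
    have o: "outs D2 p2 = {#e, f1, f2#}" using o f by simp
    have "P2 p2 = arc_vec P2 Q2 e + (arc_vec P2 Q2 f1 + arc_vec P2 Q2 f2)"
      using B.P_nonhybrid[OF p2] o by simp
    moreover have "P2 p2 = c + arc_vec P2 Q2 e" using Pp e' R by (simp add: p2_def)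
    ultimately have "arc_vec P2 Q2 f1 + arc_vec P2 Q2 f2 = c" by (simp add: add.commute)
    moreover have "ins D2 p2 = 0" using B.wfD(15)[OF p2] e'(2) by (simp add: p2_def)
    moreover have "outs D2 p2 = {#f1, f2#} + {#e#}" using o by (simp add: add_mset_commute)
    ultimately show thesis using that[of p2 f1 f2 "{#e#}"] p2 root3 e(2) R by simp
  qed
qed

section \<open>The effect of a step on the entries\<close>

definition zero_at :: "nat \<Rightarrow> mu_vector \<Rightarrow> mu_vector" where
  "zero_at a x = (\<lambda>i. if i = a then 0 else x i)"

text \<open>
  Let $h$ be the hybrid parent of leaf $a$, and let $p$ be a parent of $h$ and of leaf $b$. The
  number of paths to $h$ is $x_a$ and the number of paths to $p$ is $x_b$; the former are no
  longer counted in $x_0$, and the paths to $a$ through $p$ now end in $c$.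
\<close>

definition split_at :: "nat \<Rightarrow> nat \<Rightarrow> nat \<Rightarrow> mu_vector \<Rightarrow> mu_vector" where
  "split_at a b c x =
     (\<lambda>i. if i = c then x b else if i = 0 then x 0 - x a else if i = a then x a - x b else x i)"

lemma zero_at_add: "zero_at a (x + y) = zero_at a x + zero_at a y"
  by (auto simp: zero_at_def fun_apply)

lemma zero_at_0: "zero_at a 0 = 0"
  by (auto simp: zero_at_def fun_apply)

lemma zero_at_unit: "zero_at a (unit_vector i) = (if i = a then 0 else unit_vector i)"
  by (auto simp: zero_at_def fun_apply unit_vector_apply fun_eq_iff)

lemma split_at_add: "split_at a b c (x + y) = split_at a b c x + split_at a b c y"
  by (auto simp: split_at_def fun_apply)

lemma split_at_unit:
  "i \<noteq> a \<Longrightarrow> i \<noteq> b \<Longrightarrow> i \<noteq> c \<Longrightarrow> a \<noteq> 0 \<Longrightarrow> split_at a b c (unit_vector i) = unit_vector i"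
  by (auto simp: split_at_def fun_apply unit_vector_apply fun_eq_iff)

lemma split_at_hybrid:
  "a \<noteq> 0 \<Longrightarrow> a \<noteq> b \<Longrightarrow> b \<noteq> 0 \<Longrightarrow> c \<noteq> 0 \<Longrightarrow> c \<noteq> a \<Longrightarrow> c \<noteq> b \<Longrightarrow>
   split_at a b c (unit_vector 0 + unit_vector a) = unit_vector a"
  "a \<noteq> 0 \<Longrightarrow> a \<noteq> b \<Longrightarrow> b \<noteq> 0 \<Longrightarrow> c \<noteq> 0 \<Longrightarrow> c \<noteq> a \<Longrightarrow> c \<noteq> b \<Longrightarrow>
   split_at a b c (unit_vector b) + unit_vector a = unit_vector b + unit_vector c"
  by (auto simp: split_at_def fun_apply unit_vector_apply fun_eq_iff)

definition map_ent :: "(mu_vector \<Rightarrow> mu_vector) \<Rightarrow> arc_entry \<Rightarrow> arc_entry" where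
  "map_ent \<phi> e = (\<phi> (fst e), fst (snd e), map_option \<phi> (snd (snd e)))"

lemma additive_sum_mset:
  fixes \<phi> :: "mu_vector \<Rightarrow> mu_vector"
  assumes add: "\<And>x y. \<phi> (x + y) = \<phi> x + \<phi> y"
  shows "\<phi> 0 = 0" "\<phi> (\<Sum>e \<in># A. f e) = (\<Sum>e \<in># A. \<phi> (f e))"
proof -
  show 0: "\<phi> 0 = 0" using add[of 0 0] by simp
  show "\<phi> (\<Sum>e \<in># A. f e) = (\<Sum>e \<in># A. \<phi> (f e))"
    by (induction A) (simp_all add: 0 add)
qed

lemma valued_state_map:
  fixes \<phi> :: "mu_vector \<Rightarrow> mu_vector" and P :: "'v \<Rightarrow> mu_vector" and Q :: "'v \<Rightarrow> 'v \<Rightarrow> mu_vector"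
  defines "P' \<equiv> \<lambda>v. \<phi> (P v)" and "Q' \<equiv> \<lambda>u v. \<phi> (Q u v)"
  assumes S: "valued_state L W (A + D) I P Q" and wf': "wf_state L' W' (A' + D) I'" and W': "W' \<subseteq> W"
    and add: "\<And>x y. \<phi> (x + y) = \<phi> x + \<phi> y" and unit0: "\<phi> (unit_vector 0) = unit_vector 0"
    and ins: "\<And>v. v \<in> W' \<Longrightarrow> ins (A' + D) v = ins (A + D) v"
    and Lf: "\<And>u i. (u, Lf i) \<in># D \<Longrightarrow> \<phi> (unit_vector i) = unit_vector i"
    and A: "\<And>v. v \<in> W' \<Longrightarrow> (\<Sum>e \<in># outs A' v. arc_vec P' Q' e) = \<phi> (\<Sum>e \<in># outs A v. arc_vec P Q e)"
    and AUd: "\<And>u v. (u, Ud v) \<notin># A'"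
  shows "valued_state L' W' (A' + D) I' P' Q'"
    and "(\<And>e. e \<in># D \<Longrightarrow> size (outs A' (fst e)) = size (outs A (fst e))) \<Longrightarrow>
      arc_entries (A' + D) P' Q' = image_mset (entry_of (A' + D) P' Q') A' +
        image_mset (map_ent \<phi>) (image_mset (entry_of (A + D) P Q) D)"
proof -
  interpret valued_state L W "A + D" I P Q by fact
  have arc_vec': "arc_vec P' Q' e = \<phi> (arc_vec P Q e)" if "e \<in># D" for e
    using Lf[of "fst e"] that by (cases e; cases "snd e") (auto simp: P'_def Q'_def)
  have sumD: "(\<Sum>e \<in># outs D v. arc_vec P' Q' e) = \<phi> (\<Sum>e \<in># outs D v. arc_vec P Q e)" for v
    unfolding additive_sum_mset(2)[OF add] by (rule arg_cong[where f = sum_mset], rule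
        image_mset_cong) (simp add: arc_vec')
  have "valued W' (A' + D) P' Q'"
    unfolding valued_def
  proof (intro conjI ballI allI impI)
    fix v assume v: "v \<in> W'"
    then have "P' v = \<phi> (hyb (A + D) v) + (\<phi> (\<Sum>e \<in># outs A v. arc_vec P Q e) +
        \<phi> (\<Sum>e \<in># outs D v. arc_vec P Q e))"
      using P_eq[of v] W' by (simp add: P'_def add subsetD)
    also have "\<phi> (hyb (A + D) v) = hyb (A' + D) v"
      using ins[OF v] by (simp add: hyb_def unit0 additive_sum_mset(1)[OF add])
    finally show "P' v = hyb (A' + D) v + (\<Sum>e \<in># outs (A' + D) v. arc_vec P' Q' e)"
      using A[OF v] sumD[of v] by simp
  next
    fix u v assume "(u, Ud v) \<in># A' + D"
    then have "(u, Ud v) \<in># A + D" using AUd by auto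
    then show "P' u = P' v" "P' u = Q' u v + Q' v u"
      using Ud_eq[of u v] by (auto simp: P'_def Q'_def add[symmetric])
  qed
  then show "valued_state L' W' (A' + D) I' P' Q'" using wf' by (simp add: valued_state_def)
  assume sz: "\<And>e. e \<in># D \<Longrightarrow> size (outs A' (fst e)) = size (outs A (fst e))"
  have "entry_of (A' + D) P' Q' e = map_ent \<phi> (entry_of (A + D) P Q e)" if e: "e \<in># D" for e
  proof -
    have "arc_tag (A' + D) e = arc_tag (A + D) e"
    proof (cases "\<exists>v. snd e = Nd v")
      case True
      then obtain v where "snd e = Nd v" by blast
      moreover from this have "v \<in> W'" using wf_stateD(8)[OF wf', of "fst e" v] e
          by (metis prod.collapse union_iff)
      ultimately show ?thesis using ins[of v] by (simp add: arc_tag_def)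
    next
      case False
      then show ?thesis by (cases "snd e") (auto simp: arc_tag_def)
    qed
    then show ?thesis using arc_vec'[OF e] sz[OF e] by (simp add: entry_of_def map_ent_def P'_def)
  qed
  then show "arc_entries (A' + D) P' Q' = image_mset (entry_of (A' + D) P' Q') A' +
        image_mset (map_ent \<phi>) (image_mset (entry_of (A + D) P Q) D)"
    by (simp add: arc_entries_def multiset.map_comp comp_def cong: image_mset_cong)
qed

lemma root_vectors_map:
  assumes "\<And>v. v \<in> W' \<Longrightarrow> ins D' v = 0 \<Longrightarrow> v \<in> W \<and> ins D v = 0"
    and "\<And>v. v \<in> W \<Longrightarrow> ins D v = 0 \<Longrightarrow>
      (\<exists>w \<in> W'. ins D' w = 0 \<and> P w = P v) \<or> (\<exists>b \<in> I'. \<phi> (P v) = unit_vector b)"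
    and "\<And>i. i \<in> I \<Longrightarrow> \<phi> (unit_vector i) = unit_vector i"
    and "I \<subseteq> I'" and "\<And>i. i \<in> I' - I \<Longrightarrow> \<exists>v \<in> W. ins D v = 0 \<and> \<phi> (P v) = unit_vector i"
  shows "root_vectors W' D' I' (\<lambda>v. \<phi> (P v)) = \<phi> ` root_vectors W D I P"
proof (rule set_eqI)
  fix x
  show "x \<in> root_vectors W' D' I' (\<lambda>v. \<phi> (P v)) \<longleftrightarrow> x \<in> \<phi> ` root_vectors W D I P"
  proof
    assume "x \<in> root_vectors W' D' I' (\<lambda>v. \<phi> (P v))"
    then consider v where "v \<in> W'" "ins D' v = 0" "x = \<phi> (P v)" | i where "i \<in> I'"
        "x = unit_vector i"
      by (auto simp: root_vectors_def)
    then show "x \<in> \<phi> ` root_vectors W D I P"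
    proof cases
      case 1
      then show ?thesis using assms(1)[of v] by (auto simp: root_vectors_def)
    next
      case 2
      show ?thesis
      proof (cases "i \<in> I")
        case True
        then show ?thesis using 2 assms(3)[of i] by (auto simp: root_vectors_def image_iff
            intro!: bexI[of _ "unit_vector i"])
      next
        case False
        then obtain v where "v \<in> W" "ins D v = 0" "\<phi> (P v) = unit_vector i" using assms(5)[of i] 2
            by auto
        then show ?thesis using 2 by (auto simp: root_vectors_def image_iff intro!: bexI[of _
            "P v"])
      qed
    qed
  next
    assume "x \<in> \<phi> ` root_vectors W D I P"
    then consider v where "v \<in> W" "ins D v = 0" "x = \<phi> (P v)" | i where "i \<in> I"
        "x = \<phi> (unit_vector i)"
      by (auto simp: root_vectors_def)
    then show "x \<in> root_vectors W' D' I' (\<lambda>v. \<phi> (P v))"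
    proof cases
      case 1
      then show ?thesis using assms(2)[of v] by (fastforce simp: root_vectors_def image_iff)
    next
      case 2
      then show ?thesis using assms(3)[of i] assms(4) by (auto simp: root_vectors_def)
    qed
  qed
qed

lemma step_tree_valued:
  fixes P :: "'v \<Rightarrow> mu_vector" and Q :: "'v \<Rightarrow> 'v \<Rightarrow> mu_vector"
  assumes S: "valued_state L W ({#(u, Nd p), (p, Lf a), (p, Lf b)#} + D) I P Q" (is
      "valued_state _ _ (?A + D) _ _ _")
  defines "P' \<equiv> \<lambda>v. zero_at a (P v)" and "Q' \<equiv> \<lambda>u v. zero_at a (Q u v)"
  shows "valued_state L (W - {p}) ({#(u, Lf b)#} + D) I P' Q'"
    and "arc_entries ({#(u, Lf b)#} + D) P' Q' = image_mset (map_ent (zero_at a))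
      (arc_entries (?A + D) P Q - {#(unit_vector a, Tag_t, None), (unit_vector b, Tag_t, None)#})"
    and "root_vectors (W - {p}) ({#(u, Lf b)#} + D) I P' = zero_at a ` root_vectors W (?A + D) I P"
proof -
  interpret valued_state L W "?A + D" I P Q by fact
  note f = wf_step_tree[OF wf]
  have a0: "a \<noteq> 0" using f(9) wfD(3) by metis
  have Pp: "P p = unit_vector a + unit_vector b"
    using P_nonhybrid[OF f(7)] f(1,2) by simp
  have zP: "zero_at a (P p) = unit_vector b" using f(4) by (simp add: Pp zero_at_add zero_at_unit)
  have fh: "(p, z) \<notin># D" for z using f(2) by (simp add: outs_empty_iff)
  have 1: "valued_state L (W - {p}) ({#(u, Lf b)#} + D) I P' Q'"
    unfolding P'_def Q'_def
    by (rule valued_state_map(1)[OF S f(15)]; use f in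
        \<open>auto simp: zero_at_add zero_at_unit a0 zP leaf_count_0_iff zero_at_0\<close>)
  show "valued_state L (W - {p}) ({#(u, Lf b)#} + D) I P' Q'" using 1 by simp
  have 2: "arc_entries ({#(u, Lf b)#} + D) P' Q' = image_mset (entry_of ({#(u, Lf b)#} +
      D) P' Q') {#(u, Lf b)#} +
        image_mset (map_ent (zero_at a)) (image_mset (entry_of (?A + D) P Q) D)"
    unfolding P'_def Q'_def
    by (rule valued_state_map(2)[OF S f(15)]; use f in
        \<open>auto simp: fh zero_at_add zero_at_unit a0 zP leaf_count_0_iff zero_at_0\<close>)
  show "arc_entries ({#(u, Lf b)#} + D) P' Q' = image_mset (map_ent (zero_at a))
      (arc_entries (?A + D) P Q - {#(unit_vector a, Tag_t, None), (unit_vector b, Tag_t, None)#})"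
  proof -
    define G where "G = image_mset (entry_of (?A + D) P Q) D"
    define g where "g = entry_of (?A + D) P Q (u, Nd p)"
    have E: "entry_of (?A + D) P Q (p, Lf a) = (unit_vector a, Tag_t, None)"
      "entry_of (?A + D) P Q (p, Lf b) = (unit_vector b, Tag_t, None)"
      "entry_of ({#(u, Lf b)#} + D) P' Q' (u, Lf b) = map_ent (zero_at a) g"
      using f zP by (simp_all add: entry_of_def map_ent_def P'_def g_def)
    have "arc_entries (?A + D) P Q = {#g, (unit_vector a, Tag_t, None), (unit_vector b, Tag_t,
        None)#} + G"
      unfolding arc_entries_def image_mset_union image_mset_add_mset image_mset_empty G_def E g_def
          ..
    then show ?thesis unfolding 2 G_def[symmetric] using E(3) by simp
  qed
  show "root_vectors (W - {p}) ({#(u, Lf b)#} + D) I P' = zero_at a ` root_vectors W (?A + D) I P"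
    unfolding P'_def by (rule root_vectors_map) (use f in \<open>auto simp: zero_at_unit
        split: if_splits\<close>)
qed

lemma step_root2_valued:
  fixes P :: "'v \<Rightarrow> mu_vector" and Q :: "'v \<Rightarrow> 'v \<Rightarrow> mu_vector"
  assumes S: "valued_state L W ({#(p, Lf a), (p, Lf b)#} + D) I P Q" (is "valued_state _ _ (?A +
      D) _ _ _")
    and o: "outs D p = {#}" and i: "ins D p = 0"
  defines "P' \<equiv> \<lambda>v. zero_at a (P v)" and "Q' \<equiv> \<lambda>u v. zero_at a (Q u v)"
  shows "valued_state L (W - {p}) D (insert b I) P' Q'"
    and "arc_entries D P' Q' = image_mset (map_ent (zero_at a))
      (arc_entries (?A + D) P Q - {#(unit_vector a, Tag_t, None), (unit_vector b, Tag_t, None)#})"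
    and "root_vectors (W - {p}) D (insert b I) P' = zero_at a ` root_vectors W (?A + D) I P"
proof -
  interpret valued_state L W "?A + D" I P Q by fact
  note f = wf_step_root2[OF wf o i]
  have wf': "wf_state L (W - {p}) ({#} + D) (insert b I)" using f(11) by simp
  have a0: "a \<noteq> 0" using f(5) wfD(3) by metis
  have Pp: "P p = unit_vector a + unit_vector b"
    using P_nonhybrid[OF f(4)] o by simp
  have zP: "zero_at a (P p) = unit_vector b" using f(1) by (simp add: Pp zero_at_add zero_at_unit)
  have fh: "(p, z) \<notin># D" for z using o by (simp add: outs_empty_iff)
  have 1: "valued_state L (W - {p}) ({#} + D) (insert b I) P' Q'"
    unfolding P'_def Q'_def
    by (rule valued_state_map(1)[OF S wf']; use f in
        \<open>auto simp: zero_at_add zero_at_unit a0 zP leaf_count_0_iff zero_at_0\<close>)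
  show "valued_state L (W - {p}) D (insert b I) P' Q'" using 1 by simp
  have 2: "arc_entries ({#} + D) P' Q' = image_mset (entry_of ({#} + D) P' Q') {#} +
        image_mset (map_ent (zero_at a)) (image_mset (entry_of (?A + D) P Q) D)"
    unfolding P'_def Q'_def
    by (rule valued_state_map(2)[OF S wf']; use f in
        \<open>auto simp: fh zero_at_add zero_at_unit a0 zP leaf_count_0_iff zero_at_0\<close>)
  show "arc_entries D P' Q' = image_mset (map_ent (zero_at a))
      (arc_entries (?A + D) P Q - {#(unit_vector a, Tag_t, None), (unit_vector b, Tag_t, None)#})"
  proof -
    define G where "G = image_mset (entry_of (?A + D) P Q) D"
    have E: "entry_of (?A + D) P Q (p, Lf a) = (unit_vector a, Tag_t, None)"
      "entry_of (?A + D) P Q (p, Lf b) = (unit_vector b, Tag_t, None)"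
      using o by (simp_all add: entry_of_def)
    have "arc_entries (?A + D) P Q = {#(unit_vector a, Tag_t, None), (unit_vector b, Tag_t, None)#}
        + G"
      unfolding arc_entries_def image_mset_union image_mset_add_mset image_mset_empty G_def E ..
    then show ?thesis using 2 unfolding G_def[symmetric] by simp
  qed
  show "root_vectors (W - {p}) D (insert b I) P' = zero_at a ` root_vectors W (?A + D) I P"
    unfolding P'_def by (rule root_vectors_map) (use f zP i in \<open>auto simp: zero_at_unit
        split: if_splits\<close>)
qed

lemma step_root3_valued:
  fixes P :: "'v \<Rightarrow> mu_vector" and Q :: "'v \<Rightarrow> 'v \<Rightarrow> mu_vector"
  assumes S: "valued_state L W ({#(p, Lf a), (p, Lf b), (p, x)#} + D) I P Q" (is
      "valued_state _ _ (?A + D) _ _ _")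
    and o: "outs D p = {#}" and x: "\<forall>v. x \<noteq> Ud v"
  defines "P' \<equiv> \<lambda>v. zero_at a (P v)" and "Q' \<equiv> \<lambda>u v. zero_at a (Q u v)"
  shows "valued_state L W ({#(p, Lf b), (p, x)#} + D) I P' Q'"
    and "entry_of (?A + D) P Q (p, x) = (P p - unit_vector a - unit_vector b, arc_tag (?A +
        D) (p, x), Some (P p))"
    and "arc_entries ({#(p, Lf b), (p, x)#} + D) P' Q' = image_mset (map_ent (zero_at a))
      (arc_entries (?A + D) P Q - {#(unit_vector a, Tag_t, Some (P p)), (unit_vector b, Tag_t, Some
          (P p)),
         entry_of (?A + D) P Q (p, x)#}) +
      {#(unit_vector b, Tag_t, None),
        (zero_at a (P p - unit_vector a - unit_vector b), arc_tag (?A + D) (p, x), None)#}"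
    and "root_vectors W ({#(p, Lf b), (p, x)#} + D) I P' = zero_at a ` root_vectors W (?A + D) I P"
proof -
  let ?A' = "{#(p, Lf b), (p, x)#}"
  interpret valued_state L W "?A + D" I P Q by fact
  have eq: "?A + D = {#(p, Lf a), (p, Lf b)#} + add_mset (p, x) D" "{#(p, Lf b)#} +
      add_mset (p, x) D = ?A' + D"
    by simp_all
  have "wf_state L W ({#(p, Lf a), (p, Lf b)#} + add_mset (p, x) D) I" using wf unfolding eq(1) .
  from wf_step_root3[OF this _ x] o
  have f: "a \<noteq> b" "leaf_count D a = 0" "leaf_count D b = 0" "x \<noteq> Lf a" "p \<in> W"
      "ins (add_mset (p, x) D) p = 0"
    "a \<in> L" "b \<in> L" "a \<notin> I" "b \<notin> I" "\<And>v. (v, Ud p) \<notin># D" "wf_state L W (?A' + D) I"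
    unfolding eq(2) by (auto split: if_splits)
  have a0: "a \<noteq> 0" using f(7) wfD(3) by metis
  have Pp: "P p = unit_vector a + (unit_vector b + vl (p, x))"
    using P_nonhybrid[OF f(5)] o by simp
  have za: "zero_at a (unit_vector a) = 0" by (simp add: zero_at_unit)
  have vx: "arc_vec P' Q' (p, x) = zero_at a (vl (p, x))"
    using f(4) by (cases x) (auto simp: P'_def Q'_def zero_at_unit)
  have fh: "(p, z) \<notin># D" for z using o by (simp add: outs_empty_iff)
  have 1: "valued_state L W (?A' + D) I P' Q'"
    unfolding P'_def Q'_def
    by (rule valued_state_map(1)[OF S f(12)]; use f x vx in
        \<open>auto simp: zero_at_add zero_at_unit a0 leaf_count_0_iff zero_at_0 P'_def Q'_def\<close>)
  show "valued_state L W (?A' + D) I P' Q'" using 1 by simp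
  have 2: "arc_entries (?A' + D) P' Q' = image_mset (entry_of (?A' + D) P' Q') ?A' +
        image_mset (map_ent (zero_at a)) (image_mset (entry_of (?A + D) P Q) D)"
    unfolding P'_def Q'_def
    by (rule valued_state_map(2)[OF S f(12)]; use f x vx in
        \<open>auto simp: fh zero_at_add zero_at_unit a0 leaf_count_0_iff zero_at_0 P'_def Q'_def\<close>)
  have vpx: "vl (p, x) = P p - unit_vector a - unit_vector b" unfolding Pp by simp
  show e3: "entry_of (?A + D) P Q (p, x) = (P p - unit_vector a - unit_vector b, arc_tag (?A +
      D) (p, x), Some (P p))"
    using o by (simp add: entry_of_def vpx)
  have k: "arc_tag (?A' + D) (p, x) = arc_tag (?A + D) (p, x)"
      by (simp add: arc_tag_def split: target.split)
  show "arc_entries (?A' + D) P' Q' = image_mset (map_ent (zero_at a))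
      (arc_entries (?A + D) P Q - {#(unit_vector a, Tag_t, Some (P p)), (unit_vector b, Tag_t, Some
          (P p)),
         entry_of (?A + D) P Q (p, x)#}) +
      {#(unit_vector b, Tag_t, None),
        (zero_at a (P p - unit_vector a - unit_vector b), arc_tag (?A + D) (p, x), None)#}"
  proof -
    have "entry_of (?A' + D) P' Q' (p, x) = (zero_at a (P p - unit_vector a - unit_vector b),
        arc_tag (?A + D) (p, x), None)"
      using o vx k by (simp add: entry_of_def vpx)
    moreover have "entry_of (?A' + D) P' Q' (p, Lf b) = (unit_vector b, Tag_t, None)"
      "entry_of (?A + D) P Q (p, Lf b) = (unit_vector b, Tag_t, Some (P p))"
      "entry_of (?A + D) P Q (p, Lf a) = (unit_vector a, Tag_t, Some (P p))"
      using o by (simp_all add: entry_of_def)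
    ultimately have E: "entry_of (?A' + D) P' Q' (p, x) = (zero_at a (P p - unit_vector a -
        unit_vector b), arc_tag (?A + D) (p, x), None)"
      "entry_of (?A' + D) P' Q' (p, Lf b) = (unit_vector b, Tag_t, None)"
      "entry_of (?A + D) P Q (p, Lf b) = (unit_vector b, Tag_t, Some (P p))"
      "entry_of (?A + D) P Q (p, Lf a) = (unit_vector a, Tag_t, Some (P p))" by blast+
    define G where "G = image_mset (entry_of (?A + D) P Q) D"
    define g where "g = entry_of (?A + D) P Q (p, x)"
    have "arc_entries (?A + D) P Q = {#(unit_vector a, Tag_t, Some (P p)), (unit_vector b, Tag_t,
        Some (P p)), g#} + G"
      unfolding arc_entries_def image_mset_union image_mset_add_mset image_mset_empty G_def E g_def
          ..
    moreover have "arc_entries (?A' + D) P' Q' = {#(unit_vector b, Tag_t, None),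
        (zero_at a (P p - unit_vector a - unit_vector b), arc_tag (?A + D) (p, x), None)#} +
            image_mset (map_ent (zero_at a)) G"
      unfolding 2 image_mset_add_mset image_mset_empty G_def E ..
    ultimately show ?thesis unfolding g_def[symmetric] by simp
  qed
  show "root_vectors W (?A' + D) I P' = zero_at a ` root_vectors W (?A + D) I P"
    unfolding P'_def by (rule root_vectors_map) (use f in \<open>auto simp: zero_at_unit
        split: if_splits\<close>)
qed

lemma step_undir_valued:
  fixes P :: "'v \<Rightarrow> mu_vector" and Q :: "'v \<Rightarrow> 'v \<Rightarrow> mu_vector"
  assumes S: "valued_state L W ({#(u, Ud p), (p, Ud u), (p, Lf a), (p, Lf b)#} + D) I P Q" (is
      "valued_state _ _ (?A + D) _ _ _")
  defines "P' \<equiv> \<lambda>v. zero_at a (P v)" and "Q' \<equiv> \<lambda>u v. zero_at a (Q u v)"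
  shows "valued_state L (W - {p}) ({#(u, Lf b)#} + D) I P' Q'" and "P u = P p"
    and "entry_of (?A + D) P Q (p, Ud u) = (P p - unit_vector a - unit_vector b, Tag_i, Some (P p))"
    and "arc_entries ({#(u, Lf b)#} + D) P' Q' = image_mset (map_ent (zero_at a))
      (arc_entries (?A + D) P Q - {#(unit_vector a, Tag_t, Some (P p)), (unit_vector b, Tag_t, Some
          (P p)),
        (unit_vector a + unit_vector b, Tag_i, Some (P p)),
        (P p - unit_vector a - unit_vector b, Tag_i, Some (P p))#}) +
      {#(unit_vector b, Tag_t, Some (zero_at a (P p)))#}"
    and "root_vectors (W - {p}) ({#(u, Lf b)#} + D) I P' = zero_at a ` root_vectors W (?A + D) I P"
proof -
  interpret valued_state L W "?A + D" I P Q by fact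
  note f = wf_step_undir[OF wf]
  have a0: "a \<noteq> 0" using f(9) wfD(3) by metis
  show Pu: "P u = P p" using Ud_eq(1)[of u p] by simp
  have Pp: "P p = Q p u + (unit_vector a + unit_vector b)"
    using P_nonhybrid[OF f(7)] f(1,2) by simp
  have Qup: "Q u p = unit_vector a + unit_vector b" using Ud_eq(2)[of p u] Pp by simp
  have Qpu: "Q p u = P p - unit_vector a - unit_vector b" unfolding Pp by simp
  have zQ: "zero_at a (Q u p) = unit_vector b" using f(4)
      by (simp add: Qup zero_at_add zero_at_unit)
  have fh: "(p, z) \<notin># D" for z using f(2) by (simp add: outs_empty_iff)
  have 1: "valued_state L (W - {p}) ({#(u, Lf b)#} + D) I P' Q'"
    unfolding P'_def Q'_def
    by (rule valued_state_map(1)[OF S f(17)]; use f in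
        \<open>auto simp: zero_at_add zero_at_unit a0 zQ leaf_count_0_iff zero_at_0\<close>)
  show "valued_state L (W - {p}) ({#(u, Lf b)#} + D) I P' Q'" using 1 by simp
  have 2: "arc_entries ({#(u, Lf b)#} + D) P' Q' = image_mset (entry_of ({#(u, Lf b)#} +
      D) P' Q') {#(u, Lf b)#} +
        image_mset (map_ent (zero_at a)) (image_mset (entry_of (?A + D) P Q) D)"
    unfolding P'_def Q'_def
    by (rule valued_state_map(2)[OF S f(17)]; use f in
        \<open>auto simp: fh zero_at_add zero_at_unit a0 zQ leaf_count_0_iff zero_at_0\<close>)
  show "entry_of (?A + D) P Q (p, Ud u) = (P p - unit_vector a - unit_vector b, Tag_i, Some (P p))"
    using f by (simp add: entry_of_def Qpu del: minus_apply)
  have E: "entry_of (?A + D) P Q (p, Ud u) = (P p - unit_vector a - unit_vector b, Tag_i, Some (P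
      p))"
    "entry_of (?A + D) P Q (u, Ud p) = (unit_vector a + unit_vector b, Tag_i, Some (P p))"
    "entry_of (?A + D) P Q (p, Lf b) = (unit_vector b, Tag_t, Some (P p))"
    "entry_of (?A + D) P Q (p, Lf a) = (unit_vector a, Tag_t, Some (P p))"
    "entry_of ({#(u, Lf b)#} + D) P' Q' (u, Lf b) = (unit_vector b, Tag_t, Some (zero_at a (P p)))"
    using f by (simp_all add: entry_of_def Qpu Qup Pu P'_def del: minus_apply)
  show "arc_entries ({#(u, Lf b)#} + D) P' Q' = image_mset (map_ent (zero_at a))
      (arc_entries (?A + D) P Q - {#(unit_vector a, Tag_t, Some (P p)), (unit_vector b, Tag_t, Some
          (P p)),
        (unit_vector a + unit_vector b, Tag_i, Some (P p)),
        (P p - unit_vector a - unit_vector b, Tag_i, Some (P p))#}) +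
      {#(unit_vector b, Tag_t, Some (zero_at a (P p)))#}"
  proof -
    define G where "G = image_mset (entry_of (?A + D) P Q) D"
    have "arc_entries (?A + D) P Q = {#(unit_vector a + unit_vector b, Tag_i, Some (P p)),
        (P p - unit_vector a - unit_vector b, Tag_i, Some (P p)),
        (unit_vector a, Tag_t, Some (P p)), (unit_vector b, Tag_t, Some (P p))#} + G"
      unfolding arc_entries_def image_mset_union image_mset_add_mset image_mset_empty G_def E ..
    moreover have "arc_entries ({#(u, Lf b)#} + D) P' Q' =
        {#(unit_vector b, Tag_t, Some (zero_at a (P p)))#} + image_mset (map_ent (zero_at a)) G"
      unfolding 2 image_mset_add_mset image_mset_empty G_def E ..
    ultimately show ?thesis by (simp add: add_mset_commute)
  qed
  show "root_vectors (W - {p}) ({#(u, Lf b)#} + D) I P' = zero_at a ` root_vectors W (?A + D) I P"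
    unfolding P'_def by (rule root_vectors_map) (use f Pu in \<open>auto simp: zero_at_unit
        split: if_splits\<close>)
qed

definition unhybrid :: "nat \<Rightarrow> (mu_vector \<Rightarrow> mu_vector) \<Rightarrow> arc_entry \<Rightarrow> arc_entry" where
  "unhybrid a \<phi> e = (if fst e = unit_vector 0 + unit_vector a
     then (unit_vector a, Tag_t, map_option \<phi> (snd (snd e))) else map_ent \<phi> e)"

lemma step_split_valued:
  fixes P :: "'v \<Rightarrow> mu_vector" and Q :: "'v \<Rightarrow> 'v \<Rightarrow> mu_vector"
  assumes S: "valued_state L W ({#(p, Lf b), (p, Nd h), (q, Nd h), (h, Lf a)#} + D) I P Q" (is
      "valued_state _ _ (?A + D) _ _ _")
    and c: "c \<notin> L" "c \<noteq> 0"
  defines "P' \<equiv> \<lambda>v. split_at a b c (P v)" and "Q' \<equiv> \<lambda>u v. split_at a b c (Q u v)"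
    and "o' \<equiv> if size (outs ({#(p, Lf b), (p, Nd h), (q, Nd h), (h, Lf a)#} +
        D) p) = 3 then Some (P p) else None"
  shows "valued_state (insert c L) (W - {h}) ({#(p, Lf b), (p, Lf c), (q, Lf a)#} + D) I P' Q'"
    and "arc_entries ({#(p, Lf b), (p, Lf c), (q, Lf a)#} +
        D) P' Q' = image_mset (unhybrid a (split_at a b c))
      (arc_entries (?A + D) P Q - {#(unit_vector b, Tag_t, o'), (unit_vector 0 +
          unit_vector a, Tag_h, o'),
        (unit_vector a, Tag_t, None)#}) +
      {#(unit_vector b, Tag_t, map_option (split_at a b c) o'), (unit_vector c, Tag_t, map_option
          (split_at a b c) o')#}"
    and "root_vectors (W - {h}) ({#(p, Lf b), (p, Lf c), (q, Lf a)#} +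
        D) I P' = split_at a b c ` root_vectors W (?A + D) I P"
    and "entry_of (?A + D) P Q (p, Lf b) = (unit_vector b, Tag_t, o')"
    and "P h = unit_vector 0 + unit_vector a"
proof -
  let ?A' = "{#(p, Lf b), (p, Lf c), (q, Lf a)#}"
  interpret valued_state L W "?A + D" I P Q by fact
  note f = wf_step_split[OF wf c]
  let ?\<phi> = "split_at a b c"
  have n: "a \<noteq> 0" "b \<noteq> 0" "c \<noteq> 0" "c \<noteq> a" "c \<noteq> b" "a \<noteq> b"
    using f(5,12,13) wfD(3) c by metis+
  note \<phi> = split_at_hybrid[OF n(1) n(6) n(2-5)]
  have "size (outs (?A + D) h) = 1" using f by simp
  then have ih: "ins (?A + D) h = 2" using f by simp
  show Ph: "P h = unit_vector 0 + unit_vector a"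
    using P_eq[OF f(11)] ih f(1-3) by (simp add: hyb_def)
  have u: "?\<phi> (unit_vector i) = unit_vector i" if "i \<noteq> a" "i \<noteq> b" "i \<noteq> c" for i
    using that n by (simp add: split_at_unit)
  have uI: "?\<phi> (unit_vector i) = unit_vector i" if "i \<in> I" for i
    by (rule u) (use that f(14-16) in auto)
  have \<phi>0: "?\<phi> 0 = 0" using additive_sum_mset(1)[OF split_at_add] .
  have \<phi>h: "?\<phi> (P h) = unit_vector a" by (simp add: Ph \<phi>(1))
  have sp: "?\<phi> (unit_vector b + P h) = unit_vector b + unit_vector c"
    "?\<phi> (unit_vector b + 2 * P h) = unit_vector b + (unit_vector c + unit_vector a)"
    unfolding split_at_add mult_2 \<phi>h using \<phi>(2) by (simp_all add: ac_simps)
  have D0: "i \<noteq> a" "i \<noteq> b" "i \<noteq> c" if "(v, Lf i) \<in># D" for v i using that f(6-8)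
      by (auto simp: leaf_count_0_iff)
  have fh: "(h, z) \<notin># D" for z using f(3) by (simp add: outs_empty_iff)
  have 1: "valued_state (insert c L) (W - {h}) (?A' + D) I P' Q'"
    unfolding P'_def Q'_def
    by (rule valued_state_map(1)[OF S f(19) _ split_at_add]; use f(1-18) D0 n in
        \<open>auto simp: u n \<phi>h \<phi>0 sp split: if_splits\<close>)
  show "valued_state (insert c L) (W - {h}) (?A' + D) I P' Q'" using 1 by simp
  have 2: "arc_entries (?A' + D) P' Q' = image_mset (entry_of (?A' + D) P' Q') ?A' +
        image_mset (map_ent ?\<phi>) (image_mset (entry_of (?A + D) P Q) D)"
    unfolding P'_def Q'_def
    by (rule valued_state_map(2)[OF S f(19) _ split_at_add]; use f(1-18) D0 n in
        \<open>auto simp: fh u n \<phi>h \<phi>0 sp split: if_splits\<close>)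
  have nh: "vl e \<noteq> unit_vector 0 + unit_vector a" if e: "e \<in># D" for e
  proof
    assume "vl e = unit_vector 0 + unit_vector a"
    then obtain w h' where h': "e = (w, Nd h')" "outs (?A + D) h' = {#(h', Lf a)#}"
      using hybrid_arc[of e a] e f(12) by (metis union_iff)
    have "(h', Lf a) \<in># ?A + D" using in_outs_iff[of "(h', Lf a)" "?A + D" h'] unfolding h'(2)
        by simp
    then have "h' = h" using Lf_unique[of h' a h] by simp
    then show False using f(4) e h'(1) by (auto simp: ins_0_iff)
  qed
  have 3: "image_mset (map_ent ?\<phi>) (image_mset (entry_of (?A + D) P Q) D) =
      image_mset (unhybrid a ?\<phi>) (image_mset (entry_of (?A + D) P Q) D)"
    unfolding multiset.map_comp by (rule image_mset_cong) (simp add: unhybrid_def nh entry_of_def)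
  show e1: "entry_of (?A + D) P Q (p, Lf b) = (unit_vector b, Tag_t, o')"
    by (simp add: entry_of_def o'_def)
  have sz: "size (outs (?A' + D) p) = size (outs (?A + D) p)" "size (outs (?A' +
      D) q) = size (outs (?A + D) q)"
    using f(1,2) by auto
  have E: "entry_of (?A + D) P Q (p, Nd h) = (unit_vector 0 + unit_vector a, Tag_h, o')"
    "entry_of (?A + D) P Q (h, Lf a) = (unit_vector a, Tag_t, None)"
    "entry_of (?A' + D) P' Q' (p, Lf b) = (unit_vector b, Tag_t, map_option ?\<phi> o')"
    "entry_of (?A' + D) P' Q' (p, Lf c) = (unit_vector c, Tag_t, map_option ?\<phi> o')"
    using \<open>size (outs (?A + D) h) = 1\<close> ih sz by (simp_all add: entry_of_def Ph o'_def P'_def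
        del: outs_simps ins_simps)
  have Eq: "unhybrid a ?\<phi> (entry_of (?A + D) P Q (q, Nd h)) = entry_of (?A' + D) P' Q' (q, Lf a)"
    using sz ih by (simp add: unhybrid_def entry_of_def Ph P'_def del: outs_simps ins_simps)
  show "arc_entries (?A' + D) P' Q' = image_mset (unhybrid a ?\<phi>)
      (arc_entries (?A + D) P Q - {#(unit_vector b, Tag_t, o'), (unit_vector 0 +
          unit_vector a, Tag_h, o'),
        (unit_vector a, Tag_t, None)#}) +
      {#(unit_vector b, Tag_t, map_option ?\<phi> o'), (unit_vector c, Tag_t, map_option ?\<phi> o')#}"
  proof -
    define G where "G = image_mset (entry_of (?A + D) P Q) D"
    define g where "g = entry_of (?A + D) P Q (q, Nd h)"
    have "arc_entries (?A + D) P Q = {#(unit_vector b, Tag_t, o'), (unit_vector 0 +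
        unit_vector a, Tag_h, o'), g,
        (unit_vector a, Tag_t, None)#} + G"
      unfolding arc_entries_def image_mset_union image_mset_add_mset image_mset_empty G_def e1
          E(1,2) g_def ..
    moreover have "arc_entries (?A' + D) P' Q' = {#(unit_vector b, Tag_t, map_option ?\<phi> o'),
        (unit_vector c, Tag_t, map_option ?\<phi> o'), unhybrid a ?\<phi> g#} + image_mset (unhybrid a ?\<phi>) G"
      unfolding 2 3 image_mset_add_mset image_mset_empty G_def E(3,4) g_def Eq ..
    ultimately show ?thesis by (simp add: add_mset_commute)
  qed
  show "root_vectors (W - {h}) (?A' + D) I P' = ?\<phi> ` root_vectors W (?A + D) I P"
    unfolding P'_def by (rule root_vectors_map) (use f(1-18) n uI in \<open>auto split: if_splits\<close>)
qed

section \<open>Reconstruction\<close>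

definition map_arc :: "('v \<Rightarrow> 'w) \<Rightarrow> 'v arc \<Rightarrow> 'w arc" where
  "map_arc f e = (f (fst e), map_target f (snd e))"

definition state_iso :: "'v set \<Rightarrow> 'v arc multiset \<Rightarrow> nat set \<Rightarrow> 'w set \<Rightarrow> 'w arc multiset \<Rightarrow> nat set \<Rightarrow>
    bool" where
  "state_iso W1 D1 I1 W2 D2 I2 \<longleftrightarrow>
     I1 = I2 \<and> (\<exists>f. bij_betw f W1 W2 \<and> image_mset (map_arc f) D1 = D2)"

definition determined :: "'w itself \<Rightarrow> nat set \<Rightarrow> 'v set \<Rightarrow> 'v arc multiset \<Rightarrow> nat set \<Rightarrow> bool" where
  "determined _ L W D I \<longleftrightarrow>
     (\<forall>P Q (W2 :: 'w set) D2 I2 P2 Q2. valued_state L W D I P Q \<longrightarrow> valued_state L W2 D2 I2 P2 Q2 \<longrightarrow>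
        arc_entries D P Q = arc_entries D2 P2 Q2 \<longrightarrow> root_vectors W D I P = root_vectors W2 D2 I2 P2 \<longrightarrow>
            state_iso W D I W2 D2 I2)"

lemma determinedI:
  assumes "\<And>P Q (W2 :: 'w set) D2 I2 P2 Q2. valued_state L W D I P Q \<Longrightarrow> valued_state L W2 D2 I2 P2 Q2
      \<Longrightarrow>
        arc_entries D P Q = arc_entries D2 P2 Q2 \<Longrightarrow> root_vectors W D I P = root_vectors W2 D2 I2 P2 \<Longrightarrow>
            state_iso W D I W2 D2 I2"
  shows "determined TYPE('w) L W D I"
  using assms unfolding determined_def by blast

lemma determinedD:
  assumes "determined TYPE('w) L W D I"
    "valued_state L W D I P Q" "valued_state L (W2 :: 'w set) D2 I2 P2 Q2"
    "arc_entries D P Q = arc_entries D2 P2 Q2" "root_vectors W D I P = root_vectors W2 D2 I2 P2"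
  shows "state_iso W D I W2 D2 I2"
  using assms unfolding determined_def by blast

lemma bij_betw_extend:
  assumes "bij_betw f (A - {p}) (B - {q})" "p \<in> A" "q \<in> B"
  shows "bij_betw (f(p := q)) A B"
proof -
  have "bij_betw (f(p := q)) (A - {p}) (B - {q})" using assms(1)
      by (subst bij_betw_cong[of _ _ f]) auto
  then show ?thesis
    using bij_betw_combine[of "f(p := q)" "A - {p}" "B - {q}" "{p}" "{q}"] assms(2,3)
    by (simp add: insert_absorb bij_betw_def)
qed

lemma map_arc_simps [simp]:
  "map_arc f (u, Lf i) = (f u, Lf i)" "map_arc f (u, Nd v) = (f u, Nd (f v))"
      "map_arc f (u, Ud v) = (f u, Ud (f v))"
  by (simp_all add: map_arc_def)

lemma image_map_arc_upd:
  assumes "outs D p = {#}" "ins D p = 0" "\<And>v. (v, Ud p) \<notin># D"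
  shows "image_mset (map_arc (f(p := q))) D = image_mset (map_arc f) D"
proof (rule image_mset_cong)
  fix e assume e: "e \<in># D"
  then show "map_arc (f(p := q)) e = map_arc f e"
    using assms by (cases e; cases "snd e") (auto simp: map_arc_def outs_empty_iff ins_0_iff)
qed

lemma leaf_arc_cancel:
  assumes "add_mset (x, Lf b) (image_mset (map_arc f) D1) = add_mset (y, Lf b) D2"
      "leaf_count D2 b = 0"
  shows "x = y" "image_mset (map_arc f) D1 = D2"
proof -
  have "(x, Lf b) \<in># add_mset (y, Lf b) D2" using assms(1) by (metis union_single_eq_member)
  then show "x = y" using assms(2) by (auto simp: leaf_count_0_iff)
  then show "image_mset (map_arc f) D1 = D2" using assms(1) by simp
qed

lemma outs_decomp: "D = outs D v + {#e \<in># D. fst e \<noteq> v#}"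
  unfolding outs_def by (rule multiset_partition)

lemma outs_filter [simp]: "outs {#e \<in># D. fst e \<noteq> v#} v = {#}"
  by (auto simp: outs_empty_iff)

lemma image_mset_eq_single:
  assumes "image_mset f A = image_mset g {#x#}"
  obtains y where "A = {#y#}" "f y = g x"
proof -
  have "size A = 1" using arg_cong[OF assms, of size] by simp
  then obtain y where "A = {#y#}" by (metis size_1_singleton_mset)
  then show thesis using that assms by simp
qed

lemma cherry_transfer:
  assumes 1: "valued_state L W1 D1 I1 P1 Q1" and 2: "valued_state L W2 D2 I2 P2 Q2"
    and arc_entries: "arc_entries D1 P1 Q1 = arc_entries D2 P2 Q2"
        and root_vectors: "root_vectors W1 D1 I1 P1 = root_vectors W2 D2 I2 P2"
    and p: "p \<in> W1" "outs D1 p = {#(p, Lf a), (p, Lf b)#} + R" and ab: "a \<in> L" "b \<in> L"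
  obtains p2 R2 where "p2 \<in> W2" "outs D2 p2 = {#(p2, Lf a), (p2, Lf b)#} + R2"
    "ins D2 p2 = ins D1 p" "image_mset (entry_of D2 P2 Q2) R2 = image_mset (entry_of D1 P1 Q1) R"
proof -
  interpret A: valued_state L W1 D1 I1 P1 Q1 by fact
  interpret B: valued_state L W2 D2 I2 P2 Q2 by fact
  obtain p2 f1 f2 R2 where f: "p2 \<in> W2" "outs D2 p2 = {#f1, f2#} + R2"
    "arc_vec P2 Q2 f1 + arc_vec P2 Q2 f2 = unit_vector a + unit_vector b"
    "ins D2 p2 = ins D1 p" "image_mset (entry_of D2 P2 Q2) R2 = image_mset (entry_of D1 P1 Q1) R"
    by (rule pair_transfer[OF 1 2 arc_entries root_vectors p, of "unit_vector a +
        unit_vector b"]) (use ab A.wfD(2) in \<open>simp_all add: wt_unit\<close>)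
  have "f1 \<in># outs D2 p2" "f2 \<in># outs D2 p2" unfolding f(2) by simp_all
  then have "{#f1, f2#} = {#(p2, Lf a), (p2, Lf b)#}"
    using B.tree_cherry_arcs[OF _ _ _ _ f(3) ab] by auto
  then show thesis using that f by metis
qed

lemma determined_step_tree:
  assumes IH: "determined TYPE('w) L (W - {p}) ({#(u, Lf b)#} + D) I"
  shows "determined TYPE('w) L W ({#(u, Nd p), (p, Lf a), (p, Lf b)#} + D) I" (is
      "determined _ _ _ ?D _")
proof (rule determinedI)
  fix P Q and W2 :: "'w set" and D2 I2 P2 Q2
  assume A: "valued_state L W ?D I P Q" and B: "valued_state L W2 D2 I2 P2 Q2"
    and arc_entries: "arc_entries ?D P Q = arc_entries D2 P2 Q2"
        and root_vectors: "root_vectors W ?D I P = root_vectors W2 D2 I2 P2"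
  interpret A: valued_state L W ?D I P Q by fact
  interpret B: valued_state L W2 D2 I2 P2 Q2 by fact
  note f = wf_step_tree[OF A.wf]
  have "outs ?D p = {#(p, Lf a), (p, Lf b)#} + {#}" using f by simp
  then obtain p2 R2 where p2: "p2 \<in> W2" "outs D2 p2 = {#(p2, Lf a), (p2, Lf b)#} + R2"
    "ins D2 p2 = ins ?D p" "image_mset (entry_of D2 P2 Q2) R2 = image_mset (entry_of ?D P Q) {#}"
    by (rule cherry_transfer[OF A B arc_entries root_vectors f(7) _ f(9,10)])
  then have p2: "p2 \<in> W2" "outs D2 p2 = {#(p2, Lf a), (p2, Lf b)#}" "ins D2 p2 = 1"
    using f by simp_all
  then obtain u2 where u2: "(u2, Nd p2) \<in># D2" using ins_0_iff[of D2 p2] by auto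
  moreover have "u2 \<noteq> p2"
  proof
    assume "u2 = p2"
    then have "(p2, Nd p2) \<in># outs D2 p2" using u2 by simp
    then show False unfolding p2(2) by simp
  qed
  ultimately have "(u2, Nd p2) \<in># {#e \<in># D2. fst e \<noteq> p2#}" by simp
  then obtain E where "{#e \<in># D2. fst e \<noteq> p2#} = add_mset (u2, Nd p2) E" by (metis insert_DiffM)
  then have D2: "D2 = {#(u2, Nd p2), (p2, Lf a), (p2, Lf b)#} + E"
    using outs_decomp[of D2 p2] p2(2) by (simp add: add_mset_commute)
  note B' = B[unfolded D2]
  note g = wf_step_tree[OF B.wf[unfolded D2]]
  note SA = step_tree_valued[OF A] and SB = step_tree_valued[OF B']
  have "state_iso (W - {p}) ({#(u, Lf b)#} + D) I (W2 - {p2}) ({#(u2, Lf b)#} + E) I2"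
    by (rule determinedD[OF IH SA(1) SB(1)]) (simp_all only: SA(2,3) SB(2,3) arc_entries
        root_vectors D2)
  then obtain f' where f': "I = I2" "bij_betw f' (W - {p}) (W2 - {p2})"
    "image_mset (map_arc f') ({#(u, Lf b)#} + D) = {#(u2, Lf b)#} + E" by (auto simp: state_iso_def)
  then have fu: "f' u = u2" "image_mset (map_arc f') D = E"
    using leaf_arc_cancel[of "f' u" b f' D u2 E] g by auto
  have "bij_betw (f'(p := p2)) W W2" using bij_betw_extend[OF f'(2)] f(7) p2(1) by blast
  moreover have "image_mset (map_arc (f'(p := p2))) ?D = D2"
    using image_map_arc_upd[OF f(2,3), of f' p2] f fu by (simp add: D2)
  ultimately show "state_iso W ?D I W2 D2 I2" using f'(1) by (auto simp: state_iso_def)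
qed

lemma determined_step_root2:
  assumes IH: "determined TYPE('w) L (W - {p}) D (insert b I)" and o: "outs D p = {#}"
      and i: "ins D p = 0"
  shows "determined TYPE('w) L W ({#(p, Lf a), (p, Lf b)#} + D) I" (is "determined _ _ _ ?D _")
proof (rule determinedI)
  fix P Q and W2 :: "'w set" and D2 I2 P2 Q2
  assume A: "valued_state L W ?D I P Q" and B: "valued_state L W2 D2 I2 P2 Q2"
    and arc_entries: "arc_entries ?D P Q = arc_entries D2 P2 Q2"
        and root_vectors: "root_vectors W ?D I P = root_vectors W2 D2 I2 P2"
  interpret A: valued_state L W ?D I P Q by fact
  interpret B: valued_state L W2 D2 I2 P2 Q2 by fact
  note f = wf_step_root2[OF A.wf o i]
  have "outs ?D p = {#(p, Lf a), (p, Lf b)#} + {#}" using o by simp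
  then obtain p2 R2 where p2: "p2 \<in> W2" "outs D2 p2 = {#(p2, Lf a), (p2, Lf b)#} + R2"
    "ins D2 p2 = ins ?D p" "image_mset (entry_of D2 P2 Q2) R2 = image_mset (entry_of ?D P Q) {#}"
    by (rule cherry_transfer[OF A B arc_entries root_vectors f(4) _ f(5,6)])
  then have p2: "p2 \<in> W2" "outs D2 p2 = {#(p2, Lf a), (p2, Lf b)#}" "ins D2 p2 = 0"
    using i by simp_all
  define E where "E = {#e \<in># D2. fst e \<noteq> p2#}"
  have D2: "D2 = {#(p2, Lf a), (p2, Lf b)#} + E"
    using outs_decomp[of D2 p2] p2(2) by (simp add: E_def)
  have E: "outs E p2 = {#}" "ins E p2 = 0" using p2(3) unfolding D2 by (simp_all add: E_def)
  note B' = B[unfolded D2]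
  note g = wf_step_root2[OF B.wf[unfolded D2] E]
  note SA = step_root2_valued[OF A o i] and SB = step_root2_valued[OF B' E]
  have "state_iso (W - {p}) D (insert b I) (W2 - {p2}) E (insert b I2)"
    by (rule determinedD[OF IH SA(1) SB(1)]) (simp_all only: SA(2,3) SB(2,3) arc_entries
        root_vectors D2)
  then obtain f' where f': "insert b I = insert b I2" "bij_betw f' (W - {p}) (W2 - {p2})"
    "image_mset (map_arc f') D = E" by (auto simp: state_iso_def)
  have "bij_betw (f'(p := p2)) W W2" using bij_betw_extend[OF f'(2)] f(4) p2(1) by blast
  moreover have "image_mset (map_arc (f'(p := p2))) ?D = D2"
    using image_map_arc_upd[OF o i, of f' p2] f f'(3) by (simp add: D2)
  moreover have "I = I2" using f'(1) f(8) g(8) by (metis insert_ident)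
  ultimately show "state_iso W ?D I W2 D2 I2" by (auto simp: state_iso_def)
qed

lemma determined_step_root3:
  assumes IH: "determined TYPE('w) L W ({#(p, Lf b), (p, x)#} + D) I" and o: "outs D p = {#}"
      and x: "\<forall>v. x \<noteq> Ud v"
  shows "determined TYPE('w) L W ({#(p, Lf a), (p, Lf b), (p, x)#} + D) I" (is
      "determined _ _ _ ?D _")
proof (rule determinedI)
  fix P Q and W2 :: "'w set" and D2 I2 P2 Q2
  assume A: "valued_state L W ?D I P Q" and B: "valued_state L W2 D2 I2 P2 Q2"
    and arc_entries: "arc_entries ?D P Q = arc_entries D2 P2 Q2"
        and root_vectors: "root_vectors W ?D I P = root_vectors W2 D2 I2 P2"
  interpret A: valued_state L W ?D I P Q by fact
  interpret B: valued_state L W2 D2 I2 P2 Q2 by fact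
  have f: "p \<in> W" "a \<in> L" "b \<in> L" using A.wfD(5)[of p "Lf a"] A.wfD(6)[of p] by auto
  have "outs ?D p = {#(p, Lf a), (p, Lf b)#} + {#(p, x)#}" using o by simp
  then obtain p2 R2 where p2: "p2 \<in> W2" "outs D2 p2 = {#(p2, Lf a), (p2, Lf b)#} + R2"
    "ins D2 p2 = ins ?D p" and im: "image_mset (entry_of D2 P2 Q2) R2 = image_mset (entry_of ?D P Q)
        {#(p, x)#}"
    by (rule cherry_transfer[OF A B arc_entries root_vectors f(1) _ f(2,3)])
  from im obtain g where R2: "R2 = {#g#}" and g: "entry_of D2 P2 Q2 g = entry_of ?D P Q (p, x)"
    by (rule image_mset_eq_single)
  have "fst g = p2" using in_outs_iff[of g D2 p2] unfolding p2(2) R2 by simp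
  then obtain x2 where gx: "g = (p2, x2)" by (cases g) auto
  have x2: "\<forall>v. x2 \<noteq> Ud v" using g x unfolding gx by (cases x) (auto simp: entry_of_def
      split: if_splits)
  define E where "E = {#e \<in># D2. fst e \<noteq> p2#}"
  have D2: "D2 = {#(p2, Lf a), (p2, Lf b), (p2, x2)#} + E"
    using outs_decomp[of D2 p2] p2(2) by (simp add: E_def R2 gx add_mset_commute)
  have E: "outs E p2 = {#}" by (simp add: E_def)
  note B' = B[unfolded D2]
  note SA = step_root3_valued[OF A o x] and SB = step_root3_valued[OF B' E x2]
  have eq: "P2 p2 = P p" "arc_tag D2 (p2, x2) = arc_tag ?D (p, x)"
    using g unfolding gx D2 SA(2) SB(2) by simp_all
  have "leaf_count D2 b \<le> 1" using B.wfD(14) .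
  then have leaf_count: "leaf_count (add_mset (p2, x2) E) b = 0" unfolding D2
      by (auto split: if_splits)
  have "state_iso W ({#(p, Lf b), (p, x)#} + D) I W2 ({#(p2, Lf b), (p2, x2)#} + E) I2"
    by (rule determinedD[OF IH SA(1) SB(1)])
      (simp_all only: SA(3,4) SB(3,4) arc_entries root_vectors D2[symmetric] eq g[unfolded gx])
  then obtain f' where f': "I = I2" "bij_betw f' W W2"
    "image_mset (map_arc f') ({#(p, Lf b), (p, x)#} + D) = {#(p2, Lf b), (p2, x2)#} + E"
        by (auto simp: state_iso_def)
  then have fu: "f' p = p2" "image_mset (map_arc f') (add_mset (p, x) D) = add_mset (p2, x2) E"
    using leaf_arc_cancel[of "f' p" b f' "add_mset (p, x) D" p2 "add_mset (p2, x2) E"] leaf_count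
        by auto
  then have "image_mset (map_arc f') ?D = D2"
    by (simp add: D2)
  then show "state_iso W ?D I W2 D2 I2" using f'(1,2) by (auto simp: state_iso_def)
qed

lemma determined_step_undir:
  assumes IH: "determined TYPE('w) L (W - {p}) ({#(u, Lf b)#} + D) I"
  shows "determined TYPE('w) L W ({#(u, Ud p), (p, Ud u), (p, Lf a), (p, Lf b)#} + D) I" (is
      "determined _ _ _ ?D _")
proof (rule determinedI)
  fix P Q and W2 :: "'w set" and D2 I2 P2 Q2
  assume A: "valued_state L W ?D I P Q" and B: "valued_state L W2 D2 I2 P2 Q2"
    and arc_entries: "arc_entries ?D P Q = arc_entries D2 P2 Q2"
        and root_vectors: "root_vectors W ?D I P = root_vectors W2 D2 I2 P2"
  interpret A: valued_state L W ?D I P Q by fact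
  interpret B: valued_state L W2 D2 I2 P2 Q2 by fact
  note f = wf_step_undir[OF A.wf]
  have "outs ?D p = {#(p, Lf a), (p, Lf b)#} + {#(p, Ud u)#}" using f
      by (simp add: add_mset_commute)
  then obtain p2 R2 where p2: "p2 \<in> W2" "outs D2 p2 = {#(p2, Lf a), (p2, Lf b)#} + R2"
    "ins D2 p2 = ins ?D p" and im: "image_mset (entry_of D2 P2 Q2) R2 = image_mset (entry_of ?D P Q)
        {#(p, Ud u)#}"
    by (rule cherry_transfer[OF A B arc_entries root_vectors f(7) _ f(9,10)])
  from im obtain g where R2: "R2 = {#g#}" and g: "entry_of D2 P2 Q2 g = entry_of ?D P Q (p, Ud u)"
    by (rule image_mset_eq_single)
  have "fst g = p2" using in_outs_iff[of g D2 p2] unfolding p2(2) R2 by simp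
  moreover have "\<exists>v. snd g = Ud v" using g by (cases g; cases
      "snd g") (auto simp: entry_of_def split: if_splits)
  ultimately obtain u2 where gx: "g = (p2, Ud u2)" by (cases g) auto
  have "(p2, Ud u2) \<in># outs D2 p2" unfolding p2(2) R2 gx by simp
  then have "(p2, Ud u2) \<in># D2" by simp
  then have "(u2, Ud p2) \<in># {#e \<in># D2. fst e \<noteq> p2#}" using B.wfD(9,10) by fastforce
  then obtain E where "{#e \<in># D2. fst e \<noteq> p2#} = add_mset (u2, Ud p2) E" by (metis insert_DiffM)
  then have D2: "D2 = {#(u2, Ud p2), (p2, Ud u2), (p2, Lf a), (p2, Lf b)#} + E"
    using outs_decomp[of D2 p2] p2(2) R2 gx by (simp add: add_mset_commute)
  note B' = B[unfolded D2]
  note h = wf_step_undir[OF B.wf[unfolded D2]]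
  note SA = step_undir_valued[OF A] and SB = step_undir_valued[OF B']
  have eq: "P2 p2 = P p"
    using g unfolding gx D2 SA(3) SB(3) by simp
  have "state_iso (W - {p}) ({#(u, Lf b)#} + D) I (W2 - {p2}) ({#(u2, Lf b)#} + E) I2"
    by (rule determinedD[OF IH SA(1) SB(1)]) (simp_all only: SA(4,5) SB(4,5) arc_entries
        root_vectors D2[symmetric] eq)
  then obtain f' where f': "I = I2" "bij_betw f' (W - {p}) (W2 - {p2})"
    "image_mset (map_arc f') ({#(u, Lf b)#} + D) = {#(u2, Lf b)#} + E" by (auto simp: state_iso_def)
  then have fu: "f' u = u2" "image_mset (map_arc f') D = E"
    using leaf_arc_cancel[of "f' u" b f' D u2 E] h by auto
  have "bij_betw (f'(p := p2)) W W2" using bij_betw_extend[OF f'(2)] f(7) p2(1) by blast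
  moreover have "image_mset (map_arc (f'(p := p2))) ?D = D2"
    using image_map_arc_upd[OF f(2,3), of f' p2] f fu by (simp add: D2)
  ultimately show "state_iso W ?D I W2 D2 I2" using f'(1) by (auto simp: state_iso_def)
qed

lemma determined_step_split:
  assumes IH: "determined TYPE('w) (insert c L) (W - {h}) ({#(p, Lf b), (p, Lf c), (q, Lf a)#} +
      D) I"
    and c: "c \<notin> L" "c \<noteq> 0"
  shows "determined TYPE('w) L W ({#(p, Lf b), (p, Nd h), (q, Nd h), (h, Lf a)#} + D) I" (is
      "determined _ _ _ ?D _")
proof (rule determinedI)
  fix P Q and W2 :: "'w set" and D2 I2 P2 Q2
  assume A: "valued_state L W ?D I P Q" and B: "valued_state L W2 D2 I2 P2 Q2"
    and arc_entries: "arc_entries ?D P Q = arc_entries D2 P2 Q2"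
        and root_vectors: "root_vectors W ?D I P = root_vectors W2 D2 I2 P2"
  interpret A: valued_state L W ?D I P Q by fact
  interpret B: valued_state L W2 D2 I2 P2 Q2 by fact
  note f = wf_step_split[OF A.wf c]
  note SA = step_split_valued[OF A c]
  obtain R where R: "outs ?D p = {#(p, Lf b), (p, Nd h)#} + R" by auto
  obtain p2 f1 f2 R2 where p2: "p2 \<in> W2" "outs D2 p2 = {#f1, f2#} + R2"
    "arc_vec P2 Q2 f1 + arc_vec P2 Q2 f2 = unit_vector 0 + unit_vector a + unit_vector b"
    by (rule pair_transfer[OF A B arc_entries root_vectors f(9) R, of "unit_vector 0 +
        unit_vector a + unit_vector b"])
      (use f(12,13) A.wfD(2,3) SA(5) in \<open>simp_all add: wt_unit add.commute\<close>)
  have f12: "f1 \<in># D2" "f2 \<in># D2" "fst f1 = p2" "fst f2 = p2"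
    using in_outs_iff[of f1 D2 p2] in_outs_iff[of f2 D2 p2] unfolding p2(2) by auto
  obtain h2 where h2: "ins D2 h2 = 2"
    "{#f1, f2#} = {#(p2, Lf b), (p2, Nd h2)#} \<and> (h2, Lf a) \<in># D2 \<or>
     {#f1, f2#} = {#(p2, Lf a), (p2, Nd h2)#} \<and> (h2, Lf b) \<in># D2"
    using B.reticulate_cherry_arcs[OF f12 p2(3) f(12,13)] by blast
  have "{#f1, f2#} \<noteq> {#(p2, Lf a), (p2, Nd h2)#}"
  proof
    assume eq: "{#f1, f2#} = {#(p2, Lf a), (p2, Nd h2)#}"
    have "entry_of ?D P Q (p, Nd h) \<in># arc_entries D2 P2 Q2" unfolding arc_entries[symmetric]
        by (simp add: arc_entries_def)
    then obtain e where e: "e \<in># D2" "entry_of D2 P2 Q2 e = entry_of ?D P Q (p, Nd h)"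
        by (auto simp: arc_entries_def)
    then have "arc_vec P2 Q2 e = unit_vector 0 + unit_vector a" using SA(5)
        by (simp add: entry_of_def)
    then obtain w h' where h': "outs D2 h' = {#(h', Lf a)#}" using B.hybrid_arc[OF e(1) _ f(12)]
        by blast
    have "(h', Lf a) \<in># outs D2 h'" "(p2, Lf a) \<in># outs D2 p2" unfolding h' p2(2) eq by simp_all
    then have "h' = p2" using B.Lf_unique[of h' a p2] by simp
    then show False using h' p2(2) by simp
  qed
  then have h2': "{#f1, f2#} = {#(p2, Lf b), (p2, Nd h2)#}" "(h2, Lf a) \<in># D2" using h2(2) by auto
  define E1 where "E1 = R2 + {#e \<in># D2. fst e \<noteq> p2#}"
  have D2a: "D2 = {#(p2, Lf b), (p2, Nd h2)#} + E1"
    using outs_decomp[of D2 p2] unfolding p2(2) h2'(1) E1_def by simp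
  have "ins E1 h2 \<noteq> 0" using h2(1) unfolding D2a by simp
  then obtain q2 where "(q2, Nd h2) \<in># E1" unfolding ins_0_iff by blast
  then obtain E2 where E2: "E1 = add_mset (q2, Nd h2) E2" by (metis insert_DiffM)
  have D2b: "D2 = {#(p2, Lf b), (p2, Nd h2), (q2, Nd h2)#} + E2" using D2a unfolding E2 by simp
  then have "(h2, Lf a) \<in># E2" using h2'(2) f(5) by auto
  then obtain E where E: "E2 = add_mset (h2, Lf a) E" by (metis insert_DiffM)
  have D2: "D2 = {#(p2, Lf b), (p2, Nd h2), (q2, Nd h2), (h2, Lf a)#} + E" using D2b unfolding E
      by (simp add: add_mset_commute)
  note B' = B[unfolded D2]
  note g = wf_step_split[OF B.wf[unfolded D2] c]
  note SB = step_split_valued[OF B' c]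
  have o: "(if size (outs D2 p2) = 3 then Some (P2 p2) else None) =
      (if size (outs ?D p) = 3 then Some (P p) else None)"
  proof -
    have "entry_of ?D P Q (p, Lf b) \<in># arc_entries D2 P2 Q2" unfolding arc_entries[symmetric]
        by (simp add: arc_entries_def)
    then obtain e where e: "e \<in># D2" "entry_of D2 P2 Q2 e = entry_of ?D P Q (p, Lf b)"
        by (auto simp: arc_entries_def)
    then have "arc_vec P2 Q2 e = unit_vector b" by (simp add: entry_of_def)
    then have "e = (fst e, Lf b)" using B.arc_vec_unit_leaf[OF e(1)] f(13) by blast
    moreover have "(p2, Lf b) \<in># D2" by (subst D2) simp
    ultimately have e': "e = (p2, Lf b)" using B.Lf_unique[of "fst e" b p2] e(1) by metis
    show ?thesis using e(2) unfolding e' entry_of_def prod.inject fst_conv by blast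
  qed
  have "state_iso (W - {h}) ({#(p, Lf b), (p, Lf c), (q, Lf a)#} + D) I
     (W2 - {h2}) ({#(p2, Lf b), (p2, Lf c), (q2, Lf a)#} + E) I2"
    by (rule determinedD[OF IH SA(1) SB(1)]) (simp_all only: SA(2,3) SB(2,3) arc_entries
        root_vectors D2[symmetric] o)
  then obtain f' where f': "I = I2" "bij_betw f' (W - {h}) (W2 - {h2})"
    "image_mset (map_arc f') ({#(p, Lf b), (p, Lf c), (q, Lf a)#} +
        D) = {#(p2, Lf b), (p2, Lf c), (q2, Lf a)#} + E"
    by (auto simp: state_iso_def)
  have cab: "c \<noteq> a" "c \<noteq> b" "a \<noteq> b" using c f(5,12,13) by auto
  have 1: "f' p = p2" "image_mset (map_arc f') (add_mset (p, Lf c) (add_mset (q, Lf a) D)) =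
      add_mset (p2, Lf c) (add_mset (q2, Lf a) E)"
    using leaf_arc_cancel[of "f' p" b f' "add_mset (p, Lf c) (add_mset (q, Lf a) D)" p2
        "add_mset (p2, Lf c) (add_mset (q2, Lf a) E)"]
      f'(3) g(6-8) cab by auto
  have 2: "image_mset (map_arc f') (add_mset (q, Lf a) D) = add_mset (q2, Lf a) E"
    using 1 by simp
  have 3: "f' q = q2" "image_mset (map_arc f') D = E"
    using leaf_arc_cancel[of "f' q" a f' D q2 E] 2 g(6) by auto
  have "bij_betw (f'(h := h2)) W W2" using bij_betw_extend[OF f'(2)] f(11) g(11) by blast
  moreover have "image_mset (map_arc (f'(h := h2))) ?D = D2"
    using image_map_arc_upd[OF f(3,4), of f' h2] f 1 3 by (simp add: D2)
  ultimately show "state_iso W ?D I W2 D2 I2" using f'(1) by (auto simp: state_iso_def)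
qed

lemma determined_empty: "determined TYPE('w) L {} D I"
proof (rule determinedI)
  fix P Q and W2 :: "'w set" and D2 I2 P2 Q2
  assume A: "valued_state L {} D I P Q" and B: "valued_state L W2 D2 I2 P2 Q2"
    and arc_entries: "arc_entries D P Q = arc_entries D2 P2 Q2"
        and root_vectors: "root_vectors {} D I P = root_vectors W2 D2 I2 P2"
  interpret A: valued_state L "{}" D I P Q by fact
  interpret B: valued_state L W2 D2 I2 P2 Q2 by fact
  have D: "D = {#}" using A.wfD(5) by (metis empty_iff multiset_nonemptyE surj_pair)
  then have D2: "D2 = {#}" using arc_entries by (simp add: arc_entries_def)
  then have W2: "W2 = {}" using B.wfD(15) by fastforce
  have "unit_vector ` I = unit_vector ` I2" using root_vectors by (simp add: root_vectors_def W2)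
  then have "I = I2" by (simp add: inj_image_eq_iff inj_def)
  then show "state_iso {} D I W2 D2 I2" using D D2 W2 by (simp add: state_iso_def bij_betw_def)
qed

theorem steps_determined:
  assumes "step\<^sup>*\<^sup>* (L, W, D, I) (L', {}, D', I')"
  shows "determined TYPE('w) L W D I"
  using assms
proof (induction "(L, W, D, I)" arbitrary: L W D I rule: converse_rtranclp_induct)
  case base
  show ?case by (rule determined_empty)
next
  case (step z)
  obtain Lz Wz Dz Iz where z: "z = (Lz, Wz, Dz, Iz)" by (cases z)
  have IH: "determined TYPE('w) Lz Wz Dz Iz" using step(3) z by blast
  from step(1) show ?case unfolding z
  proof (cases rule: step.cases)
    case step_tree
    show ?thesis unfolding step_tree(1) by (rule determined_step_tree) (use IH step_tree in
        simp_all)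
  next
    case step_root2
    show ?thesis unfolding step_root2(1) by (rule determined_step_root2) (use IH step_root2 in
        simp_all)
  next
    case (step_root3 E p x a b)
    then obtain F where F: "E = add_mset (p, x) F" "outs F p = {#}"
      using outs_decomp[of E p] by (metis add_mset_add_single outs_filter union_commute)
    have D: "D = {#(p, Lf a), (p, Lf b), (p, x)#} + F" and "Dz = {#(p, Lf b), (p, x)#} + F"
      unfolding step_root3(1,4) F(1) by simp_all
    then show ?thesis unfolding D using IH step_root3 F by (intro determined_step_root3) metis+
  next
    case step_undir
    show ?thesis unfolding step_undir(1) by (rule determined_step_undir) (use IH step_undir in
        simp_all)
  next
    case step_split
    show ?thesis unfolding step_split(1) by (rule determined_step_split) (use IH step_split in
        simp_all)
  qed
qed

section \<open>From networks to states\<close>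

definition nonleaves :: "('v, 'e) sd_net \<Rightarrow> 'v set" where
  "nonleaves N = {v \<in> nodes N. \<not> is_leaf N v}"

definition darc :: "('v, 'e) sd_net \<Rightarrow> 'e \<Rightarrow> 'v arc" where
  "darc N e = (tail N e, if is_leaf N (head N e) then Lf (label N (head N e)) else Nd (head N e))"

definition uarcs :: "('v, 'e) sd_net \<Rightarrow> 'e \<Rightarrow> 'v arc multiset" where
  "uarcs N e = {#(tail N e, Ud (head N e)), (head N e, Ud (tail N e))#}"

definition arcs :: "('v, 'e) sd_net \<Rightarrow> 'v arc multiset" where
  "arcs N = image_mset (darc N) (mset_set (dedges N)) + (\<Sum>e \<in># mset_set (uedges N). uarcs N e)"

definition isolated_labels :: "('v, 'e) sd_net \<Rightarrow> nat set" where
  "isolated_labels N = label N ` {v. is_leaf N v \<and> deg N v = 0}"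

definition labelled_graph :: "('v, 'e) sd_net \<Rightarrow> bool" where
  "labelled_graph N \<longleftrightarrow> semidirected_graph N \<and> inj_on (label N) {v. is_leaf N v} \<and>
     (\<forall>v. is_leaf N v \<longrightarrow> deg_i N v \<le> 1) \<and> (\<forall>e \<in> uedges N. tail N e \<noteq> head N e)"

lemma labelled_graphD:
  assumes "labelled_graph N"
  shows "finite (nodes N)" "finite (uedges N)" "finite (dedges N)" "uedges N \<inter> dedges N = {}"
    "e \<in> edges N \<Longrightarrow> tail N e \<in> nodes N" "e \<in> edges N \<Longrightarrow> head N e \<in> nodes N"
    "e \<in> dedges N \<Longrightarrow> tail N e \<in> nodes N" "e \<in> dedges N \<Longrightarrow> head N e \<in> nodes N"
    "e \<in> uedges N \<Longrightarrow> tail N e \<in> nodes N" "e \<in> uedges N \<Longrightarrow> head N e \<in> nodes N"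
    "inj_on (label N) {v. is_leaf N v}" "is_leaf N v \<Longrightarrow> deg_i N v \<le> 1"
    "e \<in> uedges N \<Longrightarrow> tail N e \<noteq> head N e"
  using assms unfolding labelled_graph_def semidirected_graph_def edges_def ends_def by auto

lemma is_leaf_iff:
  assumes "finite (uedges N)" "finite (dedges N)"
  shows "is_leaf N v \<longleftrightarrow> v \<in> nodes N \<and> (\<forall>e \<in> dedges N. tail N e \<noteq> v) \<and> (\<forall>e \<in> uedges N. v \<notin> ends N e)"
  using assms by (auto simp: is_leaf_def deg_o_def deg_u_def)

lemma leaf_deg_0_iff:
  assumes "labelled_graph N" "is_leaf N v"
  shows "deg N v = 0 \<longleftrightarrow> (\<forall>e \<in> dedges N. head N e \<noteq> v)"
  using assms labelled_graphD(3)[OF assms(1)] by (auto simp: is_leaf_def deg_def deg_i_def)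

lemma leaf_in_edge_unique:
  assumes "labelled_graph N" "is_leaf N v" "e \<in> dedges N" "head N e = v" "f \<in> dedges N"
      "head N f = v"
  shows "e = f"
proof -
  have "card {e \<in> dedges N. head N e = v} \<le> 1" using labelled_graphD(12)[OF assms(1,2)]
      by (simp add: deg_i_def)
  then show ?thesis using assms labelled_graphD(3)[OF assms(1)] by (auto simp: card_le_Suc0_iff_eq)
qed

lemma incident_leaf:
  assumes "labelled_graph N" "is_leaf N v" "e \<in> dedges N" "head N e = v"
  shows "incident_edges N v = {e}"
  using assms is_leaf_iff[of N v] labelled_graphD(2,3)[OF assms(1)]
      leaf_in_edge_unique[OF assms(1,2)]
  by (auto simp: incident_edges_def edges_def ends_def)

lemma labelled_graphI:
  assumes "semidirected_graph N" "inj_on (label N) {v. is_leaf N v}"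
    "\<And>v e f. is_leaf N v \<Longrightarrow> e \<in> dedges N \<Longrightarrow> f \<in> dedges N \<Longrightarrow> head N e = v \<Longrightarrow> head N f = v \<Longrightarrow> e = f"
    "\<And>e. e \<in> uedges N \<Longrightarrow> tail N e \<noteq> head N e"
  shows "labelled_graph N"
proof -
  have "deg_i N v \<le> 1" if "is_leaf N v" for v
    using assms(1) assms(3)[OF that] by (auto simp: deg_i_def semidirected_graph_def
        card_le_Suc0_iff_eq)
  then show ?thesis using assms by (auto simp: labelled_graph_def)
qed

lemma suppress_arcs:
  assumes M: "labelled_graph M" and inc: "incident_edges M p = {e1, eb}" and ne: "e1 \<noteq> eb"
    and eb: "eb \<in> dedges M" "tail M eb = p" "head M eb = b" and b: "is_leaf M b"
    and e1: "e1 \<in> dedges M \<and> tail M e1 = u \<and> head M e1 = p \<or> e1 \<in> uedges M \<and> ends M e1 = {u, p}"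
    and up: "u \<noteq> p" and deg: "deg M p = 2" and sup: "suppress M p M'"
  shows "labelled_graph M'" "nonleaves M' = nonleaves M - {p}"
      "isolated_labels M' = isolated_labels M" "label M' = label M"
    "\<And>v. is_leaf M' v \<longleftrightarrow> is_leaf M v"
    "\<exists>R. arcs M = (if e1 \<in> dedges M then {#(u, Nd p)#} else {#(u, Ud p), (p, Ud u)#}) +
       {#(p, Lf (label M b))#} + R \<and> arcs M' = {#(u, Lf (label M b))#} + R"
proof -
  note d = labelled_graphD[OF M]
  have e1E: "e1 \<in> edges M" "e1 \<in> uedges M \<longleftrightarrow> e1 \<notin> dedges M" "ends M e1 = {u, p}"
    using e1 d(4) by (auto simp: edges_def ends_def)
  have ebU: "eb \<notin> uedges M" using eb d(4) by auto
  obtain f where f: "f \<notin> edges (delete_node M p)" and M': "M' = add_dedge (delete_node M p) f u b"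
    using sup
  proof cases
    case suppress_deg1 then show ?thesis using deg by simp
  next
    case (suppress_directed e1' e2' u' w f)
    then have "e2' \<in> {e1, eb}" "e1' \<in> {e1, eb}" using inc by auto
    moreover have "e2' \<noteq> e1" using suppress_directed(6,7) e1 up d(4) by auto
    ultimately have *: "e2' = eb" "e1' = e1" using suppress_directed(4) by auto
    then have "u' = u" "w = b" using suppress_directed(5,8) e1E(3) up eb(3)
        by (auto simp: doubleton_eq_iff)
    then show ?thesis using that[of f] suppress_directed by simp
  next
    case (suppress_undirected e1' e2' u' w f)
    then show ?thesis using eb by auto
  qed
  have pb: "p \<noteq> b" using eb b is_leaf_iff[OF d(2,3), of b] by auto
  have ub: "u \<noteq> b" using e1 b is_leaf_iff[OF d(2,3), of b] by auto
  have uW: "u \<in> nodes M" "\<not> is_leaf M u" using e1 d(7,9,10)[of e1] is_leaf_iff[OF d(2,3), of u]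
      by (auto simp: ends_def doubleton_eq_iff)
  have pL: "\<not> is_leaf M p" using eb is_leaf_iff[OF d(2,3), of p] by auto
  have pW: "p \<in> nodes M" using d(7)[OF eb(1)] eb by simp
  have bW: "b \<in> nodes M" using b by (simp add: is_leaf_def)
  define R where "R = dedges M - {e1, eb}"
  define RU where "RU = uedges M - {e1}"
  have M'E: "nodes M' = nodes M - {p}" "dedges M' = insert f R" "uedges M' = RU"
      "label M' = label M"
    "tail M' f = u" "head M' f = b"
    using ebU by (auto simp: M' add_dedge_def delete_node_def inc R_def RU_def)
  have fR: "f \<notin> R" "f \<notin> RU" using f ebU by (auto simp: delete_node_def edges_def inc R_def RU_def)
  then have M'R: "tail M' e = tail M e" "head M' e = head M e" if "e \<in> R \<union> RU" for e
    using that by (auto simp: M' add_dedge_def delete_node_def)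
  have Rp: "tail M e \<noteq> p" "head M e \<noteq> p" if "e \<in> R \<union> RU" for e
  proof -
    have "e \<in> edges M" "e \<notin> incident_edges M p" using that inc ebU
        by (auto simp: R_def RU_def edges_def)
    then show "tail M e \<noteq> p" "head M e \<noteq> p" by (auto simp: incident_edges_def ends_def)
  qed
  have fin: "finite R" "finite RU" using d by (auto simp: R_def RU_def)
  have leaf: "is_leaf M' v \<longleftrightarrow> is_leaf M v" for v
  proof
    assume v: "is_leaf M' v"
    then have v': "v \<in> nodes M" "v \<noteq> p" "v \<noteq> u" "\<And>e. e \<in> R \<Longrightarrow> tail M e \<noteq> v" "\<And>e. e \<in> RU \<Longrightarrow>
        v \<notin> ends M e"
      using is_leaf_iff[of M' v] fin M'E M'R by (auto simp: ends_def)
    show "is_leaf M v" unfolding is_leaf_iff[OF d(2,3)]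
    proof (intro conjI ballI)
      fix e assume "e \<in> dedges M"
      then show "tail M e \<noteq> v" using v' e1 eb d(4) by (cases "e \<in> R") (auto simp: R_def)
    next
      fix e assume "e \<in> uedges M"
      then show "v \<notin> ends M e" using v' e1E by (cases "e \<in> RU") (auto simp: RU_def)
    qed (rule v')
  next
    assume v: "is_leaf M v"
    then have "v \<noteq> p" "v \<noteq> u" using pL uW by auto
    moreover have "v \<in> nodes M" "\<And>e. e \<in> R \<Longrightarrow> tail M e \<noteq> v" "\<And>e. e \<in> RU \<Longrightarrow> v \<notin> ends M e"
      using v is_leaf_iff[OF d(2,3), of v] by (auto simp: R_def RU_def)
    ultimately show "is_leaf M' v" using is_leaf_iff[of M' v] fin M'E M'R by (auto simp: ends_def)
  qed
  then show "\<And>v. is_leaf M' v \<longleftrightarrow> is_leaf M v" .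
  show "label M' = label M" by (rule M'E)
  show "nonleaves M' = nonleaves M - {p}" by (auto simp: nonleaves_def leaf M'E)
  have sg: "semidirected_graph M'"
    unfolding semidirected_graph_def
  proof (intro conjI ballI)
    show "uedges M' \<inter> dedges M' = {}" using fR d(4) by (auto simp: M'E R_def RU_def)
  next
    fix e assume "e \<in> edges M'"
    then consider "e = f" | "e \<in> R \<union> RU" by (auto simp: edges_def M'E)
    then show "ends M' e \<subseteq> nodes M'"
    proof cases
      case 1
      then show ?thesis using uW bW up pb by (auto simp: ends_def M'E)
    next
      case 2
      then have "e \<in> edges M" by (auto simp: edges_def R_def RU_def)
      then show ?thesis using Rp[OF 2] M'R[OF 2] d(5,6)[of e] by (auto simp: ends_def M'E)
    qed
  qed (use fin d in \<open>auto simp: M'E\<close>)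
  have bR: "head M e \<noteq> b" if "e \<in> R" for e
    using leaf_in_edge_unique[OF M b eb(1,3), of e] that by (auto simp: R_def)
  show M's: "labelled_graph M'"
  proof (rule labelled_graphI[OF sg])
    show "inj_on (label M') {v. is_leaf M' v}" using d(11) by (simp add: leaf M'E)
  next
    fix v e g assume *: "is_leaf M' v" "e \<in> dedges M'" "g \<in> dedges M'" "head M' e = v"
        "head M' g = v"
    show "e = g"
    proof (cases "v = b")
      case True
      have "x = f" if "x \<in> dedges M'" "head M' x = b" for x
        using that bR[of x] M'R(2)[of x] unfolding M'E(2) by (metis UnCI insertE)
      then show ?thesis using * True by blast
    next
      case False
      then have R: "e \<in> R" "g \<in> R" using * M'E(2,6) by auto
      then have "head M e = v" "head M g = v" using * M'R(2)[of e] M'R(2)[of g] by auto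
      then show ?thesis using leaf_in_edge_unique[OF M, of v e g] *(1) R leaf by (auto simp: R_def)
    qed
  next
    fix e assume "e \<in> uedges M'"
    then show "tail M' e \<noteq> head M' e" using M'R d(13)[of e] by (auto simp: M'E RU_def)
  qed
  have "deg M' v = 0 \<longleftrightarrow> deg M v = 0" if v: "is_leaf M v" for v
  proof -
    have "v \<noteq> p" using v pL by auto
    then have "(\<forall>e \<in> dedges M'. head M' e \<noteq> v) \<longleftrightarrow> (\<forall>e \<in> dedges M. head M e \<noteq> v)"
      using M'R eb e1 d(4) by (auto simp: M'E R_def)
    then show ?thesis using leaf_deg_0_iff[OF M v] leaf_deg_0_iff[OF M's, of v] v
        by (simp add: leaf)
  qed
  then show "isolated_labels M' = isolated_labels M" by (auto simp: isolated_labels_def leaf M'E)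
  have darcR: "darc M' e = darc M e" if "e \<in> R" for e using M'R that
      by (simp add: darc_def leaf M'E)
  have uarcR: "uarcs M' e = uarcs M e" if "e \<in> RU" for e using M'R that by (simp add: uarcs_def)
  define S where "S = image_mset (darc M) (mset_set R) + (\<Sum>e \<in># mset_set RU. uarcs M e)"
  have "image_mset (darc M') (mset_set R) = image_mset (darc M) (mset_set R)"
    "image_mset (uarcs M') (mset_set RU) = image_mset (uarcs M) (mset_set RU)"
    by (auto intro!: image_mset_cong simp: darcR uarcR fin)
  then have 1: "arcs M' = {#(u, Lf (label M b))#} + S"
    using fin fR b M'E by (simp add: arcs_def S_def darc_def[of M' f] leaf)
  have "arcs M = (if e1 \<in> dedges M then {#(u, Nd p)#} else {#(u, Ud p), (p, Ud u)#}) +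
       {#(p, Lf (label M b))#} + S"
  proof (cases "e1 \<in> dedges M")
    case True
    then have "dedges M = insert e1 (insert eb R)" "uedges M = RU" using eb e1E
        by (auto simp: R_def RU_def)
    moreover have "e1 \<notin> R" "eb \<notin> R" by (auto simp: R_def)
    moreover have "darc M e1 = (u, Nd p)" "darc M eb = (p, Lf (label M b))"
      using True e1 e1E eb b pL by (auto simp: darc_def)
    ultimately show ?thesis using True fin ne by (simp add: arcs_def S_def)
  next
    case False
    then have "dedges M = insert eb R" "uedges M = insert e1 RU" using eb e1E
        by (auto simp: R_def RU_def)
    moreover have "e1 \<notin> RU" "eb \<notin> R" by (auto simp: R_def RU_def)
    moreover have "uarcs M e1 = {#(u, Ud p), (p, Ud u)#}" "darc M eb = (p, Lf (label M b))"
      using False e1E eb b by (auto simp: darc_def uarcs_def ends_def doubleton_eq_iff)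
    ultimately show ?thesis using False fin by (simp add: arcs_def S_def)
  qed
  then show "\<exists>R. arcs M = (if e1 \<in> dedges M then {#(u, Nd p)#} else {#(u, Ud p), (p, Ud u)#}) +
       {#(p, Lf (label M b))#} + R \<and> arcs M' = {#(u, Lf (label M b))#} + R" using 1 by blast
qed

lemma remove_edge_arcs:
  assumes M: "labelled_graph M" and e: "e \<in> dedges M"
    and M': "nodes M' = nodes M - X" "dedges M' = dedges M - {e}" "uedges M' = uedges M"
      "label M' = label M" "tail M' = tail M" "head M' = head M"
    and X: "\<And>d. d \<in> edges M - {e} \<Longrightarrow> ends M d \<inter> X = {}"
    and tail: "tail M e \<in> X \<or> (\<exists>d \<in> dedges M - {e}. tail M d = tail M e)"
  shows "labelled_graph M'" "\<And>v. is_leaf M' v \<longleftrightarrow> is_leaf M v \<and> v \<notin> X" "arcs M = {#darc M e#} +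
      arcs M'"
    "is_leaf M (head M e) \<longrightarrow> head M e \<in> X \<Longrightarrow> X \<inter> {v. is_leaf M v} \<subseteq> {head M e} \<Longrightarrow>
        isolated_labels M' = isolated_labels M"
    "is_leaf M (head M e) \<Longrightarrow> X \<inter> {v. is_leaf M v} = {} \<Longrightarrow>
        isolated_labels M' = insert (label M (head M e)) (isolated_labels M)"
proof -
  note d = labelled_graphD[OF M]
  define R where "R = dedges M - {e}"
  note M'E = M'[folded R_def]
  have fin: "finite R" using d by (simp add: R_def)
  have eU: "e \<notin> uedges M" using e d(4) by auto
  have RX: "tail M f \<notin> X" "head M f \<notin> X" if "f \<in> R \<union> uedges M" for f
    using X[of f] that eU by (auto simp: R_def edges_def ends_def)
  show leaf: "is_leaf M' v \<longleftrightarrow> is_leaf M v \<and> v \<notin> X" for v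
  proof -
    have "(\<forall>f \<in> R. tail M f \<noteq> v) \<longleftrightarrow> (\<forall>f \<in> dedges M. tail M f \<noteq> v)" if "v \<notin> X"
      using tail e that unfolding R_def by (metis Diff_iff singletonD)
    then show ?thesis
      using is_leaf_iff[of M' v] is_leaf_iff[OF d(2,3), of v] fin d(2) by (auto simp: M'E ends_def)
  qed
  have sg: "semidirected_graph M'"
    unfolding semidirected_graph_def
  proof (intro conjI ballI)
    fix f assume "f \<in> edges M'"
    then have "f \<in> R \<union> uedges M" "f \<in> edges M" by (auto simp: edges_def M'E R_def)
    then show "ends M' f \<subseteq> nodes M'" using RX[of f] d(5,6)[of f] by (auto simp: ends_def M'E)
  qed (use fin d(1-4) in \<open>auto simp: M'E R_def\<close>)
  show M's: "labelled_graph M'"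
  proof (rule labelled_graphI[OF sg])
    show "inj_on (label M') {v. is_leaf M' v}" using d(11) by (auto simp: leaf M'E inj_on_def)
  next
    fix v f g assume *: "is_leaf M' v" "f \<in> dedges M'" "g \<in> dedges M'" "head M' f = v"
        "head M' g = v"
    then have "is_leaf M v" "f \<in> dedges M" "g \<in> dedges M" "head M f = v" "head M g = v"
      unfolding leaf M'E R_def by blast+
    then show "f = g" using leaf_in_edge_unique[OF M] by blast
  qed (use d(13) in \<open>auto simp: M'E\<close>)
  have deg: "deg M' v = 0 \<longleftrightarrow> deg M v = 0 \<or> v = head M e" if v: "is_leaf M v" "v \<notin> X" for v
  proof -
    have "deg M' v = 0 \<longleftrightarrow> (\<forall>f \<in> R. head M f \<noteq> v)"
      using leaf_deg_0_iff[OF M's, of v] v by (simp add: leaf M'E)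
    moreover have "v \<noteq> head M e \<Longrightarrow> (\<forall>f \<in> R. head M f \<noteq> v) \<longleftrightarrow> (\<forall>f \<in> dedges M. head M f \<noteq> v)"
      by (auto simp: R_def)
    moreover have "\<forall>f \<in> R. head M f \<noteq> v" if "v = head M e"
      using leaf_in_edge_unique[OF M v(1) e] that by (auto simp: R_def)
    ultimately show ?thesis using leaf_deg_0_iff[OF M v(1)] by (cases "v = head M e") auto
  qed
  have deg_h: "is_leaf M (head M e) \<Longrightarrow> deg M (head M e) \<noteq> 0" using leaf_deg_0_iff[OF M] e by auto
  show "isolated_labels M' = isolated_labels M"
    if "is_leaf M (head M e) \<longrightarrow> head M e \<in> X" "X \<inter> {v. is_leaf M v} \<subseteq> {head M e}"
  proof -
    have "is_leaf M' v \<and> deg M' v = 0 \<longleftrightarrow> is_leaf M v \<and> deg M v = 0" for v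
    proof (cases "v \<in> X")
      case True
      then have "v = head M e" if "is_leaf M v" using \<open>X \<inter> {v. is_leaf M v} \<subseteq> {head M e}\<close> that
          by blast
      then show ?thesis using True deg_h leaf by metis
    next
      case False
      then show ?thesis using that(1) deg[of v] leaf[of v] by metis
    qed
    then show ?thesis by (simp add: isolated_labels_def M'E)
  qed
  show "isolated_labels M' = insert (label M (head M e)) (isolated_labels M)"
    if "is_leaf M (head M e)" "X \<inter> {v. is_leaf M v} = {}"
  proof -
    have "{v. is_leaf M' v \<and> deg M' v = 0} = insert (head M e) {v. is_leaf M v \<and> deg M v = 0}"
      using that deg by (auto simp: leaf)
    then show ?thesis by (simp add: isolated_labels_def M'E)
  qed
  have "darc M' f = darc M f" if "f \<in> R" for f using RX[of f] that by (auto simp: darc_def leaf M'E)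
  then have "image_mset (darc M') (mset_set R) = image_mset (darc M) (mset_set R)"
    using fin by (auto intro!: image_mset_cong)
  moreover have "uarcs M' = uarcs M" by (auto simp: uarcs_def M'E fun_eq_iff)
  moreover have "dedges M = insert e R" "e \<notin> R" using e by (auto simp: R_def)
  ultimately show "arcs M = {#darc M e#} + arcs M'" using fin by (simp add: arcs_def M'E)
qed

lemma delete_root_arcs:
  assumes M: "labelled_graph M" and inc: "incident_edges M p = {eb}"
    and eb: "eb \<in> dedges M" "tail M eb = p" "head M eb = b" and b: "is_leaf M b"
  defines "M' \<equiv> delete_node M p"
  shows "labelled_graph M'" "nonleaves M' = nonleaves M - {p}"
      "isolated_labels M' = insert (label M b) (isolated_labels M)"
    "label M' = label M" "\<And>v. is_leaf M' v \<longleftrightarrow> is_leaf M v"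
    "arcs M = {#(p, Lf (label M b))#} + arcs M'"
proof -
  note d = labelled_graphD[OF M]
  have pL: "\<not> is_leaf M p" using eb is_leaf_iff[OF d(2,3), of p] by auto
  have E: "nodes M' = nodes M - {p}" "dedges M' = dedges M - {eb}" "uedges M' = uedges M"
    "label M' = label M" "tail M' = tail M" "head M' = head M"
    using eb(1) d(4) by (auto simp: M'_def delete_node_def inc)
  have X: "ends M f \<inter> {p} = {}" if "f \<in> edges M - {eb}" for f using that inc
      by (auto simp: incident_edges_def)
  note r = remove_edge_arcs[OF M eb(1) E X disjI1]
  show "labelled_graph M'" "label M' = label M" using r(1) eb E by simp_all
  show leaf: "is_leaf M' v \<longleftrightarrow> is_leaf M v" for v using r(2) eb pL by auto
  show "nonleaves M' = nonleaves M - {p}" by (auto simp: nonleaves_def leaf E)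
  show "isolated_labels M' = insert (label M b) (isolated_labels M)" using r(5) eb b pL by auto
  show "arcs M = {#(p, Lf (label M b))#} + arcs M'" using r(3) eb b by (simp add: darc_def)
qed

lemma delete_leaf_arcs:
  assumes M: "labelled_graph M" and ea: "ea \<in> dedges M" "tail M ea = p" "head M ea = a"
      and a: "is_leaf M a"
    and other: "eb \<in> dedges M" "tail M eb = p" "eb \<noteq> ea"
  defines "M' \<equiv> delete_node M a"
  shows "labelled_graph M'" "nonleaves M' = nonleaves M" "isolated_labels M' = isolated_labels M"
      "label M' = label M"
    "\<And>v. is_leaf M' v \<longleftrightarrow> is_leaf M v \<and> v \<noteq> a"
    "arcs M = {#(p, Lf (label M a))#} + arcs M'"
    "dedges M' = dedges M - {ea}" "uedges M' = uedges M" "tail M' = tail M" "head M' = head M"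
proof -
  note inc = incident_leaf[OF M a ea(1,3)]
  have E: "nodes M' = nodes M - {a}" "dedges M' = dedges M - {ea}" "uedges M' = uedges M"
    "label M' = label M" "tail M' = tail M" "head M' = head M"
    using ea(1) labelled_graphD(4)[OF M] by (auto simp: M'_def delete_node_def inc)
  then show "dedges M' = dedges M - {ea}" "uedges M' = uedges M" "tail M' = tail M"
      "head M' = head M"
    "label M' = label M" by simp_all
  have X: "ends M f \<inter> {a} = {}" if "f \<in> edges M - {ea}" for f using that inc
      by (auto simp: incident_edges_def)
  have t: "\<exists>d \<in> dedges M - {ea}. tail M d = tail M ea" using other ea by auto
  note r = remove_edge_arcs[OF M ea(1) E X disjI2[OF t]]
  show "labelled_graph M'" using r(1) by simp
  show leaf: "is_leaf M' v \<longleftrightarrow> is_leaf M v \<and> v \<noteq> a" for v using r(2) by simp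
  show "nonleaves M' = nonleaves M" using a by (auto simp: nonleaves_def leaf E)
  show "isolated_labels M' = isolated_labels M" using r(4) ea by auto
  show "arcs M = {#(p, Lf (label M a))#} + arcs M'" using r(3) ea a by (simp add: darc_def)
qed

lemma delete_edge_arcs:
  assumes M: "labelled_graph M" and e: "e \<in> dedges M" "tail M e = p" "head M e = h"
      and h: "\<not> is_leaf M h"
    and other: "eb \<in> dedges M" "tail M eb = p" "eb \<noteq> e"
  defines "M' \<equiv> delete_edge M e"
  shows "labelled_graph M'" "nonleaves M' = nonleaves M" "isolated_labels M' = isolated_labels M"
      "label M' = label M"
    "\<And>v. is_leaf M' v \<longleftrightarrow> is_leaf M v"
    "arcs M = {#(p, Nd h)#} + arcs M'"
    "dedges M' = dedges M - {e}" "uedges M' = uedges M" "tail M' = tail M" "head M' = head M"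
proof -
  have E: "nodes M' = nodes M - {}" "dedges M' = dedges M - {e}" "uedges M' = uedges M"
    "label M' = label M" "tail M' = tail M" "head M' = head M"
    using e(1) labelled_graphD(4)[OF M] by (auto simp: M'_def delete_edge_def)
  then show "dedges M' = dedges M - {e}" "uedges M' = uedges M" "tail M' = tail M"
      "head M' = head M"
    "label M' = label M" by simp_all
  have t: "\<exists>d \<in> dedges M - {e}. tail M d = tail M e" using other e by auto
  note r = remove_edge_arcs[OF M e(1) E Int_empty_right disjI2[OF t]]
  show "labelled_graph M'" using r(1) by simp
  show leaf: "is_leaf M' v \<longleftrightarrow> is_leaf M v" for v using r(2) by simp
  show "nonleaves M' = nonleaves M" by (auto simp: nonleaves_def leaf E)
  show "isolated_labels M' = isolated_labels M" using r(4) e h by auto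
  show "arcs M = {#(p, Nd h)#} + arcs M'" using r(3) e h by (simp add: darc_def)
qed

lemma in_arcs_iff:
  assumes "finite (dedges N)" "finite (uedges N)"
  shows "(u, Lf i) \<in># arcs N \<longleftrightarrow> (\<exists>e \<in> dedges N. tail N e = u \<and> is_leaf N (head N e) \<and>
      label N (head N e) = i)"
    "(u, Nd v) \<in># arcs N \<longleftrightarrow> (\<exists>e \<in> dedges N. tail N e = u \<and> head N e = v \<and> \<not> is_leaf N v)"
    "(u, Ud v) \<in># arcs N \<longleftrightarrow> (\<exists>e \<in> uedges N. tail N e = u \<and> head N e = v \<or> tail N e = v \<and>
        head N e = u)"
  using assms by (auto simp: arcs_def darc_def uarcs_def image_iff)

lemma size_filter_image_mset_set:
  "finite A \<Longrightarrow> size {#y \<in># image_mset f (mset_set A). Q y#} = card {x \<in> A. Q (f x)}"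
  by (simp add: filter_mset_image_mset filter_mset_mset_set comp_def)

lemma uarcs_sum:
  assumes "finite U" "\<And>e. e \<in> U \<Longrightarrow> tail N e \<noteq> head N e"
  shows "ins (\<Sum>e \<in># mset_set U. uarcs N e) v = 0"
    "size (outs (\<Sum>e \<in># mset_set U. uarcs N e) v) = card {e \<in> U. v \<in> ends N e}"
    "leaf_count (\<Sum>e \<in># mset_set U. uarcs N e) i = 0"
proof -
  show "ins (\<Sum>e \<in># mset_set U. uarcs N e) v = 0" "leaf_count (\<Sum>e \<in># mset_set U. uarcs N e) i = 0"
    using assms(1) by (auto simp: ins_0_iff leaf_count_0_iff uarcs_def)
  show "size (outs (\<Sum>e \<in># mset_set U. uarcs N e) v) = card {e \<in> U. v \<in> ends N e}"
    using assms
  proof (induction U rule: finite_induct)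
    case empty then show ?case by simp
  next
    case (insert e U)
    have "{x \<in> insert e U. v \<in> ends N x} = (if v \<in> ends N e then insert e {x \<in> U. v \<in> ends N x} else
        {x \<in> U. v \<in> ends N x})"
      by auto
    moreover have "tail N e \<noteq> head N e" using insert.prems[of e] by simp
    moreover have "size (outs (uarcs N e) v) = (if v \<in> ends N e then 1 else 0)"
      using calculation(2) by (auto simp: uarcs_def ends_def)
    ultimately show ?case using insert.IH insert.prems insert.hyps by simp
  qed
qed

lemma deg_arcs:
  assumes "labelled_graph N" "\<not> is_leaf N v"
  shows "deg_i N v = ins (arcs N) v" "deg_o N v + deg_u N v = size (outs (arcs N) v)"
proof -
  note d = labelled_graphD[OF assms(1)]
  have "ins (arcs N) v = card {e \<in> dedges N. snd (darc N e) = Nd v}"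
    using uarcs_sum(1)[OF d(2,13)] d(3) by (simp add: arcs_def) (simp add: ins_def
        size_filter_image_mset_set)
  also have "{e \<in> dedges N. snd (darc N e) = Nd v} = {e \<in> dedges N. head N e = v}"
    using assms(2) by (auto simp: darc_def)
  finally show "deg_i N v = ins (arcs N) v" by (simp add: deg_i_def)
  have "size (outs (arcs N) v) = card {e \<in> dedges N. fst (darc N e) = v} +
      card {e \<in> uedges N. v \<in> ends N e}"
    using uarcs_sum(2)[OF d(2,13)] d(3) by (simp add: arcs_def) (simp add: outs_def
        size_filter_image_mset_set)
  then show "deg_o N v + deg_u N v = size (outs (arcs N) v)"
      by (simp add: deg_o_def deg_u_def darc_def)
qed

lemma undir_class_self: "v \<in> undir_class N v"
  by (simp add: undir_class_def)

lemma undir_rel_sym: "sym (undir_rel N)"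
  by (auto simp: undir_rel_def sym_def insert_commute)

lemma undir_class_eq:
  assumes "w \<in> undir_class N v"
  shows "undir_class N w = undir_class N v"
proof -
  have 1: "(v, w) \<in> (undir_rel N)\<^sup>*" using assms by (simp add: undir_class_def)
  then have 2: "(w, v) \<in> (undir_rel N)\<^sup>*" using sym_rtrancl[OF undir_rel_sym[of N]] by (metis symD)
  show ?thesis unfolding undir_class_def by (intro Collect_cong) (metis 1 2 rtrancl_trans)
qed

lemma undir_class_singleton:
  assumes "finite (uedges N)" "\<And>e. e \<in> uedges N \<Longrightarrow> tail N e \<noteq> head N e"
  shows "undir_class N v = {v} \<longleftrightarrow> deg_u N v = 0"
proof
  assume *: "undir_class N v = {v}"
  have "v \<notin> ends N e" if e: "e \<in> uedges N" for e
  proof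
    assume "v \<in> ends N e"
    then have "v = tail N e \<or> v = head N e" by (simp add: ends_def)
    then obtain w where w: "ends N e = {v, w}" "w \<noteq> v"
      using assms(2)[OF e] unfolding ends_def by (metis insert_commute)
    then have "w \<in> undir_class N v" using e by (auto simp: undir_class_def undir_rel_def)
    then show False using * w by auto
  qed
  then show "deg_u N v = 0" using assms(1) by (simp add: deg_u_def)
next
  assume "deg_u N v = 0"
  then have no: "v \<notin> ends N e" if "e \<in> uedges N" for e using assms(1) that by (auto simp: deg_u_def)
  show "undir_class N v = {v}"
  proof (rule ccontr)
    assume "undir_class N v \<noteq> {v}"
    then obtain w where "(v, w) \<in> (undir_rel N)\<^sup>*" "w \<noteq> v" by (auto simp: undir_class_def)
    then obtain x where "(v, x) \<in> undir_rel N" by (metis converse_rtranclE)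
    then show False using no by (auto simp: undir_rel_def)
  qed
qed

lemma root_component_iff:
  assumes "finite (dedges N)"
  shows "T \<in> root_components N \<longleftrightarrow>
    T \<in> undir_class N ` nodes N \<and> (\<forall>e \<in> dedges N. undir_class N (head N e) \<noteq> T)"
  using assms by (auto simp: root_components_def is_root_def contraction_def deg_i_def deg_u_def)

lemma singleton_root_component:
  assumes "labelled_graph N"
  shows "{p} \<in> root_components N \<longleftrightarrow> p \<in> nodes N \<and> deg_i N p = 0 \<and> deg_u N p = 0"
proof -
  note d = labelled_graphD[OF assms]
  have p: "{p} = undir_class N v \<longleftrightarrow> v = p \<and> deg_u N p = 0" for v
    using undir_class_singleton[OF d(2,13), of p] undir_class_self[of v N] by (metis singletonD)
  then show ?thesis
    using d(3) unfolding root_component_iff[OF d(3)]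
    by (auto simp: p image_iff deg_i_def eq_commute[of _ "{p}"])
qed

lemma suppress_step_arcs:
  assumes M: "labelled_graph M" and S: "suppress_if_suppressible M p M' \<or> suppress M p M'"
      and b: "is_leaf M b"
    and eb: "eb \<in> dedges M" "tail M eb = p" "head M eb = b"
        and D: "arcs M = {#(p, Lf (label M b))#} + D"
  shows
    "\<lbrakk>D = {#(u, Nd p)#} + E; outs E p = {#}; ins E p = 0; u \<noteq> p\<rbrakk> \<Longrightarrow>
      labelled_graph M' \<and> nonleaves M' = nonleaves M - {p} \<and> isolated_labels M' = isolated_labels M
          \<and> label M' = label M \<and>
      (\<forall>v. is_leaf M' v \<longleftrightarrow> is_leaf M v) \<and> arcs M' = {#(u, Lf (label M b))#} + E"
    "\<lbrakk>D = {#(u, Ud p), (p, Ud u)#} + E; outs E p = {#}; ins E p = 0; u \<noteq> p; suppress_if_suppressible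
        M p M'\<rbrakk> \<Longrightarrow>
      labelled_graph M' \<and> nonleaves M' = nonleaves M - {p} \<and> isolated_labels M' = isolated_labels M
          \<and> label M' = label M \<and>
      (\<forall>v. is_leaf M' v \<longleftrightarrow> is_leaf M v) \<and> arcs M' = {#(u, Lf (label M b))#} + E"
    "\<lbrakk>outs D p = {#}; ins D p = 0; suppress_if_suppressible M p M'\<rbrakk> \<Longrightarrow>
      labelled_graph M' \<and> nonleaves M' = nonleaves M - {p} \<and>
          isolated_labels M' = insert (label M b) (isolated_labels M) \<and> label M' = label M \<and>
      (\<forall>v. is_leaf M' v \<longleftrightarrow> is_leaf M v) \<and> arcs M' = D"
    "\<lbrakk>size (outs D p) = 1; ins D p = 0; \<forall>v. (p, Ud v) \<notin># D;
      suppress_if_suppressible M p M'\<rbrakk> \<Longrightarrow> M' = M"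
proof -
  note d = labelled_graphD[OF M]
  have pL: "\<not> is_leaf M p" using eb is_leaf_iff[OF d(2,3), of p] by auto
  have pW: "p \<in> nodes M" using d(7)[OF eb(1)] eb by simp
  note deg = deg_arcs[OF M pL]
  have ebo: "eb \<in> {e \<in> dedges M. tail M e = p}" using eb by simp
  then have o1: "1 \<le> deg_o M p" unfolding deg_o_def
    using d(3) by (auto simp: Suc_le_eq card_gt_0_iff)
  have single: "{e \<in> dedges M. tail M e = p} = {eb}" if "deg_o M p = 1"
    using that ebo unfolding deg_o_def by (metis card_1_singletonE singletonD)
  have incE: "incident_edges M p = {e \<in> dedges M. tail M e = p} \<union> {e \<in> dedges M. head M e = p} \<union> {e
      \<in> uedges M. p \<in> ends M e}"
    by (auto simp: incident_edges_def edges_def ends_def)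
  have u0: "deg_u M p = 0 \<longleftrightarrow> {e \<in> uedges M. p \<in> ends M e} = {}" using d(2) by (simp add: deg_u_def)
  have i0: "deg_i M p = 0 \<longleftrightarrow> {e \<in> dedges M. head M e = p} = {}" using d(3) by (simp add: deg_i_def)
  note rc = singleton_root_component[OF M, of p]
  { assume A: "D = {#(u, Nd p)#} + E" "outs E p = {#}" "ins E p = 0" "u \<noteq> p"
    have dg: "deg_i M p = 1" "deg_o M p = 1" "deg_u M p = 0" using deg A D o1 by auto
    then obtain e1 where e1: "{e \<in> dedges M. head M e = p} = {e1}" unfolding deg_i_def
        by (metis card_1_singletonE)
    then have e1': "e1 \<in> dedges M" "head M e1 = p" by auto
    have "(tail M e1, Nd p) \<in># arcs M" unfolding in_arcs_iff[OF d(3,2)] using e1' pL by auto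
    then have tu: "tail M e1 = u" using A D by (auto simp: ins_0_iff)
    have inc: "incident_edges M p = {e1, eb}" unfolding incE e1 single[OF dg(2)] using u0 dg by auto
    have ne: "e1 \<noteq> eb" using tu eb A(4) by auto
    have dg2: "deg M p = 2" using dg by (simp add: deg_def)
    have sup: "suppress M p M'" using S rc dg dg2 pL pW
        by (simp add: suppress_if_suppressible_def suppressible_def)
    have e1d: "e1 \<in> dedges M \<and> tail M e1 = u \<and> head M e1 = p \<or> e1 \<in> uedges M \<and> ends M e1 = {u, p}"
      using e1' tu by simp
    note s = suppress_arcs[OF M inc ne eb b e1d A(4) dg2 sup]
    obtain R where "arcs M = {#(u, Nd p)#} + {#(p, Lf (label M b))#} + R"
        "arcs M' = {#(u, Lf (label M b))#} + R"
      using s(6) e1'(1) by auto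
    then have "arcs M' = {#(u, Lf (label M b))#} + E" using D A(1) by simp
    then show "labelled_graph M' \<and> nonleaves M' = nonleaves M - {p} \<and>
        isolated_labels M' = isolated_labels M \<and> label M' = label M \<and>
      (\<forall>v. is_leaf M' v \<longleftrightarrow> is_leaf M v) \<and> arcs M' = {#(u, Lf (label M b))#} + E" using s(1-5)
          by blast
  next
    assume A: "D = {#(u, Ud p), (p, Ud u)#} + E" "outs E p = {#}" "ins E p = 0" "u \<noteq> p"
      and S: "suppress_if_suppressible M p M'"
    have sz: "deg_i M p = 0" "deg_o M p + deg_u M p = 2" using deg A D by auto
    have "(u, Ud p) \<in># arcs M" using A D by simp
    then obtain e1 where e1: "e1 \<in> uedges M" "ends M e1 = {u, p}"
      unfolding in_arcs_iff[OF d(3,2)] by (auto simp: ends_def)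
    then have "deg_u M p \<noteq> 0" using u0 by auto
    then have dg: "deg_i M p = 0" "deg_o M p = 1" "deg_u M p = 1" using sz o1 by auto
    then obtain e where "{e \<in> uedges M. p \<in> ends M e} = {e}" unfolding deg_u_def
        by (metis card_1_singletonE)
    then have e1s: "{e \<in> uedges M. p \<in> ends M e} = {e1}" using e1 by auto
    have inc: "incident_edges M p = {e1, eb}" unfolding incE e1s single[OF dg(2)] using i0 dg
        by auto
    have ne: "e1 \<noteq> eb" using e1 eb d(4) by auto
    have dg2: "deg M p = 2" using dg by (simp add: deg_def)
    have sup: "suppress M p M'" using S rc dg dg2 pL pW
        by (simp add: suppress_if_suppressible_def suppressible_def)
    have e1d: "e1 \<in> dedges M \<and> tail M e1 = u \<and> head M e1 = p \<or> e1 \<in> uedges M \<and> ends M e1 = {u, p}"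
      using e1 by simp
    note s = suppress_arcs[OF M inc ne eb b e1d A(4) dg2 sup]
    have "e1 \<notin> dedges M" using e1 d(4) by auto
    then obtain R where "arcs M = {#(u, Ud p), (p, Ud u)#} + {#(p, Lf (label M b))#} + R"
        "arcs M' = {#(u, Lf (label M b))#} + R"
      using s(6) by auto
    then have "arcs M' = {#(u, Lf (label M b))#} + E" using D A(1) by simp
    then show "labelled_graph M' \<and> nonleaves M' = nonleaves M - {p} \<and>
        isolated_labels M' = isolated_labels M \<and> label M' = label M \<and>
      (\<forall>v. is_leaf M' v \<longleftrightarrow> is_leaf M v) \<and> arcs M' = {#(u, Lf (label M b))#} + E" using s(1-5)
          by blast
  next
    assume A: "outs D p = {#}" "ins D p = 0" "suppress_if_suppressible M p M'"
    have dg: "deg_i M p = 0" "deg_o M p = 1" "deg_u M p = 0" using deg A D o1 by auto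
    have inc: "incident_edges M p = {eb}" unfolding incE single[OF dg(2)] using i0 u0 dg by auto
    have dg1: "deg M p = 1" using dg by (simp add: deg_def)
    have "is_parent M p b" "is_tree_node M b" using eb b d(12)
        by (auto simp: is_parent_def is_tree_node_def is_leaf_def)
    then have "suppressible M p" using rc dg dg1 pL pW by (auto simp: suppressible_def)
    then have sup: "suppress M p M'" using A(3) by (simp add: suppress_if_suppressible_def)
    then have M': "M' = delete_node M p" using dg1 by cases auto
    note s = delete_root_arcs[OF M inc eb b]
    then show "labelled_graph M' \<and> nonleaves M' = nonleaves M - {p} \<and>
        isolated_labels M' = insert (label M b) (isolated_labels M) \<and> label M' = label M \<and>
      (\<forall>v. is_leaf M' v \<longleftrightarrow> is_leaf M v) \<and> arcs M' = D" unfolding M' using D by simp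
  next
    assume A: "size (outs D p) = 1" "ins D p = 0" "\<forall>v. (p, Ud v) \<notin># D"
      and S: "suppress_if_suppressible M p M'"
    have "deg_u M p = 0"
    proof (rule ccontr)
      assume "deg_u M p \<noteq> 0"
      then obtain e where "e \<in> uedges M" "p \<in> ends M e" using u0 by auto
      then obtain v where "(p, Ud v) \<in># arcs M" unfolding in_arcs_iff[OF d(3,2)]
          by (auto simp: ends_def)
      then show False using A(3) D by auto
    qed
    then have dg: "deg_i M p = 0" "deg_u M p = 0" "deg_o M p = 2" using deg A D by auto
    then have "deg M p = 2" by (simp add: deg_def)
    then show "M' = M" using S rc dg pW by (simp add: suppress_if_suppressible_def suppressible_def)
  }
qed

lemma cherry_arc_cases:
  assumes wf: "wf_state L W ({#(p, Lf a), (p, Lf b)#} + D) I"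
  obtains
    (tree) u E where "D = {#(u, Nd p)#} + E" "outs E p = {#}" "ins E p = 0" "u \<noteq> p"
  | (undir) u E where "D = {#(u, Ud p), (p, Ud u)#} + E" "outs E p = {#}" "ins E p = 0" "u \<noteq> p"
  | (root2) "outs D p = {#}" "ins D p = 0"
  | (root3) x where "outs D p = {#(p, x)#}" "\<forall>v. x \<noteq> Ud v" "ins D p = 0"
proof -
  note d = wf_stateD[OF wf]
  have pW: "p \<in> W" using d(5)[of p "Lf a"] by simp
  from d(15)[OF pW] consider "ins D p = 1" "outs D p = {#}" | "ins D p = 0" "outs D p = {#}" |
      "ins D p = 0" "size (outs D p) = 1"
    by auto
  then show thesis
  proof cases
    case 1
    then obtain u where "(u, Nd p) \<in># D" using ins_0_iff[of D p] by auto
    then obtain E where E: "D = add_mset (u, Nd p) E" by (metis insert_DiffM)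
    then show thesis using tree[of u E] 1 by (auto split: if_splits)
  next
    case 2 then show thesis using root2 by blast
  next
    case 3
    then obtain e where e: "outs D p = {#e#}" by (metis size_1_singleton_mset)
    then have e': "e \<in># D" "fst e = p" using in_outs_iff[of e D p] by auto
    then obtain x where x: "e = (p, x)" by (cases e) auto
    show thesis
    proof (cases "\<exists>u. x = Ud u")
      case False then show thesis using root3[of x] e x 3 by auto
    next
      case True
      then obtain u where u: "x = Ud u" by blast
      then have pu: "(p, Ud u) \<in># {#(p, Lf a), (p, Lf b)#} + D" using e' x by simp
      then have up: "(u, Ud p) \<in># D" "u \<noteq> p" using d(9)[OF pu] d(10)[OF pu] by auto
      obtain E1 where E1: "D = add_mset (p, Ud u) E1" using e' x u by (metis insert_DiffM)
      then obtain E where "E1 = add_mset (u, Ud p) E" using up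
          by (metis insert_DiffM insert_noteq_member prod.inject)
      then show thesis using undir[of u E] E1 up 3 e x u by (auto simp: add_mset_commute)
    qed
  qed
qed


lemma step_wf:
  assumes "step (L, W, D, I) (L', W', D', I')" "wf_state L W D I"
  shows "wf_state L' W' D' I'"
  using assms
proof (cases rule: step.cases)
  case step_tree then show ?thesis using wf_step_tree(15) assms(2) by metis
next
  case step_root2 then show ?thesis using wf_step_root2(11) assms(2) by metis
next
  case step_root3 then show ?thesis using wf_step_root3(12) assms(2) by metis
next
  case step_undir then show ?thesis using wf_step_undir(17) assms(2) by metis
next
  case step_split then show ?thesis using wf_step_split(19) assms(2) by metis
qed

lemma steps_wf:
  assumes "step\<^sup>*\<^sup>* (L, W, D, I) (L', W', D', I')" "wf_state L W D I"
  shows "wf_state L' W' D' I'"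
  using assms
proof (induction "(L', W', D', I')" arbitrary: L' W' D' I' rule: rtranclp_induct)
  case base then show ?case by simp
next
  case (step z)
  obtain Lz Wz Dz Iz where "z = (Lz, Wz, Dz, Iz)" by (cases z)
  then show ?case using step step_wf by metis
qed

definition state_of :: "nat set \<Rightarrow> ('v, 'e) sd_net \<Rightarrow> nat set \<times> 'v set \<times> 'v arc multiset \<times> nat set"
    where
  "state_of L N = (L, nonleaves N, arcs N, isolated_labels N)"

lemma tree_cherry_step:
  assumes N: "labelled_graph N" and wf: "wf_state L (nonleaves N) (arcs N) (isolated_labels N)"
    and c: "tree_cherry N a b p" and S: "suppress_if_suppressible (delete_node N a) p N'"
  shows "step (state_of L N) (state_of L N') \<and> labelled_graph N'"
proof -
  obtain ea eb where ab: "a \<noteq> b" "is_leaf N a" "is_leaf N b"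
    and ea: "ea \<in> dedges N" "tail N ea = p" "head N ea = a" and eb: "eb \<in> dedges N" "tail N eb = p"
        "head N eb = b"
    using c by (auto simp: tree_cherry_def nonisolated_leaf_def is_parent_def)
  have ne: "eb \<noteq> ea" using ab ea eb by auto
  define M where "M = delete_node N a"
  note m = delete_leaf_arcs[OF N ea ab(2) eb(1,2) ne, folded M_def]
  note d = labelled_graphD[OF m(1)]
  have bM: "is_leaf M b" using ab m(5) by simp
  have ebM: "eb \<in> dedges M" "tail M eb = p" "head M eb = b" using eb ne m(7-10) by auto
  have "(p, Lf (label N b)) \<in># arcs M" unfolding in_arcs_iff[OF d(3,2)] using ebM bM m(4) by auto
  then obtain D where D: "arcs M = {#(p, Lf (label N b))#} + D"
      by (metis insert_DiffM add_mset_add_single union_commute)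
  have aN: "arcs N = {#(p, Lf (label N a)), (p, Lf (label N b))#} + D" using m(6) D by simp
  have SM: "suppress_if_suppressible M p N'" using S by (simp add: M_def)
  note s = suppress_step_arcs[OF m(1) disjI1[OF SM] bM ebM, unfolded m(4), OF D]
  from wf[unfolded aN] show ?thesis
  proof (cases rule: cherry_arc_cases)
    case (tree u E)
    have "arcs N = {#(u, Nd p), (p, Lf (label N a)), (p, Lf (label N b))#} + E" using aN tree(1)
        by (simp add: add_mset_commute)
    moreover have "state_of L N' = (L, nonleaves N - {p}, {#(u, Lf (label N b))#} +
        E, isolated_labels N)" "labelled_graph N'"
      using s(1)[OF tree] m by (simp_all add: state_of_def)
    ultimately show ?thesis using step.step_tree unfolding state_of_def[of L N] by metis
  next
    case (undir u E)
    have "arcs N = {#(u, Ud p), (p, Ud u), (p, Lf (label N a)), (p, Lf (label N b))#} + E"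
        using aN undir(1) by (simp add: add_mset_commute)
    moreover have "state_of L N' = (L, nonleaves N - {p}, {#(u, Lf (label N b))#} +
        E, isolated_labels N)" "labelled_graph N'"
      using s(2)[OF undir SM] m by (simp_all add: state_of_def)
    ultimately show ?thesis using step.step_undir unfolding state_of_def[of L N] by metis
  next
    case root2
    have "state_of L N' = (L, nonleaves N - {p}, D, insert (label N b) (isolated_labels N))"
        "labelled_graph N'"
      using s(3)[OF root2 SM] m by (simp_all add: state_of_def)
    then show ?thesis using step.step_root2[OF root2] aN unfolding state_of_def[of L N] by metis
  next
    case (root3 x)
    have "\<forall>v. (p, Ud v) \<notin># D"
    proof (intro allI notI)
      fix v assume "(p, Ud v) \<in># D"
      then have "(p, Ud v) \<in># outs D p" by simp
      then show False using root3(1,2) by auto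
    qed
    then have "N' = M" using s(4) root3 SM by simp
    then have "state_of L N' = (L, nonleaves N, {#(p, Lf (label N b))#} + D, isolated_labels N)"
        "labelled_graph N'"
      using m D by (simp_all add: state_of_def)
    then show ?thesis using step.step_root3[OF root3(1,2)] aN unfolding state_of_def[of L N]
        by metis
  qed
qed

lemma reticulate_cherry_steps:
  assumes N: "labelled_graph N" and wf: "wf_state L (nonleaves N) (arcs N) (isolated_labels N)"
    and c: "reticulate_cherry N a b h p" and e: "e \<in> dedges N" "tail N e = p" "head N e = h"
    and S: "suppress_if_suppressible (delete_edge N e) p M" and S': "suppress M h N'"
  shows "\<exists>L'. step\<^sup>*\<^sup>* (state_of L N) (state_of L' N') \<and> labelled_graph N'"
proof -
  note n = labelled_graphD[OF N]
  obtain ea eb where ab: "a \<noteq> b" "is_leaf N a" "is_leaf N b" "is_hybrid N h"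
    and ea: "ea \<in> dedges N" "tail N ea = h" "head N ea = a" and eb: "eb \<in> dedges N" "tail N eb = p"
        "head N eb = b"
    using c by (auto simp: reticulate_cherry_def nonisolated_leaf_def is_parent_def)
  have hL: "\<not> is_leaf N h" using ea is_leaf_iff[OF n(2,3), of h] by auto
  have ne: "eb \<noteq> e" using e eb ab hL by auto
  define la lb where "la = label N a" and "lb = label N b"
  have lab: "la \<noteq> lb" using n(11) ab unfolding la_def lb_def inj_on_def by auto
  define M0 where "M0 = delete_edge N e"
  note m = delete_edge_arcs[OF N e hL eb(1,2) ne, folded M0_def]
  note d = labelled_graphD[OF m(1)]
  have bM: "is_leaf M0 b" using ab m(5) by simp
  have ebM: "eb \<in> dedges M0" "tail M0 eb = p" "head M0 eb = b" using eb ne m(7-10) by auto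
  have "(p, Lf lb) \<in># arcs M0" unfolding in_arcs_iff[OF d(3,2)] using ebM bM m(4)
      by (auto simp: lb_def)
  then obtain Dm where Dm: "arcs M0 = {#(p, Lf lb)#} + Dm"
      by (metis insert_DiffM add_mset_add_single union_commute)
  have "(h, Lf la) \<in># arcs N" unfolding in_arcs_iff[OF n(3,2)] using ea ab by (auto simp: la_def)
  then have "(h, Lf la) \<in># Dm" using m(6) Dm lab by auto
  then obtain D1 where D1: "Dm = add_mset (h, Lf la) D1" by (metis insert_DiffM)
  have "ins (arcs N) h \<ge> 2" using deg_arcs(1)[OF N hL] ab(4) by (simp add: is_hybrid_def)
  then have "ins D1 h \<noteq> 0" using m(6) Dm D1 by auto
  then obtain q where "(q, Nd h) \<in># D1" by (auto simp: ins_0_iff)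
  then obtain D0 where D0: "D1 = add_mset (q, Nd h) D0" by (metis insert_DiffM)
  have Dm0: "Dm = {#(q, Nd h), (h, Lf la)#} + D0" using D1 D0 by (simp add: add_mset_commute)
  have aN: "arcs N = {#(p, Lf lb), (p, Nd h), (q, Nd h), (h, Lf la)#} + D0" using m(6) Dm Dm0
      by (simp add: add_mset_commute)
  have "finite (insert 0 L)" using wf_stateD(2)[OF wf] by simp
  then obtain c where "c \<notin> insert 0 L" using ex_new_if_finite infinite_UNIV_nat by blast
  then have c: "c \<notin> L" "c \<noteq> 0" by auto
  note f = wf_step_split[OF wf[unfolded aN] c]
  define W where "W = nonleaves N"
  define I where "I = isolated_labels N"
  have st1: "step (state_of L N) (insert c L, W - {h}, {#(p, Lf lb), (p, Lf c), (q, Lf la)#} +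
      D0, I)"
    unfolding state_of_def aN W_def I_def by (rule step_split[OF c])
  define D where "D = {#(q, Lf la)#} + D0"
  have X: "{#(p, Lf lb), (p, Lf c), (q, Lf la)#} + D0 = {#(p, Lf c), (p, Lf lb)#} + D"
      by (simp add: D_def add_mset_commute)
  have SM: "suppress_if_suppressible M0 p M" using S by (simp add: M0_def)
  note s = suppress_step_arcs[OF m(1) disjI1[OF SM] bM ebM, unfolded m(4), folded lb_def, OF Dm]
  have hp: "h \<noteq> p" "q \<noteq> h" "outs D0 h = {#}" "ins D0 h = 0" using f by auto
  have fin: "labelled_graph N' \<and> nonleaves N' = nonleaves M - {h} \<and>
      isolated_labels N' = isolated_labels M \<and> arcs N' = {#(q, Lf la)#} + E"
    if M: "labelled_graph M" "label M = label N" "arcs M = {#(q, Nd h), (h, Lf la)#} + E"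
        "outs E h = {#}" "ins E h = 0" for E
  proof -
    note dm = labelled_graphD[OF M(1)]
    have "(h, Lf la) \<in># arcs M" using M(3) by simp
    then obtain ea' where ea': "ea' \<in> dedges M" "tail M ea' = h" "is_leaf M (head M ea')"
        "label M (head M ea') = la"
      unfolding in_arcs_iff[OF dm(3,2)] by auto
    have "arcs M = {#(h, Lf (label M (head M ea')))#} + ({#(q, Nd h)#} + E)" using M(3) ea'(4)
        by (simp add: add_mset_commute)
    from suppress_step_arcs(1)[OF M(1) disjI2[OF S'] ea'(3,1,2) refl this refl M(4,5) hp(2)]
    show ?thesis using ea'(4) by simp
  qed
  have key: ?thesis if "step (insert c L, W - {h}, {#(p, Lf c), (p, Lf lb)#} +
      D, I) (state_of (insert c L) N')" "labelled_graph N'"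
    using st1 that unfolding X by (meson converse_rtranclp_into_rtranclp r_into_rtranclp)
  from f(19) show ?thesis unfolding X
  proof (cases rule: cherry_arc_cases)
    case (tree u E)
    then have "(u, Nd p) \<in># D0" by (metis D_def add_mset_add_single insert_iff prod.inject
        set_mset_add_mset_insert target.distinct(1) union_commute union_iff set_mset_empty empty_iff
        union_single_eq_member)
    then obtain E0 where E0: "D0 = add_mset (u, Nd p) E0" by (metis insert_DiffM)
    then have E: "E = {#(q, Lf la)#} + E0" using tree(1) by (simp add: D_def)
    have 1: "Dm = {#(u, Nd p)#} + ({#(q, Nd h), (h, Lf la)#} + E0)" using Dm0 E0
        by (simp add: add_mset_commute)
    have "outs ({#(q, Nd h), (h, Lf la)#} + E0) p = {#}" "ins ({#(q, Nd h), (h, Lf la)#} +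
        E0) p = 0"
      using tree hp E by (auto split: if_splits)
    note r = s(1)[OF 1 this tree(4)]
    have "u \<noteq> h" "outs E0 h = {#}" "ins E0 h = 0" using hp E0 by (auto split: if_splits)
    then have fN: "labelled_graph N' \<and> nonleaves N' = nonleaves M - {h} \<and>
        isolated_labels N' = isolated_labels M \<and> arcs N' = {#(q, Lf la)#} + ({#(u, Lf lb)#} + E0)"
      using fin[of "{#(u, Lf lb)#} + E0"] r by (simp add: add_mset_commute)
    show ?thesis
    proof (rule key)
      have "{#(p, Lf c), (p, Lf lb)#} + D = {#(u, Nd p), (p, Lf c), (p, Lf lb)#} + E" using tree(1)
          by (simp add: add_mset_commute)
      moreover have "state_of (insert c L) N' = (insert c L, W - {h} - {p}, {#(u, Lf lb)#} + E, I)"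
        using fN r m E by (auto simp: state_of_def W_def I_def)
      ultimately show "step (insert c L, W - {h}, {#(p, Lf c), (p, Lf lb)#} +
          D, I) (state_of (insert c L) N')"
        using step.step_tree by metis
    qed (use fN in blast)
  next
    case (undir u E)
    then have *: "(u, Ud p) \<in># D" "(p, Ud u) \<in># D" by auto
    then have "(u, Ud p) \<in># D0" by (auto simp: D_def)
    then obtain E1 where E1: "D0 = add_mset (u, Ud p) E1" by (metis insert_DiffM)
    then have "(p, Ud u) \<in># E1" using * undir(4) by (auto simp: D_def)
    then obtain E0 where "E1 = add_mset (p, Ud u) E0" by (metis insert_DiffM)
    then have E0: "D0 = {#(u, Ud p), (p, Ud u)#} + E0" using E1 by simp
    then have E: "E = {#(q, Lf la)#} + E0" using undir(1) by (simp add: D_def)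
    have 1: "Dm = {#(u, Ud p), (p, Ud u)#} + ({#(q, Nd h), (h, Lf la)#} + E0)" using Dm0 E0
        by (simp add: add_mset_commute)
    have "outs ({#(q, Nd h), (h, Lf la)#} + E0) p = {#}" "ins ({#(q, Nd h), (h, Lf la)#} +
        E0) p = 0"
      using undir hp E by (auto split: if_splits)
    note r = s(2)[OF 1 this undir(4) SM]
    have "u \<noteq> h" "outs E0 h = {#}" "ins E0 h = 0" using hp E0 by (auto split: if_splits)
    then have fN: "labelled_graph N' \<and> nonleaves N' = nonleaves M - {h} \<and>
        isolated_labels N' = isolated_labels M \<and> arcs N' = {#(q, Lf la)#} + ({#(u, Lf lb)#} + E0)"
      using fin[of "{#(u, Lf lb)#} + E0"] r by (simp add: add_mset_commute)
    show ?thesis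
    proof (rule key)
      have "{#(p, Lf c), (p, Lf lb)#} + D = {#(u, Ud p), (p, Ud u), (p, Lf c), (p, Lf lb)#} + E"
          using undir(1) by (simp add: add_mset_commute)
      moreover have "state_of (insert c L) N' = (insert c L, W - {h} - {p}, {#(u, Lf lb)#} + E, I)"
        using fN r m E by (auto simp: state_of_def W_def I_def)
      ultimately show "step (insert c L, W - {h}, {#(p, Lf c), (p, Lf lb)#} +
          D, I) (state_of (insert c L) N')"
        using step.step_undir by metis
    qed (use fN in blast)
  next
    case root2
    then have q: "q \<noteq> p" "outs D0 p = {#}" "ins D0 p = 0" by (auto simp: D_def split: if_splits)
    then have r: "labelled_graph M \<and> nonleaves M = nonleaves M0 - {p} \<and>
        isolated_labels M = insert lb (isolated_labels M0) \<and> label M = label N \<and>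
      (\<forall>v. is_leaf M v = is_leaf M0 v) \<and> arcs M = Dm" using s(3)[OF _ _ SM] Dm0 hp by simp
    then have fN: "labelled_graph N' \<and> nonleaves N' = nonleaves M - {h} \<and>
        isolated_labels N' = isolated_labels M \<and> arcs N' = {#(q, Lf la)#} + D0"
      using fin[of D0] Dm0 hp by simp
    show ?thesis
    proof (rule key)
      have "state_of (insert c L) N' = (insert c L, W - {h} - {p}, D, insert lb I)"
        using fN r m by (auto simp: state_of_def W_def I_def D_def)
      then show "step (insert c L, W - {h}, {#(p, Lf c), (p, Lf lb)#} +
          D, I) (state_of (insert c L) N')"
        using step.step_root2[OF root2] by metis
    qed (use fN in blast)
  next
    case (root3 x)
    have nU: "(p, Ud v) \<notin># Dm" for v
    proof
      assume "(p, Ud v) \<in># Dm"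
      then have "(p, Ud v) \<in># outs D p" by (auto simp: Dm0 D_def)
      then show False using root3(1,2) by auto
    qed
    have "size (outs D p) = 1" using root3 by simp
    then have "size (outs Dm p) = 1" "ins Dm p = 0" using root3(3) hp
        by (auto simp: Dm0 D_def split: if_splits)
    then have MM: "M = M0" using s(4) nU SM by blast
    have "arcs M0 = {#(q, Nd h), (h, Lf la)#} + ({#(p, Lf lb)#} + D0)" using Dm Dm0
        by (simp add: add_mset_commute)
    then have fN: "labelled_graph N' \<and> nonleaves N' = nonleaves M - {h} \<and>
        isolated_labels N' = isolated_labels M \<and> arcs N' = {#(q, Lf la)#} + ({#(p, Lf lb)#} + D0)"
      using fin[of "{#(p, Lf lb)#} + D0"] m hp by (simp add: MM)
    show ?thesis
    proof (rule key)
      have "state_of (insert c L) N' = (insert c L, W - {h}, {#(p, Lf lb)#} + D, I)"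
        using fN m by (auto simp: state_of_def W_def I_def D_def MM)
      then show "step (insert c L, W - {h}, {#(p, Lf c), (p, Lf lb)#} +
          D, I) (state_of (insert c L) N')"
        using step.step_root3[OF root3(1,2)] by metis
    qed (use fN in blast)
  qed
qed

lemma orchard_steps:
  assumes "orchard N" "labelled_graph N" "wf_state L (nonleaves N) (arcs N) (isolated_labels N)"
  shows "\<exists>L' D' I'. step\<^sup>*\<^sup>* (state_of L N) (L', {}, D', I')"
proof -
  obtain F L0 where red: "(\<lambda>M M'. \<exists>a b. cherry_reduction M a b M')\<^sup>*\<^sup>* N F"
      and F: "trivial_forest L0 F"
    using assms(1) by (auto simp: orchard_def)
  from red have "\<exists>L'. step\<^sup>*\<^sup>* (state_of L N) (state_of L' F) \<and> labelled_graph F"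
  proof (induction rule: rtranclp_induct)
    case base
    then show ?case using assms(2) by blast
  next
    case (step M M')
    then obtain L' where L': "step\<^sup>*\<^sup>* (state_of L N) (state_of L' M)" "labelled_graph M" by blast
    have wf: "wf_state L' (nonleaves M) (arcs M) (isolated_labels M)"
      using steps_wf[OF _ assms(3)] L'(1) by (simp add: state_of_def)
    obtain a b where "cherry_reduction M a b M'" using step(2) by blast
    then have "\<exists>L''. step\<^sup>*\<^sup>* (state_of L' M) (state_of L'' M') \<and> labelled_graph M'"
    proof cases
      case (reduce_tree_cherry p)
      then show ?thesis using tree_cherry_step[OF L'(2) wf] by blast
    next
      case (reduce_reticulate_cherry pa pb e M1)
      then show ?thesis using reticulate_cherry_steps[OF L'(2) wf] by blast
    qed
    then show ?case using L'(1) by (meson rtranclp_trans)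
  qed
  then obtain L' where L': "step\<^sup>*\<^sup>* (state_of L N) (state_of L' F)" "labelled_graph F" by blast
  have "nonleaves F = {}"
    using F is_leaf_iff[OF labelled_graphD(2,3)[OF L'(2)]]
        by (auto simp: trivial_forest_def edges_def nonleaves_def)
  then show ?thesis using L'(1) by (auto simp: state_of_def)
qed

section \<open>Path counts\<close>

definition out_edges :: "('v, 'e, 'z) sd_graph_scheme \<Rightarrow> 'v \<Rightarrow> 'e set" where
  "out_edges N v = {e \<in> dedges N. tail N e = v} \<union> {e \<in> uedges N. v \<in> ends N e}"

definition other :: "('v, 'e, 'z) sd_graph_scheme \<Rightarrow> 'e \<Rightarrow> 'v \<Rightarrow> 'v" where
  "other N e v = (if tail N e = v then head N e else tail N e)"

definition paths :: "('v, 'e, 'z) sd_graph_scheme \<Rightarrow> 'v \<Rightarrow> 'v \<Rightarrow> 'e \<Rightarrow> ('v list \<times> 'e list) set" where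
  "paths N u x e = {(vs, es). sd_path N vs es \<and> hd vs = u \<and> last vs = x \<and> e \<notin> set es}"

lemma traverses_iff: "traverses N v e w \<longleftrightarrow> e \<in> out_edges N v \<and> w = other N e v"
  by (auto simp: traverses_def out_edges_def other_def ends_def doubleton_eq_iff)

lemma sd_walk_Nil: "sd_walk N vs [] \<longleftrightarrow> (\<exists>v \<in> nodes N. vs = [v])"
  by (auto simp: sd_walk_def length_Suc_conv)

lemma sd_walk_Cons:
  "sd_walk N (v # vs) (e # es) \<longleftrightarrow> v \<in> nodes N \<and> vs \<noteq> [] \<and> traverses N v e (hd vs) \<and> sd_walk N vs es"
  by (cases vs) (auto simp: sd_walk_def All_less_Suc2)

lemma sd_walk_nonempty: "sd_walk N vs es \<Longrightarrow> vs \<noteq> []"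
  by (auto simp: sd_walk_def)

lemma sd_walk_take:
  assumes "sd_walk N vs es" "k \<le> length es"
  shows "sd_walk N (take (Suc k) vs) (take k es)"
  using assms by (auto simp: sd_walk_def dest: in_set_takeD)

lemma walk_edge_ends:
  assumes "sd_walk N vs es" "e \<in> set es"
  shows "ends N e \<subseteq> set vs" "e \<in> edges N"
proof -
  obtain i where i: "i < length es" "es ! i = e" using assms(2) by (auto simp: in_set_conv_nth)
  then have t: "traverses N (vs ! i) e (vs ! Suc i)" and l: "Suc i < length vs" using assms(1)
      by (auto simp: sd_walk_def)
  then have "ends N e = {vs ! i, vs ! Suc i}" "e \<in> edges N"
      by (auto simp: traverses_def ends_def edges_def)
  then show "ends N e \<subseteq> set vs" "e \<in> edges N" using l by auto
qed

lemma path_edges_distinct: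
  assumes "semidirected_graph N" "sd_path N vs es"
  shows "distinct es"
proof (rule ccontr)
  assume "\<not> distinct es"
  then obtain i j where ij: "i < j" "j < length es" "es ! i = es ! j"
    by (metis distinct_conv_nth nat_neq_iff)
  have w: "sd_walk N vs es" and dv: "distinct vs" using assms(2) by (auto simp: sd_path_def)
  have l: "length vs = Suc (length es)" using w by (simp add: sd_walk_def)
  have "traverses N (vs ! i) (es ! i) (vs ! Suc i)" "traverses N (vs ! j) (es ! i) (vs ! Suc j)"
    using w ij unfolding sd_walk_def by (metis less_trans)+
  then have "vs ! i = vs ! j \<or> vs ! i = vs ! Suc j"
    using assms(1) by (auto simp: traverses_def semidirected_graph_def doubleton_eq_iff)
  then show False using dv ij l by (simp add: nth_eq_iff_index_eq)
qed

locale acyclic_graph =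
  fixes N :: "('v, 'e, 'z) sd_graph_scheme"
  assumes sdag: "sdag N"
begin

lemma sg: "semidirected_graph N" using sdag by (simp add: sdag_def)

lemma fin: "finite (nodes N)" "finite (uedges N)" "finite (dedges N)" "finite (edges N)"
  "uedges N \<inter> dedges N = {}"
  using sg by (auto simp: semidirected_graph_def edges_def)

lemma edge_nodes: "e \<in> edges N \<Longrightarrow> ends N e \<subseteq> nodes N"
  using sg by (auto simp: semidirected_graph_def)

lemma no_return:
  assumes t: "traverses N v e w" and p: "sd_path N vs es" "hd vs = w" "e \<notin> set es"
  shows "v \<notin> set vs"
proof
  assume "v \<in> set vs"
  then obtain k where k: "k < length vs" "vs ! k = v" by (auto simp: in_set_conv_nth)
  have w: "sd_walk N vs es" and dv: "distinct vs" using p(1) by (auto simp: sd_path_def)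
  have l: "length vs = Suc (length es)" using w by (simp add: sd_walk_def)
  let ?vs = "take (Suc k) vs" and ?es = "take k es"
  have w': "sd_walk N ?vs ?es" using sd_walk_take[OF w] k l by simp
  have "v \<in> nodes N" using w \<open>v \<in> set vs\<close> by (auto simp: sd_walk_def)
  moreover have "hd ?vs = w" "?vs \<noteq> []" using p(2) k by (auto simp: hd_take)
  ultimately have "sd_walk N (v # ?vs) (e # ?es)" using w' t by (simp add: sd_walk_Cons)
  moreover have "last (v # ?vs) = v" using k by (simp add: take_Suc_conv_app_nth)
  moreover have "distinct (e # ?es)" using path_edges_distinct[OF sg p(1)] p(3)
      by (auto dest: in_set_takeD)
  ultimately have "sd_cycle N (v # ?vs) (e # ?es)" using dv by (simp add: sd_cycle_def)
  then show False using sdag by (auto simp: sdag_def)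
qed

lemma no_loop: "e \<in> edges N \<Longrightarrow> tail N e \<noteq> head N e"
proof
  assume e: "e \<in> edges N" "tail N e = head N e"
  then have "tail N e \<in> nodes N" using edge_nodes by (auto simp: ends_def)
  moreover have "traverses N (tail N e) e (tail N e)" using e
      by (auto simp: traverses_def edges_def ends_def)
  ultimately show False using no_return[of "tail N e" e "tail N e" "[tail N e]" "[]"]
    by (auto simp: sd_path_def sd_walk_Nil)
qed

lemma no_parallel_undirected:
  assumes "e \<in> uedges N" "f \<in> uedges N" "ends N e = ends N f"
  shows "e = f"
proof (rule ccontr)
  assume "e \<noteq> f"
  let ?u = "tail N e" and ?v = "head N e"
  have "?u \<in> nodes N" "?v \<in> nodes N" using edge_nodes[of e] assms(1)
      by (auto simp: ends_def edges_def)
  moreover have "?u \<noteq> ?v" using no_loop assms(1) by (simp add: edges_def)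
  moreover have t: "traverses N ?u e ?v" "traverses N ?v f ?u" using assms
      by (auto simp: traverses_def ends_def)
  ultimately have "sd_path N [?v, ?u] [f]" by (auto simp: sd_path_def sd_walk_Cons sd_walk_Nil)
  then show False using no_return[OF t(1)] \<open>e \<noteq> f\<close> by fastforce
qed

lemma finite_paths: "finite (paths N u x e)"
proof -
  have "paths N u x e \<subseteq> {vs. set vs \<subseteq> nodes N \<and> length vs \<le> card (nodes N)} \<times>
      {es. set es \<subseteq> edges N \<and> length es \<le> card (nodes N)}"
  proof clarify
    fix vs es assume "(vs, es) \<in> paths N u x e"
    then have w: "sd_walk N vs es" "distinct vs" by (auto simp: paths_def sd_path_def)
    then have s: "set vs \<subseteq> nodes N" "length vs = Suc (length es)" by (auto simp: sd_walk_def)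
    have "length vs \<le> card (nodes N)" using distinct_card[OF w(2)] card_mono[OF fin(1) s(1)] by simp
    moreover have "set es \<subseteq> edges N" using walk_edge_ends(2)[OF w(1)] by blast
    ultimately show "vs \<in> {vs. set vs \<subseteq> nodes N \<and> length vs \<le> card (nodes N)} \<and>
      es \<in> {es. set es \<subseteq> edges N \<and> length es \<le> card (nodes N)}" using s by auto
  qed
  then show ?thesis by (rule finite_subset) (intro finite_cartesian_product finite_lists_length_le
      fin)
qed

lemma finite_out: "finite (out_edges N v)"
  using fin by (auto simp: out_edges_def)

lemma out_edge_end: "e \<in> out_edges N v \<Longrightarrow> v \<in> ends N e" "e \<in> out_edges N v \<Longrightarrow> e \<in> edges N"
  "e \<in> out_edges N v \<Longrightarrow> other N e v \<in> ends N e"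
  by (auto simp: out_edges_def ends_def edges_def other_def)

lemma other_node: "e \<in> out_edges N v \<Longrightarrow> other N e v \<in> nodes N"
  using out_edge_end edge_nodes by blast

lemma paths_rec:
  assumes v: "v \<in> nodes N" and e: "v \<in> ends N e"
  shows "paths N v x e = (if v = x then {([v], [])} else {}) \<union>
    (\<Union>f \<in> out_edges N v - {e}. (\<lambda>(vs, es). (v # vs, f # es)) ` paths N (other N f v) x f)" (is
        "_ = ?R")
proof (intro equalityI subsetI)
  fix q assume q: "q \<in> paths N v x e"
  obtain vs es where qe: "q = (vs, es)" by (cases q)
  then have p: "sd_walk N vs es" "distinct vs" "hd vs = v" "last vs = x" "e \<notin> set es"
    using q by (auto simp: paths_def sd_path_def)
  show "q \<in> ?R"
  proof (cases es)
    case Nil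
    then have "vs = [v]" using p(1,3) by (auto simp: sd_walk_Nil)
    then show ?thesis using Nil p qe by simp
  next
    case (Cons f es')
    obtain vs' where vs: "vs = v # vs'" using p(1,3) sd_walk_nonempty by (metis list.collapse)
    have w: "vs' \<noteq> []" "traverses N v f (hd vs')" "sd_walk N vs' es'" using p(1)
        unfolding vs Cons sd_walk_Cons by auto
    then have f: "f \<in> out_edges N v - {e}" "hd vs' = other N f v" using p(5) Cons
        by (auto simp: traverses_iff)
    have "f \<notin> set es'"
    proof
      assume "f \<in> set es'"
      then have "ends N f \<subseteq> set vs'" using walk_edge_ends(1)[OF w(3)] by blast
      then show False using f out_edge_end(1)[of f v] p(2) vs by auto
    qed
    then have "(vs', es') \<in> paths N (other N f v) x f" using w f p vs
        by (auto simp: paths_def sd_path_def)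
    then have "q \<in> (\<lambda>(vs, es). (v # vs, f # es)) ` paths N (other N f v) x f"
      using qe vs Cons by (metis (no_types, lifting) case_prod_conv rev_image_eqI)
    then show ?thesis using f(1) by blast
  qed
next
  fix q assume "q \<in> ?R"
  then consider "v = x" "q = ([v], [])"
    | f vs es where "f \<in> out_edges N v - {e}" "(vs, es) \<in> paths N (other N f v) x f"
        "q = (v # vs, f # es)"
    by (auto split: if_splits)
  then show "q \<in> paths N v x e"
  proof cases
    case 1 then show ?thesis using v by (auto simp: paths_def sd_path_def sd_walk_Nil)
  next
    case 2
    then have p: "sd_path N vs es" "hd vs = other N f v" "last vs = x" "f \<notin> set es"
        by (auto simp: paths_def)
    then have w: "sd_walk N vs es" "distinct vs" "vs \<noteq> []" using sd_walk_nonempty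
        by (auto simp: sd_path_def)
    have t: "traverses N v f (hd vs)" using 2 p by (simp add: traverses_iff)
    have nv: "v \<notin> set vs" using no_return[OF t p(1) refl p(4)] .
    have "e \<notin> set es"
      using walk_edge_ends(1)[OF w(1), of e] e nv by blast
    then show ?thesis using 2 p w t nv v by (auto simp: paths_def sd_path_def sd_walk_Cons)
  qed
qed

lemma num_paths_card: "num_paths N u x e = card (paths N u x e)"
  by (simp add: num_paths_def paths_def)

lemma num_paths_rec:
  assumes v: "v \<in> nodes N" and e: "v \<in> ends N e"
  shows "num_paths N v x e = (if v = x then 1 else 0) +
    (\<Sum>f \<in> out_edges N v - {e}. num_paths N (other N f v) x f)"
proof -
  let ?g = "\<lambda>f. (\<lambda>(vs, es). (v # vs, f # es)) ` paths N (other N f v) x f"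
  have "card (paths N v x e) = card (if v = x then {([v], [] :: 'e list)} else {}) +
      card (\<Union>f \<in> out_edges N v - {e}. ?g f)"
    unfolding paths_rec[OF assms] by (rule card_Un_disjoint) (auto intro: finite_out finite_paths)
  also have "card (\<Union>f \<in> out_edges N v - {e}. ?g f) = (\<Sum>f \<in> out_edges N v - {e}. card (?g f))"
    by (rule card_UN_disjoint) (auto intro: finite_out finite_paths)
  also have "\<dots> = (\<Sum>f \<in> out_edges N v - {e}. num_paths N (other N f v) x f)"
    unfolding num_paths_card by (intro sum.cong refl card_image) (auto simp: inj_on_def)
  finally show ?thesis by (simp add: num_paths_card)
qed

lemma weighted_paths_rec:
  assumes "v \<in> nodes N" "v \<in> ends N e" "finite X"
  shows "(\<Sum>x \<in> X. int (num_paths N v x e)) =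
    (if v \<in> X then 1 else 0) + (\<Sum>f \<in> out_edges N v - {e}. \<Sum>x \<in> X. int (num_paths N (other N f v) x
        f))"
proof -
  have "(\<Sum>x \<in> X. int (num_paths N v x e)) =
      (\<Sum>x \<in> X. (if v = x then 1 else 0) + (\<Sum>f \<in> out_edges N v - {e}. int (num_paths N (other N f v)
          x f)))"
    by (intro sum.cong refl) (simp add: num_paths_rec[OF assms(1,2)])
  then show ?thesis
    using assms(3) by (simp add: sum.distrib sum.swap[of _ X])
qed

definition reach :: "'e \<Rightarrow> 'v \<Rightarrow> int" where
  "reach e v = (\<Sum>x \<in> nodes N. int (num_paths N v x e))"

lemma reach_rec:
  assumes "v \<in> nodes N" "v \<in> ends N e"
  shows "reach e v = 1 + (\<Sum>f \<in> out_edges N v - {e}. reach f (other N f v))"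
  unfolding reach_def using weighted_paths_rec[OF assms fin(1)] assms(1) by simp

lemma reach_nonneg: "0 \<le> reach e v"
  by (simp add: reach_def sum_nonneg)

lemma reach_less:
  assumes "v \<in> nodes N" "v \<in> ends N e" "f \<in> out_edges N v" "f \<noteq> e"
  shows "reach f (other N f v) < reach e v"
proof -
  have "reach f (other N f v) \<le> (\<Sum>f \<in> out_edges N v - {e}. reach f (other N f v))"
    by (rule member_le_sum) (use assms finite_out reach_nonneg in auto)
  then show ?thesis using reach_rec[OF assms(1,2)] by simp
qed

end

section \<open>The \<mu>-representation of a network\<close>

text \<open>
  Recovers the entries of the arcs of an edge from its \<mu>-entry; root entries give nothing.
\<close>

definition decode :: "mu_entry \<Rightarrow> arc_entry multiset" where
  "decode x = image_mset (\<lambda>p. (fst p,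
       if snd p = Tag_t \<and> size x = 2 \<and> (\<forall>q \<in># x. snd q \<noteq> Tag_i) then Tag_i else snd p,
       if size x = 2 then Some (\<Sum>q \<in># x. fst q) else None))
     {#p \<in># x. snd p = Tag_t \<or> snd p = Tag_h#}"

locale network = acyclic_graph N for N :: "('v, 'e) sd_net" +
  fixes n :: nat
  assumes net: "L_network {1..n} N" and compl: "complete_graph N" and bin: "binary_graph N"
begin

lemma leaf_tree: "is_leaf N v \<Longrightarrow> deg_i N v \<le> 1"
  using net by (auto simp: L_network_def is_tree_node_def)

lemma label_inj: "inj_on (label N) {v. is_leaf N v}"
  using net by (simp add: L_network_def)

lemma label_range: "is_leaf N v \<Longrightarrow> label N v \<in> {1..n}"
  using net by (auto simp: L_network_def)

lemma labelled_graph: "labelled_graph N"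
  unfolding labelled_graph_def using sg label_inj leaf_tree no_loop by (auto simp: edges_def)

lemmas sn = labelled_graphD[OF labelled_graph]

lemma leaf_iff: "is_leaf N v \<longleftrightarrow> v \<in> nodes N \<and> out_edges N v = {}"
  unfolding is_leaf_iff[OF fin(2,3)] out_edges_def by blast

lemma class_nodes:
  assumes "v \<in> nodes N"
  shows "undir_class N v \<subseteq> nodes N"
proof
  fix w assume "w \<in> undir_class N v"
  then have "(v, w) \<in> (undir_rel N)\<^sup>*" by (simp add: undir_class_def)
  then show "w \<in> nodes N"
    by (cases rule: rtranclE) (use assms edge_nodes in \<open>auto simp: undir_rel_def edges_def\<close>)
qed

lemma undirected_no_in:
  assumes v: "v \<in> nodes N" and u: "deg_u N v \<noteq> 0"
  shows "e \<in> dedges N \<Longrightarrow> undir_class N (head N e) \<noteq> undir_class N v" "deg_i N v = 0"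
proof -
  have "undir_class N v \<noteq> {v}" using undir_class_singleton[OF fin(2), of v] no_loop u
      by (auto simp: edges_def)
  moreover have "finite (undir_class N v)" using class_nodes[OF v] fin(1) finite_subset by blast
  moreover have "{v} \<subseteq> undir_class N v" using undir_class_self[of v N] by simp
  ultimately have "card (undir_class N v) > 1"
    using psubset_card_mono[of "undir_class N v" "{v}"] by auto
  then have "deg_i (contraction N) (undir_class N v) = 0"
    using compl v by (auto simp: complete_graph_def contraction_def)
  then have *: "\<forall>e \<in> dedges N. undir_class N (head N e) \<noteq> undir_class N v"
    using fin(3) by (auto simp: deg_i_def contraction_def)
  then show "e \<in> dedges N \<Longrightarrow> undir_class N (head N e) \<noteq> undir_class N v" by blast
  show "deg_i N v = 0" using * fin(3) by (auto simp: deg_i_def)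
qed

lemma node_types:
  assumes v: "v \<in> nodes N" "\<not> is_leaf N v"
  shows "(deg_i N v, deg_o N v + deg_u N v) \<in> {(2, 1), (1, 2), (0, 2), (0, 3)}"
    "deg_u N v \<noteq> 0 \<Longrightarrow> deg_i N v = 0 \<and> deg_o N v + deg_u N v = 3"
proof -
  have b: "is_root N v \<Longrightarrow> deg N v \<in> {0, 2, 3}" "\<not> is_root N v \<Longrightarrow> deg N v = 3"
    using bin v by (auto simp: binary_graph_def)
  have pos: "deg_o N v \<noteq> 0 \<or> deg_u N v \<noteq> 0" using v by (auto simp: is_leaf_def)
  show *: "deg_u N v \<noteq> 0 \<Longrightarrow> deg_i N v = 0 \<and> deg_o N v + deg_u N v = 3"
    using undirected_no_in(2)[OF v(1)] b(2) by (auto simp: is_root_def deg_def)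
  show "(deg_i N v, deg_o N v + deg_u N v) \<in> {(2, 1), (1, 2), (0, 2), (0, 3)}"
  proof (cases "deg_u N v = 0")
    case False then show ?thesis using * by auto
  next
    case True
    show ?thesis
    proof (cases "deg_i N v = 0")
      case True': True
      then have "is_root N v" using True v by (simp add: is_root_def)
      then show ?thesis using b(1) True True' pos by (auto simp: deg_def)
    next
      case False
      then have "deg N v = 3" using b(2) by (simp add: is_root_def)
      then show ?thesis using False True pos by (auto simp: deg_def)
    qed
  qed
qed

lemma hybrid_iff: "v \<in> nodes N \<Longrightarrow> \<not> is_leaf N v \<Longrightarrow> is_hybrid N v \<longleftrightarrow> ins (arcs N) v = 2"
  using node_types(1)[of v] deg_arcs(1)[OF labelled_graph, of v] by (auto simp: is_hybrid_def)

lemma outs_3_iff: "\<not> is_leaf N v \<Longrightarrow> size (outs (arcs N) v) = 3 \<longleftrightarrow> deg_o N v + deg_u N v = 3"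
  using deg_arcs(2)[OF labelled_graph, of v] by simp

definition arc_of :: "'v \<Rightarrow> 'e \<Rightarrow> 'v arc" where
  "arc_of v e = (if e \<in> dedges N then darc N e else (v, Ud (other N e v)))"

lemma outs_uarcs:
  assumes "finite U" "U \<subseteq> uedges N"
  shows "outs (\<Sum>e \<in># mset_set U. uarcs N e) v = image_mset (\<lambda>e. (v, Ud (other N e v))) (mset_set {e
      \<in> U. v \<in> ends N e})"
  using assms
proof (induction U rule: finite_induct)
  case empty then show ?case by simp
next
  case (insert e U)
  have ne: "tail N e \<noteq> head N e" using insert.prems sn(13) by auto
  have "{x \<in> insert e U. v \<in> ends N x} = (if v \<in> ends N e then insert e {x \<in> U. v \<in> ends N x} else
      {x \<in> U. v \<in> ends N x})"
    by auto
  moreover have "outs (uarcs N e) v = (if v \<in> ends N e then {#(v, Ud (other N e v))#} else {#})"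
    using ne by (auto simp: uarcs_def ends_def other_def)
  ultimately show ?case using insert by simp
qed

lemma outs_arcs: "outs (arcs N) v = image_mset (arc_of v) (mset_set (out_edges N v))"
proof -
  have "outs (image_mset (darc N) (mset_set (dedges N))) v = image_mset (darc N) (mset_set {e \<in>
      dedges N. tail N e = v})"
    using fin(3) by (simp add: outs_def filter_mset_image_mset filter_mset_mset_set comp_def
        darc_def)
  moreover have "mset_set (out_edges N v) = mset_set {e \<in> dedges N. tail N e = v} +
      mset_set {e \<in> uedges N. v \<in> ends N e}"
    unfolding out_edges_def by (rule mset_set_Union) (use fin in auto)
  moreover have "image_mset (arc_of v) (mset_set {e \<in> dedges N. tail N e = v}) = image_mset (darc N)
      (mset_set {e \<in> dedges N. tail N e = v})"
    by (rule image_mset_cong) (use fin in \<open>auto simp: arc_of_def\<close>)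
  moreover have "image_mset (arc_of v) (mset_set {e \<in> uedges N. v \<in> ends N e}) =
      image_mset (\<lambda>e. (v, Ud (other N e v))) (mset_set {e \<in> uedges N. v \<in> ends N e})"
    by (rule image_mset_cong) (use fin in \<open>auto simp: arc_of_def\<close>)
  ultimately show ?thesis using outs_uarcs[OF fin(2), of v] by (simp add: arcs_def)
qed

definition uedge :: "'v \<Rightarrow> 'v \<Rightarrow> 'e" where
  "uedge u v = (THE e. e \<in> uedges N \<and> ends N e = {u, v})"

lemma uedge_eq: "e \<in> uedges N \<Longrightarrow> ends N e = {u, v} \<Longrightarrow> uedge u v = e"
  unfolding uedge_def using no_parallel_undirected by (intro the_equality) auto

lemma in_arcs_Ud: "(u, Ud v) \<in># arcs N \<longleftrightarrow> (\<exists>e \<in> uedges N. ends N e = {u, v})"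
  unfolding in_arcs_iff[OF fin(3,2)] by (auto simp: ends_def doubleton_eq_iff)

lemma in_arcs_cases:
  assumes "(v, y) \<in># arcs N"
  obtains e where "e \<in> out_edges N v" "(v, y) = arc_of v e"
proof -
  have "(v, y) \<in># outs (arcs N) v" using assms by simp
  then show thesis using that finite_out by (auto simp: outs_arcs)
qed

definition arc_rank :: "'v arc \<Rightarrow> nat" where
  "arc_rank a = (case snd a of Lf i \<Rightarrow> 0
     | Nd v \<Rightarrow> nat (1 + (\<Sum>f \<in> out_edges N v. reach f (other N f v)))
     | Ud v \<Rightarrow> nat (reach (uedge (fst a) v) v))"

lemma head_not_out: "e \<in> dedges N \<Longrightarrow> e \<notin> out_edges N (head N e)"
  using fin(5) no_loop[of e] by (auto simp: out_edges_def edges_def)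

lemma arc_rank_arc:
  assumes "e \<in> out_edges N v" "arc_of v e = (v, y)" "\<forall>i. y \<noteq> Lf i"
  shows "arc_rank (v, y) = nat (reach e (other N e v))"
proof (cases "e \<in> dedges N")
  case True
  then have y: "y = Nd (head N e)" using assms by (auto simp: arc_of_def darc_def split: if_splits)
  have "tail N e = v" using True assms by (simp add: arc_of_def darc_def)
  then have o: "other N e v = head N e" by (simp add: other_def)
  have "reach e (head N e) = 1 + (\<Sum>f \<in> out_edges N (head N e). reach f (other N f (head N e)))"
    using reach_rec[of "head N e" e] sn(8)[OF True] head_not_out[OF True] by (simp add: ends_def)
  then show ?thesis by (simp add: arc_rank_def y o)
next
  case False
  then have y: "y = Ud (other N e v)" and eU: "e \<in> uedges N" "v \<in> ends N e" using assms
      by (auto simp: arc_of_def out_edges_def)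
  have "uedge v (other N e v) = e" by (rule uedge_eq) (use eU in \<open>auto simp: ends_def other_def\<close>)
  then show ?thesis by (simp add: arc_rank_def y)
qed

lemma ranked: "ranked (arcs N) arc_rank"
  unfolding ranked_def
proof (intro conjI allI impI; elim conjE)
  fix u v y assume A: "(u, Nd v) \<in># arcs N" "(v, y) \<in># arcs N" "\<forall>i. y \<noteq> Lf i"
  obtain e where e: "e \<in> out_edges N v" "(v, y) = arc_of v e" using in_arcs_cases[OF A(2)] .
  have "reach e (other N e v) \<le> (\<Sum>f \<in> out_edges N v. reach f (other N f v))"
    by (rule member_le_sum) (use e finite_out reach_nonneg in auto)
  then show "arc_rank (v, y) < arc_rank (u, Nd v)"
    using arc_rank_arc[OF e(1) e(2)[symmetric] A(3)] reach_nonneg[of e "other N e v"]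
        by (simp add: arc_rank_def)
next
  fix u v y assume A: "(u, Ud v) \<in># arcs N" "(v, y) \<in># arcs N" "\<forall>i. y \<noteq> Lf i" "y \<noteq> Ud u"
  obtain e where e: "e \<in> out_edges N v" "(v, y) = arc_of v e" using in_arcs_cases[OF A(2)] .
  obtain g where g: "g \<in> uedges N" "ends N g = {u, v}" using A(1) in_arcs_Ud by blast
  have uv: "u \<noteq> v" using g sn(13)[OF g(1)] by (auto simp: ends_def)
  have "other N g v = u" using g uv by (auto simp: other_def ends_def doubleton_eq_iff)
  moreover have "g \<notin> dedges N" using g fin(5) by auto
  ultimately have "e \<noteq> g" using e(2) A(4) by (auto simp: arc_of_def)
  moreover have "v \<in> nodes N" using g edge_nodes[of g] by (auto simp: edges_def)
  ultimately have "reach e (other N e v) < reach g v" using reach_less[of v g e] e g by auto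
  then show "arc_rank (v, y) < arc_rank (u, Ud v)"
    using arc_rank_arc[OF e(1) e(2)[symmetric] A(3)] reach_nonneg[of e "other N e v"] uedge_eq[OF g]
        by (simp add: arc_rank_def)
qed

lemma count_arcs_Ud:
  assumes "(u, Ud v) \<in># arcs N"
  shows "count (arcs N) (u, Ud v) = 1"
proof -
  obtain g where g: "g \<in> uedges N" "ends N g = {u, v}" using assms in_arcs_Ud by blast
  have uv: "u \<noteq> v" using g sn(13)[OF g(1)] by (auto simp: ends_def)
  have "count (\<Sum>e \<in># mset_set U. uarcs N e) (u, Ud v) = card {e \<in> U. ends N e = {u, v}}"
    if "finite U" "U \<subseteq> uedges N" for U
    using that
  proof (induction U rule: finite_induct)
    case (insert e U)
    have "{x \<in> insert e U. ends N x = {u, v}} = (if ends N e = {u, v} then insert e {x \<in> U. ends N x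
        = {u, v}} else {x \<in> U. ends N x = {u, v}})"
      by auto
    moreover have "count (uarcs N e) (u, Ud v) = (if ends N e = {u, v} then 1 else 0)"
      using uv by (auto simp: uarcs_def ends_def doubleton_eq_iff)
    ultimately show ?case using insert by simp
  qed simp
  then have "count (\<Sum>e \<in># mset_set (uedges N). uarcs N e) (u, Ud v) = card {e \<in> uedges N. ends N e =
      {u, v}}"
    using fin(2) by blast
  also have "{e \<in> uedges N. ends N e = {u, v}} = {g}" using g no_parallel_undirected by auto
  finally have "count (\<Sum>e \<in># mset_set (uedges N). uarcs N e) (u, Ud v) = 1" by simp
  moreover have "(u, Ud v) \<notin># image_mset (darc N) (mset_set (dedges N))"
      by (auto simp: darc_def split: if_splits)
  then have "count (image_mset (darc N) (mset_set (dedges N))) (u, Ud v) = 0"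
      by (simp only: not_in_iff)
  ultimately show ?thesis by (simp add: arcs_def)
qed

lemma leaf_count_arcs: "leaf_count (arcs N) i \<le> 1"
proof -
  have "leaf_count (arcs N) i = card {e \<in> dedges N. snd (darc N e) = Lf i}"
    using uarcs_sum(3)[OF sn(2,13)] fin(3) by (simp add: arcs_def) (simp add: leaf_count_def
        size_filter_image_mset_set)
  moreover have "e = f" if "e \<in> dedges N" "f \<in> dedges N" "snd (darc N e) = Lf i"
      "snd (darc N f) = Lf i" for e f
  proof -
    have l: "is_leaf N (head N e)" "is_leaf N (head N f)" "label N (head N e) = label N (head N f)"
      using that(3,4) by (auto simp: darc_def split: if_splits)
    then have "head N e = head N f" using label_inj by (auto simp: inj_on_def)
    then show ?thesis using leaf_in_edge_unique[OF labelled_graph l(1) that(1) refl that(2)] by simp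
  qed
  ultimately show ?thesis using fin(3) by (auto simp: card_le_Suc0_iff_eq)
qed

lemma wf: "wf_state {1..n} (nonleaves N) (arcs N) (isolated_labels N)"
  unfolding wf_state_def
proof (intro conjI allI impI ballI)
  show "isolated_labels N \<subseteq> {1..n}" using label_range by (auto simp: isolated_labels_def)
next
  fix u x assume "(u, x) \<in># arcs N"
  then obtain e where "e \<in> out_edges N u" using in_arcs_cases by blast
  then show "u \<in> nonleaves N" using leaf_iff[of u] out_edge_end[of e u] edge_nodes[of e]
      by (auto simp: nonleaves_def)
next
  fix u i assume "(u, Lf i) \<in># arcs N"
  then obtain e where e: "e \<in> dedges N" "is_leaf N (head N e)" "label N (head N e) = i"
      unfolding in_arcs_iff[OF fin(3,2)] by blast
  then show "i \<in> {1..n}" using label_range by blast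
  show "i \<notin> isolated_labels N"
  proof
    assume "i \<in> isolated_labels N"
    then obtain v where v: "is_leaf N v" "deg N v = 0" "i = label N v"
        by (auto simp: isolated_labels_def)
    then have "v = head N e" using e label_inj by (auto simp: inj_on_def)
    then show False using leaf_deg_0_iff[OF labelled_graph v(1)] v(2) e(1) by auto
  qed
next
  fix u v assume "(u, Nd v) \<in># arcs N"
  then show "v \<in> nonleaves N" unfolding in_arcs_iff[OF fin(3,2)] using sn(8)
      by (auto simp: nonleaves_def)
next
  fix u v assume A: "(u, Ud v) \<in># arcs N"
  then obtain g where g: "g \<in> uedges N" "ends N g = {u, v}" using in_arcs_Ud by blast
  then show "(v, Ud u) \<in># arcs N" using in_arcs_Ud by (metis insert_commute)
  show "u \<noteq> v" using g sn(13)[OF g(1)] by (auto simp: ends_def)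
  show "count (arcs N) (u, Ud v) = 1" using count_arcs_Ud[OF A] .
  have u: "u \<in> nodes N" "\<not> is_leaf N u" "deg_u N u \<noteq> 0"
    using g edge_nodes[of g] fin(2) is_leaf_iff[OF fin(2,3)] by (auto simp: edges_def deg_u_def)
  then show "ins (arcs N) u = 0" "size (outs (arcs N) u) = 3"
    using node_types(2)[OF u(1,2)] deg_arcs[OF labelled_graph u(2)] by auto
next
  fix v assume v: "v \<in> nonleaves N"
  then show "(ins (arcs N) v, size (outs (arcs N) v)) \<in> {(2, 1), (1, 2), (0, 2), (0, 3)}"
    using node_types(1)[of v] deg_arcs[OF labelled_graph, of v] by (simp add: nonleaves_def)
next
  show "\<exists>\<rho>. ranked (arcs N) \<rho>" using ranked by blast
qed (use fin leaf_count_arcs in \<open>auto simp: nonleaves_def\<close>)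

abbreviation m :: "'e \<Rightarrow> 'v \<Rightarrow> mu_vector" where "m \<equiv> mu_vec n N"

definition own :: "'v \<Rightarrow> mu_vector" where
  "own v = (if is_leaf N v then unit_vector (label N v) else
      if is_hybrid N v then unit_vector 0 else 0)"

lemma sum_fun_apply: "(\<Sum>x \<in> A. f x) i = (\<Sum>x \<in> A. f x i)" for f :: "'b \<Rightarrow> mu_vector"
  by (induction A rule: infinite_finite_induct) (auto simp: fun_apply)

lemma mu_rec:
  assumes v: "v \<in> nodes N" "v \<in> ends N e"
  shows "m e v = own v + (\<Sum>f \<in> out_edges N v - {e}. m f (other N f v))"
proof
  fix i
  have finX: "finite {h. is_hybrid N h}" "finite {x. is_leaf N x \<and> label N x = i}"
    by (auto intro: finite_subset[OF _ fin(1)] simp: is_hybrid_def is_leaf_def)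
  have lh: "\<not> (is_leaf N v \<and> is_hybrid N v)" using leaf_tree[of v] by (auto simp: is_hybrid_def)
  show "m e v i = (own v + (\<Sum>f \<in> out_edges N v - {e}. m f (other N f v))) i"
  proof (cases "i = 0 \<or> i > n")
    case True
    then show ?thesis
      using weighted_paths_rec[OF v finX(1)] lh label_range[of v]
      by (auto simp: mu_vec_def own_def fun_apply sum_fun_apply unit_vector_apply)
  next
    case False
    then show ?thesis
      using weighted_paths_rec[OF v finX(2)] lh
      by (auto simp: mu_vec_def own_def fun_apply sum_fun_apply unit_vector_apply)
  qed
qed

definition P :: "'v \<Rightarrow> mu_vector" where
  "P v = own v + (\<Sum>f \<in> out_edges N v. m f (other N f v))"

definition Q :: "'v \<Rightarrow> 'v \<Rightarrow> mu_vector" where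
  "Q u v = m (uedge u v) v"

lemma m_head: "e \<in> dedges N \<Longrightarrow> m e (head N e) = P (head N e)"
  using mu_rec[of "head N e" e] sn(8) head_not_out by (simp add: P_def ends_def)

lemma P_split:
  assumes "e \<in> out_edges N v"
  shows "P v = m e v + m e (other N e v)"
proof -
  have v: "v \<in> nodes N" "v \<in> ends N e" using out_edge_end[OF assms] edge_nodes[of e] by auto
  have "(\<Sum>f \<in> out_edges N v. m f (other N f v)) = m e (other N e v) +
      (\<Sum>f \<in> out_edges N v - {e}. m f (other N f v))"
    by (rule sum.remove[OF finite_out assms])
  then show ?thesis using mu_rec[OF v] by (simp add: P_def ac_simps)
qed

lemma P_undirected:
  assumes "e \<in> uedges N" "ends N e = {u, v}"
  shows "P u = P v" "P u = m e u + m e v"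
proof -
  have uv: "u \<noteq> v" using assms sn(13)[OF assms(1)] by (auto simp: ends_def)
  then have o: "e \<in> out_edges N u" "e \<in> out_edges N v" "other N e u = v" "other N e v = u"
    using assms by (auto simp: out_edges_def other_def ends_def doubleton_eq_iff)
  show "P u = m e u + m e v" using P_split[OF o(1)] o by simp
  then show "P u = P v" using P_split[OF o(2)] o by (simp add: add.commute)
qed

lemma arc_vec_arc_of:
  assumes "e \<in> out_edges N v"
  shows "arc_vec P Q (arc_of v e) = m e (other N e v)"
proof (cases "e \<in> dedges N")
  case True
  then have "tail N e = v" using assms fin(5) by (auto simp: out_edges_def)
  then have o: "other N e v = head N e" by (simp add: other_def)
  show ?thesis
  proof (cases "is_leaf N (head N e)")
    case leaf: True
    then have "P (head N e) = unit_vector (label N (head N e))" using leaf_iff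
        by (simp add: P_def own_def)
    then show ?thesis using True leaf m_head[OF True] o by (simp add: arc_of_def darc_def)
  next
    case False
    then show ?thesis using True m_head[OF True] o by (simp add: arc_of_def darc_def)
  qed
next
  case False
  then have eU: "e \<in> uedges N" "v \<in> ends N e" using assms by (auto simp: out_edges_def)
  have "uedge v (other N e v) = e" by (rule uedge_eq) (use eU in \<open>auto simp: ends_def other_def\<close>)
  then show ?thesis using False by (simp add: arc_of_def Q_def)
qed

lemma valued: "valued (nonleaves N) (arcs N) P Q"
  unfolding valued_def
proof (intro conjI ballI allI impI)
  fix v assume "v \<in> nonleaves N"
  then have v: "v \<in> nodes N" "\<not> is_leaf N v" by (auto simp: nonleaves_def)
  have "(\<Sum>e \<in># outs (arcs N) v. arc_vec P Q e) = (\<Sum>e \<in># mset_set (out_edges N v). arc_vec P Q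
      (arc_of v e))"
    by (simp add: outs_arcs multiset.map_comp comp_def)
  also have "\<dots> = (\<Sum>e \<in> out_edges N v. arc_vec P Q (arc_of v e))" by (simp add: sum_unfold_sum_mset)
  also have "\<dots> = (\<Sum>e \<in> out_edges N v. m e (other N e v))"
      by (intro sum.cong refl) (simp add: arc_vec_arc_of)
  finally show "P v = hyb (arcs N) v + (\<Sum>e \<in># outs (arcs N) v. arc_vec P Q e)"
    using v hybrid_iff[OF v] by (simp add: P_def own_def hyb_def)
next
  fix u v assume "(u, Ud v) \<in># arcs N"
  then obtain g where g: "g \<in> uedges N" "ends N g = {u, v}" using in_arcs_Ud by blast
  then have "ends N g = {v, u}" by auto
  then show "P u = P v" "P u = Q u v + Q v u"
    using P_undirected[OF g] uedge_eq[OF g] uedge_eq[OF g(1), of v u]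
        by (auto simp: Q_def add.commute)
qed

lemma valued_state: "valued_state {1..n} (nonleaves N) (arcs N) (isolated_labels N) P Q"
  using wf valued by (simp add: valued_state_def)


lemma P_class:
  assumes "w \<in> undir_class N v"
  shows "P w = P v"
proof -
  have "(v, w) \<in> (undir_rel N)\<^sup>*" using assms by (simp add: undir_class_def)
  then show ?thesis
  proof (induction rule: rtrancl_induct)
    case (step y z)
    then obtain e where "e \<in> uedges N" "ends N e = {y, z}" by (auto simp: undir_rel_def)
    then show ?case using step.IH P_undirected(1) by metis
  qed simp
qed

lemma root_component_class:
  assumes "T \<in> root_components N" "v \<in> T"
  shows "T = undir_class N v" "v \<in> nodes N" "\<forall>e \<in> dedges N. undir_class N (head N e) \<noteq> T"
      "deg_i N v = 0"
proof -
  obtain w where w: "w \<in> nodes N" "T = undir_class N w"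
      and h: "\<forall>e \<in> dedges N. undir_class N (head N e) \<noteq> T"
    using assms(1) unfolding root_component_iff[OF fin(3)] by blast
  show T: "T = undir_class N v" using undir_class_eq[of v N w] assms(2) w by simp
  show "v \<in> nodes N" using class_nodes[OF w(1)] w assms(2) by blast
  show "\<forall>e \<in> dedges N. undir_class N (head N e) \<noteq> T" by (rule h)
  then show "deg_i N v = 0" using T fin(3) by (auto simp: deg_i_def)
qed

lemma class_root_component:
  assumes v: "v \<in> nodes N" "deg_i N v = 0"
  shows "undir_class N v \<in> root_components N"
proof (cases "deg_u N v = 0")
  case True
  then have c: "undir_class N v = {v}" using undir_class_singleton[OF fin(2)] sn(13) by blast
  have "undir_class N (head N e) \<noteq> {v}" if "e \<in> dedges N" for e
  proof
    assume "undir_class N (head N e) = {v}"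
    then have "head N e = v" using undir_class_self[of "head N e" N] by auto
    then show False using v(2) that fin(3) by (auto simp: deg_i_def)
  qed
  then show ?thesis unfolding root_component_iff[OF fin(3)] using v c by auto
next
  case False
  then show ?thesis unfolding root_component_iff[OF fin(3)]
      using v undirected_no_in(1)[OF v(1) False] by auto
qed

lemma mu_root_vec_eq:
  assumes T: "T \<in> root_components N" "v \<in> T" and v: "\<not> is_leaf N v"
  shows "mu_root_vec n N T = P v"
proof -
  note c = root_component_class[OF T]
  have dv: "deg N v \<noteq> 0" using v c(2) by (auto simp: is_leaf_def deg_def)
  then have "\<not> (\<exists>w. T = {w} \<and> deg N w = 0)" using T(2) by auto
  moreover define e where "e = (SOME e. e \<in> adm N T)"
  have "e \<in> adm N T" unfolding e_def
  proof (rule someI_ex)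
    obtain f where "f \<in> out_edges N v" using leaf_iff[of v] v c(2) by auto
    then have "f \<in> adm N T" using out_edge_end[of f v] T(2) by (auto simp: adm_def)
    then show "\<exists>e. e \<in> adm N T" by blast
  qed
  then have e: "e \<in> edges N" "ends N e \<inter> T \<noteq> {}" by (auto simp: adm_def ends_def)
  have "P v = m e (tail N e) + m e (head N e)"
  proof (cases "e \<in> uedges N")
    case True
    have "P (tail N e) = P (head N e)" "P (tail N e) = m e (tail N e) + m e (head N e)"
      using P_undirected[OF True, of "tail N e" "head N e"] by (auto simp: ends_def)
    moreover have "P (tail N e) = P v \<or> P (head N e) = P v"
      using e(2) c(1) P_class by (auto simp: ends_def)
    ultimately show ?thesis by metis
  next
    case False
    then have ed: "e \<in> dedges N" using e(1) by (simp add: edges_def)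
    then have "head N e \<notin> T" using c(1,3) undir_class_eq by metis
    then have "tail N e \<in> T" using e(2) by (auto simp: ends_def)
    then have "P (tail N e) = P v" using c(1) P_class by blast
    moreover have "P (tail N e) = m e (tail N e) + m e (head N e)"
      using P_split[of e "tail N e"] ed by (simp add: out_edges_def other_def)
    ultimately show ?thesis by simp
  qed
  ultimately show ?thesis
    unfolding mu_root_vec_def Let_def e_def[symmetric] plus_fun_def by (simp only: if_False)
qed

lemma unresolved_adm_class:
  assumes e: "e \<in> dedges N" and T: "unresolved_adm N e T"
  shows "T = undir_class N (tail N e)" "deg_o N (tail N e) + deg_u N (tail N e) = 3"
proof -
  have T': "T \<in> root_components N" "\<not> resolved N T" "ends N e \<inter> T \<noteq> {}"
    using T by (auto simp: unresolved_adm_def adm_def ends_def)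
  have "head N e \<notin> T" using root_component_class(1,3)[OF T'(1), of "head N e"] e by metis
  then have t: "tail N e \<in> T" using T'(3) by (auto simp: ends_def)
  note c = root_component_class[OF T'(1) t]
  show "T = undir_class N (tail N e)" by (rule c)
  have l: "\<not> is_leaf N (tail N e)" using is_leaf_iff[OF fin(2,3)] e by auto
  show "deg_o N (tail N e) + deg_u N (tail N e) = 3"
  proof (cases "deg_u N (tail N e) = 0")
    case True
    then have "T = {tail N e}" using undir_class_singleton[OF fin(2)] sn(13) c(1) by blast
    then have "deg N (tail N e) \<noteq> 2" using T'(2) by (auto simp: resolved_def)
    then show ?thesis using node_types(1)[OF c(2) l] c(4) by (auto simp: deg_def)
  next
    case False
    then show ?thesis using node_types(2)[OF c(2) l] by blast
  qed
qed

lemma unresolved_admI: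
  assumes e: "e \<in> dedges N" "deg_o N (tail N e) + deg_u N (tail N e) = 3"
  shows "unresolved_adm N e (undir_class N (tail N e))"
proof -
  let ?u = "tail N e"
  have l: "\<not> is_leaf N ?u" using is_leaf_iff[OF fin(2,3)] e by auto
  have u: "?u \<in> nodes N" using sn(7) e by blast
  have i: "deg_i N ?u = 0" using node_types(1)[OF u l] e(2) by auto
  have "\<not> resolved N (undir_class N ?u)"
  proof
    assume "resolved N (undir_class N ?u)"
    then obtain w where "undir_class N ?u = {w}" "deg N w \<in> {0, 2}" by (auto simp: resolved_def)
    then have "deg N ?u \<in> {0, 2}" using undir_class_self[of ?u N] by auto
    then show False using i e(2) by (simp add: deg_def)
  qed
  then show ?thesis using class_root_component[OF u i] e(1) undir_class_self[of ?u N]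
    by (auto simp: unresolved_adm_def adm_def ends_def edges_def)
qed

lemma tail_nonleaf: "e \<in> dedges N \<Longrightarrow> \<not> is_leaf N (tail N e)"
  using is_leaf_iff[OF fin(2,3)] by auto

lemma mu_edge_directed:
  assumes e: "e \<in> dedges N"
  shows "mu_edge n N e = {#(m e (head N e), if is_hybrid N (head N e) then Tag_h else Tag_t)#} +
    (if deg_o N (tail N e) + deg_u N (tail N e) = 3 then {#(P (tail N e) - m e (head N e), Tag_i)#}
        else {#})"
proof -
  let ?u = "tail N e" and ?v = "head N e"
  have eU: "e \<notin> uedges N" using e fin(5) by auto
  have l: "\<not> is_leaf N ?u" using tail_nonleaf[OF e] .
  show ?thesis
  proof (cases "deg_o N ?u + deg_u N ?u = 3")
    case True
    have ex: "\<exists>T. unresolved_adm N e T" using unresolved_admI[OF e True] by blast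
    have T: "(THE T. unresolved_adm N e T) = undir_class N ?u"
    proof (rule the_equality)
      show "unresolved_adm N e (undir_class N ?u)" by (rule unresolved_admI[OF e True])
    qed (rule unresolved_adm_class(1)[OF e])
    have "undir_class N ?u \<in> root_components N" using unresolved_admI[OF e True]
        by (simp add: unresolved_adm_def)
    then have R: "mu_root_vec n N (undir_class N ?u) = P ?u"
        using mu_root_vec_eq[OF _ undir_class_self l] by blast
    then show ?thesis unfolding mu_edge_def Let_def using eU ex T True by (simp add: fun_diff_def)
  next
    case False
    then have "\<not> (\<exists>T. unresolved_adm N e T)" using unresolved_adm_class(2)[OF e] by blast
    then show ?thesis unfolding mu_edge_def Let_def using eU False by simp
  qed
qed

lemma decode_directed:
  assumes e: "e \<in> dedges N"
  shows "decode (mu_edge n N e) = {#entry_of (arcs N) P Q (darc N e)#}"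
proof -
  let ?u = "tail N e" and ?v = "head N e"
  note l = tail_nonleaf[OF e]
  have v: "?v \<in> nodes N" using sn(8) e by blast
  define \<tau> where "\<tau> = (if is_hybrid N ?v then Tag_h else Tag_t)"
  have k: "arc_tag (arcs N) (darc N e) = \<tau>"
    using hybrid_iff[OF v] leaf_tree[of ?v] by (auto simp: darc_def \<tau>_def is_hybrid_def)
  have "e \<in> out_edges N ?u" using e by (simp add: out_edges_def)
  then have vl: "arc_vec P Q (darc N e) = m e ?v" using arc_vec_arc_of[of e ?u] e
      by (simp add: arc_of_def other_def)
  have f: "fst (darc N e) = ?u" by (simp add: darc_def)
  have \<tau>c: "\<tau> = Tag_t \<or> \<tau> = Tag_h" by (simp add: \<tau>_def)
  show ?thesis
    using \<tau>c outs_3_iff[OF l] unfolding mu_edge_directed[OF e] \<tau>_def[symmetric]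
    by (auto simp: decode_def entry_of_def k vl f simp del: minus_apply)
qed

lemma decode_undirected:
  assumes e: "e \<in> uedges N"
  shows "decode (mu_edge n N e) = image_mset (entry_of (arcs N) P Q) (uarcs N e)"
proof -
  let ?u = "tail N e" and ?v = "head N e"
  have en: "ends N e = {?u, ?v}" "ends N e = {?v, ?u}" by (auto simp: ends_def)
  have a: "(?u, Ud ?v) \<in># arcs N" "(?v, Ud ?u) \<in># arcs N" using in_arcs_Ud e en by blast+
  have s: "size (outs (arcs N) ?u) = 3" "size (outs (arcs N) ?v) = 3" using wf_stateD(13)[OF wf] a
      by blast+
  have "Q ?u ?v = m e ?v" "Q ?v ?u = m e ?u" using uedge_eq[OF e en(1)] uedge_eq[OF e en(2)]
      by (simp_all add: Q_def)
  moreover have "P ?u = m e ?v + m e ?u" "P ?v = m e ?v + m e ?u"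
    using P_undirected[OF e en(1)] by (simp_all add: add.commute)
  ultimately show ?thesis using e s by (simp add: mu_edge_def Let_def decode_def entry_of_def
      uarcs_def)
qed

lemma finite_root_components: "finite (root_components N)"
  by (rule finite_subset[of _ "undir_class N ` nodes N"])
    (use fin(1) in \<open>auto simp: root_components_def is_root_def contraction_def\<close>)

lemma arc_entries_eq: "arc_entries (arcs N) P Q = (\<Sum>x \<in># mu_rep n N. decode x)"
proof -
  have r: "decode (mu_root n N T) = {#}" for T by (simp add: mu_root_def decode_def)
  have "edges N = uedges N \<union> dedges N" by (simp add: edges_def)
  then have E: "mset_set (edges N) = mset_set (uedges N) + mset_set (dedges N)"
    using mset_set_Union[OF fin(2,3,5)] by simp
  have U: "(\<Sum>e \<in># mset_set (uedges N). decode (mu_edge n N e)) = (\<Sum>e \<in># mset_set (uedges N).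
      image_mset (entry_of (arcs N) P Q) (uarcs N e))"
    by (rule arg_cong[where f = sum_mset], rule image_mset_cong) (use fin decode_undirected in auto)
  have D: "(\<Sum>e \<in># mset_set (dedges N). decode (mu_edge n N e)) = (\<Sum>e \<in># mset_set (dedges N).
      {#entry_of (arcs N) P Q (darc N e)#})"
    by (rule arg_cong[where f = sum_mset], rule image_mset_cong) (use fin decode_directed in auto)
  have "(\<Sum>e \<in># A. {#entry_of (arcs N) P Q (darc N e)#}) = image_mset (entry_of (arcs N) P Q)
      (image_mset (darc N) A)" for A
    by (induction A) auto
  moreover have "(\<Sum>e \<in># A. image_mset (entry_of (arcs N) P Q) (uarcs N e)) = image_mset (entry_of
      (arcs N) P Q) (\<Sum>e \<in># A. uarcs N e)" for A
    by (induction A) auto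
  ultimately show ?thesis
    using U D by (simp add: mu_rep_def arc_entries_def E multiset.map_comp comp_def r arcs_def)
qed

lemma root_vectors_eq: "root_vectors (nonleaves N) (arcs N) (isolated_labels N) P = {x. {#(x,
    Tag_r)#} \<in># mu_rep n N}"
proof -
  have "mu_edge n N e \<noteq> {#(x, Tag_r)#}" for e x by (auto simp: mu_edge_def Let_def)
  then have "{x. {#(x, Tag_r)#} \<in># mu_rep n N} = mu_root_vec n N ` root_components N"
    using finite_root_components fin(4) by (auto simp: mu_rep_def mu_root_def image_iff) metis+
  also have "\<dots> = root_vectors (nonleaves N) (arcs N) (isolated_labels N) P"
  proof (intro equalityI subsetI)
    fix x assume "x \<in> mu_root_vec n N ` root_components N"
    then obtain T where T: "T \<in> root_components N" "x = mu_root_vec n N T" by blast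
    then obtain v where v: "v \<in> T" using undir_class_self
        by (metis imageE root_component_iff[OF fin(3)])
    note c = root_component_class[OF T(1) v]
    show "x \<in> root_vectors (nonleaves N) (arcs N) (isolated_labels N) P"
    proof (cases "is_leaf N v")
      case True
      then have "T = {v}" "deg N v = 0"
        using undir_class_singleton[OF fin(2), of v] sn(13) c(1,4)
            by (auto simp: is_leaf_def deg_def)
      then show ?thesis using T(2) True by (auto simp: mu_root_vec_def root_vectors_def
          isolated_labels_def)
    next
      case False
      then have "x = P v" using mu_root_vec_eq[OF T(1) v] T(2) by simp
      moreover have "v \<in> nonleaves N" "ins (arcs N) v = 0"
          using False c deg_arcs(1)[OF labelled_graph False] by (auto simp: nonleaves_def)
      ultimately show ?thesis by (auto simp: root_vectors_def)
    qed
  next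
    fix x assume "x \<in> root_vectors (nonleaves N) (arcs N) (isolated_labels N) P"
    then consider v where "v \<in> nonleaves N" "ins (arcs N) v = 0" "x = P v"
      | v where "is_leaf N v" "deg N v = 0" "x = unit_vector (label N v)"
      by (auto simp: root_vectors_def isolated_labels_def)
    then show "x \<in> mu_root_vec n N ` root_components N"
    proof cases
      case 1
      then have v: "v \<in> nodes N" "\<not> is_leaf N v" "deg_i N v = 0"
          using deg_arcs(1)[OF labelled_graph, of v] by (auto simp: nonleaves_def)
      then show ?thesis using class_root_component[OF v(1,3)] mu_root_vec_eq[OF _ undir_class_self
          v(2)] 1 by force
    next
      case 2
      then have v: "v \<in> nodes N" "deg_i N v = 0" "deg_u N v = 0" by (auto simp: is_leaf_def deg_def)
      then have "undir_class N v = {v}" using undir_class_singleton[OF fin(2), of v] sn(13) by auto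
      then have "{v} \<in> root_components N" using class_root_component[OF v(1,2)] by simp
      moreover have "mu_root_vec n N {v} = x" using 2 by (simp add: mu_root_vec_def)
      ultimately show ?thesis by blast
    qed
  qed
  finally show ?thesis by simp
qed

end

section \<open>Isomorphism\<close>

lemma image_mset_set_bij:
  assumes "finite A" "finite B" "image_mset h (mset_set A) = image_mset k (mset_set B)"
  shows "\<exists>g. bij_betw g A B \<and> (\<forall>x \<in> A. k (g x) = h x)"
  using assms
proof (induction A arbitrary: B rule: finite_induct)
  case empty
  then have "B = {}" by (simp add: mset_set_empty_iff)
  then show ?case by (auto simp: bij_betw_def)
next
  case (insert x A)
  have "h x \<in># image_mset k (mset_set B)" using insert.prems(2)[symmetric] insert.hyps by simp
  then obtain y where y: "y \<in> B" "k y = h x" using insert.prems(1) by auto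
  then have "mset_set B = add_mset y (mset_set (B - {y}))" using insert.prems(1)
      by (simp add: mset_set.remove)
  then have "image_mset h (mset_set A) = image_mset k (mset_set (B - {y}))"
    using insert.prems(2) insert.hyps y by simp
  then obtain g where g: "bij_betw g A (B - {y})" "\<forall>x \<in> A. k (g x) = h x"
    using insert.IH[of "B - {y}"] insert.prems(1) by blast
  have "bij_betw (g(x := y)) (insert x A) B"
    by (rule bij_betw_extend) (use g(1) insert.hyps y in auto)
  moreover have "\<forall>z \<in> insert x A. k ((g(x := y)) z) = h z" using g(2) y insert.hyps by auto
  ultimately show ?case by blast
qed

lemma state_iso_isomorphic:
  assumes A: "network N1 n" and B: "network N2 n"
    and iso: "state_iso (nonleaves N1) (arcs N1) (isolated_labels N1) (nonleaves N2) (arcs N2)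
        (isolated_labels N2)"
  shows "isomorphic N1 N2"
proof -
  interpret A: network N1 n by fact
  interpret B: network N2 n by fact
  obtain f where f: "bij_betw f (nonleaves N1) (nonleaves N2)"
      and fD: "image_mset (map_arc f) (arcs N1) = arcs N2"
    and I: "isolated_labels N1 = isolated_labels N2" using iso by (auto simp: state_iso_def)
  have labels: "label N ` {v. is_leaf N v} = isolated_labels N \<union> {i. \<exists>u. (u, Lf i) \<in># arcs N}" if
      "network N n" for N :: "('x, 'y) sd_net"
  proof -
    interpret network N n by fact
    show ?thesis
    proof (intro equalityI subsetI)
      fix i assume "i \<in> label N ` {v. is_leaf N v}"
      then obtain v where v: "is_leaf N v" "i = label N v" by blast
      show "i \<in> isolated_labels N \<union> {i. \<exists>u. (u, Lf i) \<in># arcs N}"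
      proof (cases "deg N v = 0")
        case True
        then show ?thesis using v by (auto simp: isolated_labels_def)
      next
        case False
        then obtain e where "e \<in> dedges N" "head N e = v"
            using leaf_deg_0_iff[OF labelled_graph v(1)] by auto
        then show ?thesis using v by (auto simp: in_arcs_iff[OF fin(3,2)])
      qed
    qed (auto simp: isolated_labels_def in_arcs_iff[OF fin(3,2)])
  qed
  have "(\<exists>u. (u, Lf i) \<in># arcs N1) \<longleftrightarrow> (\<exists>u. (u, Lf i) \<in># arcs N2)" for i
  proof -
    have "(w, Lf i) = map_arc f e \<longleftrightarrow> (\<exists>u. e = (u, Lf i) \<and> w = f u)" for w e
      by (cases e; cases "snd e") (auto simp: map_arc_def)
    then show ?thesis unfolding fD[symmetric] by (auto simp: image_iff)
  qed
  then have lab: "label N1 ` {v. is_leaf N1 v} = label N2 ` {v. is_leaf N2 v}"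
    unfolding labels[OF A] labels[OF B] I by simp
  define l where "l = (\<lambda>v. inv_into {v. is_leaf N2 v} (label N2) (label N1 v))"
  have l: "is_leaf N2 (l v)" "label N2 (l v) = label N1 v" if "is_leaf N1 v" for v
  proof -
    have "label N1 v \<in> label N2 ` {v. is_leaf N2 v}" using that lab by blast
    then show "is_leaf N2 (l v)" "label N2 (l v) = label N1 v"
      using inv_into_into[of "label N1 v" "label N2"
          "{v. is_leaf N2 v}"] f_inv_into_f[of "label N1 v" "label N2" "{v. is_leaf N2 v}"]
      by (auto simp: l_def)
  qed
  have l_bij: "bij_betw l {v. is_leaf N1 v} {v. is_leaf N2 v}"
    unfolding bij_betw_def
  proof
    show "inj_on l {v. is_leaf N1 v}"
      using A.label_inj l by (auto simp: inj_on_def) metis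
    show "l ` {v. is_leaf N1 v} = {v. is_leaf N2 v}"
    proof (intro equalityI subsetI)
      fix w assume w: "w \<in> {v. is_leaf N2 v}"
      then obtain v where v: "is_leaf N1 v" "label N1 v = label N2 w" using lab
          by (metis (mono_tags, lifting) imageE imageI mem_Collect_eq)
      then have "l v = w" using l[OF v(1)] w B.label_inj by (auto simp: inj_on_def)
      then show "w \<in> l ` {v. is_leaf N1 v}" using v by blast
    qed (use l in auto)
  qed
  define F where "F v = (if is_leaf N1 v then l v else f v)" for v
  have nodes: "nodes N = nonleaves N \<union> {v. is_leaf N v}"
      "nonleaves N \<inter> {v. is_leaf N v} = {}" for N :: "('x, 'y) sd_net"
    by (auto simp: nonleaves_def is_leaf_def)
  have "bij_betw F (nonleaves N1) (nonleaves N2)"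
    using f by (subst bij_betw_cong[of _ _ f]) (auto simp: F_def nonleaves_def)
  moreover have "bij_betw F {v. is_leaf N1 v} {v. is_leaf N2 v}"
    using l_bij by (subst bij_betw_cong[of _ _ l]) (auto simp: F_def)
  ultimately have F: "bij_betw F (nodes N1) (nodes N2)"
    unfolding nodes(1) by (intro bij_betw_combine nodes(2))
  have dfilter: "{#e \<in># arcs N. \<forall>v. snd e \<noteq> Ud v#} = image_mset (darc N) (mset_set (dedges N))"
    if "network N n" for N :: "('x, 'y) sd_net"
  proof -
    interpret network N n by fact
    have 1: "{#e \<in># image_mset (darc N) X. \<forall>v. snd e \<noteq> Ud v#} = image_mset (darc N) X" for X
      by (induction X) (auto simp: darc_def)
    have 2: "{#e \<in># (\<Sum>e \<in># X. uarcs N e). \<forall>v. snd e \<noteq> Ud v#} = {#}" for X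
      by (induction X) (auto simp: uarcs_def)
    show ?thesis unfolding arcs_def filter_union_mset 1 2 by simp
  qed
  have "{#e \<in># image_mset (map_arc f) X. \<forall>v. snd e \<noteq> Ud v#} = image_mset (map_arc f) {#e \<in># X. \<forall>v.
      snd e \<noteq> Ud v#}" for X
  proof (induction X)
    case (add e X)
    have "(\<forall>v. snd (map_arc f e) \<noteq> Ud v) \<longleftrightarrow> (\<forall>v. snd e \<noteq> Ud v)" by (cases e; cases "snd e") auto
    then show ?case using add by simp
  qed simp
  then have "image_mset (map_arc f) (image_mset (darc N1) (mset_set (dedges N1))) = image_mset (darc
      N2) (mset_set (dedges N2))"
    by (simp only: dfilter[OF A, symmetric] dfilter[OF B, symmetric] fD[symmetric])
  then have "image_mset (\<lambda>e. map_arc f (darc N1 e)) (mset_set (dedges N1)) = image_mset (darc N2)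
      (mset_set (dedges N2))"
    by (simp add: multiset.map_comp comp_def)
  from image_mset_set_bij[OF A.fin(3) B.fin(3) this]
  obtain gd where gd: "bij_betw gd (dedges N1) (dedges N2)" "\<And>e. e \<in> dedges N1 \<Longrightarrow>
      darc N2 (gd e) = map_arc f (darc N1 e)"
    by blast
  have gd': "tail N2 (gd e) = F (tail N1 e)" "head N2 (gd e) = F (head N1 e)"
      if e: "e \<in> dedges N1" for e
  proof -
    have "\<not> is_leaf N1 (tail N1 e)" using A.tail_nonleaf[OF e] .
    then show "tail N2 (gd e) = F (tail N1 e)" using gd(2)[OF e]
        by (simp add: darc_def map_arc_def F_def)
    show "head N2 (gd e) = F (head N1 e)"
    proof (cases "is_leaf N1 (head N1 e)")
      case True
      then have "is_leaf N2 (head N2 (gd e))" "label N2 (head N2 (gd e)) = label N1 (head N1 e)"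
        using gd(2)[OF e] by (auto simp: darc_def map_arc_def split: if_splits)
      then show ?thesis using l[OF True] True B.label_inj by (auto simp: F_def inj_on_def)
    next
      case False
      then show ?thesis using gd(2)[OF e] by (auto simp: darc_def map_arc_def F_def
          split: if_splits)
    qed
  qed
  have Fends: "F ` ends N1 e = f ` ends N1 e" "ends N1 e \<subseteq> nonleaves N1" if e: "e \<in> uedges N1" for e
  proof -
    have "\<not> is_leaf N1 v" if "v \<in> ends N1 e" for v using is_leaf_iff[OF A.fin(2,3)] that e by blast
    then show "F ` ends N1 e = f ` ends N1 e" "ends N1 e \<subseteq> nonleaves N1"
      using A.edge_nodes[of e] e by (auto simp: F_def nonleaves_def edges_def)
  qed
  define gu where "gu e = B.uedge (f (tail N1 e)) (f (head N1 e))" for e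
  have gu: "gu e \<in> uedges N2" "ends N2 (gu e) = f ` ends N1 e" if e: "e \<in> uedges N1" for e
  proof -
    have "(tail N1 e, Ud (head N1 e)) \<in># arcs N1" using A.in_arcs_Ud e by (auto simp: ends_def)
    then have "map_arc f (tail N1 e, Ud (head N1 e)) \<in># arcs N2" unfolding fD[symmetric]
        by (rule imageI[of _ "set_mset _", folded set_image_mset])
    then obtain e2 where e2: "e2 \<in> uedges N2" "ends N2 e2 = {f (tail N1 e), f (head N1 e)}"
        using B.in_arcs_Ud by auto
    then have "gu e = e2" unfolding gu_def by (rule B.uedge_eq)
    then show "gu e \<in> uedges N2" "ends N2 (gu e) = f ` ends N1 e" using e2 by (auto simp: ends_def)
  qed
  have fin: "inj_on f (nonleaves N1)" using f by (simp add: bij_betw_def)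
  have gub: "bij_betw gu (uedges N1) (uedges N2)"
    unfolding bij_betw_def
  proof
    show "inj_on gu (uedges N1)"
    proof (rule inj_onI)
      fix d e assume *: "d \<in> uedges N1" "e \<in> uedges N1" "gu d = gu e"
      then have "f ` ends N1 d = f ` ends N1 e" using gu by metis
      then have "ends N1 d = ends N1 e" using inj_on_image_eq_iff[OF fin] Fends(2) * by blast
      then show "d = e" using A.no_parallel_undirected * by blast
    qed
    show "gu ` uedges N1 = uedges N2"
    proof (intro equalityI subsetI)
      fix e2 assume e2: "e2 \<in> uedges N2"
      then have "(tail N2 e2, Ud (head N2 e2)) \<in># arcs N2" using B.in_arcs_Ud
          by (auto simp: ends_def)
      then obtain a where a: "a \<in># arcs N1" "map_arc f a = (tail N2 e2, Ud (head N2 e2))"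
          unfolding fD[symmetric] by auto
      then obtain u v where uv: "a = (u, Ud v)" "f u = tail N2 e2" "f v = head N2 e2"
        by (cases a; cases "snd a") (auto simp: map_arc_def)
      then obtain e where e: "e \<in> uedges N1" "ends N1 e = {u, v}" using a A.in_arcs_Ud by blast
      then have "ends N2 (gu e) = ends N2 e2" using gu[OF e(1)] uv by (auto simp: ends_def)
      then have "gu e = e2" using B.no_parallel_undirected gu(1)[OF e(1)] e2 by blast
      then show "e2 \<in> gu ` uedges N1" using e by blast
    qed (use gu in auto)
  qed
  define g where "g e = (if e \<in> uedges N1 then gu e else gd e)" for e
  have gU: "g e = gu e" if "e \<in> uedges N1" for e using that by (simp add: g_def)
  have gD: "g e = gd e" if "e \<in> dedges N1" for e using that A.fin(5) by (auto simp: g_def)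
  have "bij_betw g (uedges N1) (uedges N2)" using gub gU bij_betw_cong by metis
  moreover have "bij_betw g (dedges N1) (dedges N2)" using gd(1) gD bij_betw_cong by metis
  moreover have "\<forall>e \<in> uedges N1. ends N2 (g e) = F ` ends N1 e" using gU gu Fends by auto
  moreover have "\<forall>e \<in> dedges N1. tail N2 (g e) = F (tail N1 e) \<and> head N2 (g e) = F (head N1 e)"
      using gD gd' by auto
  moreover have "\<forall>v. is_leaf N1 v \<longrightarrow> label N2 (F v) = label N1 v" using l by (simp add: F_def)
  ultimately show ?thesis unfolding isomorphic_def using F by blast
qed

locale network_iso = A: network N1 n + B: network N2 n
  for N1 :: "('v, 'e) sd_net" and N2 :: "('w, 'd) sd_net" and n +
  fixes f :: "'v \<Rightarrow> 'w" and g :: "'e \<Rightarrow> 'd"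
  assumes f: "bij_betw f (nodes N1) (nodes N2)"
    and gu: "bij_betw g (uedges N1) (uedges N2)" and gd: "bij_betw g (dedges N1) (dedges N2)"
    and gu_ends: "e \<in> uedges N1 \<Longrightarrow> ends N2 (g e) = f ` ends N1 e"
    and gd_ends: "e \<in> dedges N1 \<Longrightarrow> tail N2 (g e) = f (tail N1 e)" "e \<in> dedges N1 \<Longrightarrow>
        head N2 (g e) = f (head N1 e)"
    and lab: "is_leaf N1 v \<Longrightarrow> label N2 (f v) = label N1 v"
begin

lemma f_inj: "x \<in> nodes N1 \<Longrightarrow> y \<in> nodes N1 \<Longrightarrow> f x = f y \<longleftrightarrow> x = y"
  using f by (auto simp: bij_betw_def inj_on_def)

lemma f_node: "v \<in> nodes N1 \<Longrightarrow> f v \<in> nodes N2"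
  using f by (auto simp: bij_betw_def)

lemma g_inj: "inj_on g (edges N1)"
proof -
  have "g ` uedges N1 \<inter> g ` dedges N1 = {}" using gu gd B.fin(5) by (simp add: bij_betw_def)
  then show ?thesis unfolding edges_def using gu gd by (auto simp: bij_betw_def inj_on_Un)
qed

lemma g_edges: "g ` edges N1 = edges N2"
  using gu gd by (simp add: edges_def image_Un bij_betw_def)

lemma f_in_ends: "e \<in> edges N1 \<Longrightarrow> v \<in> nodes N1 \<Longrightarrow> f v \<in> f ` ends N1 e \<longleftrightarrow> v \<in> ends N1 e"
  using A.edge_nodes[of e] f_inj by blast

lemma image_sets:
  assumes v: "v \<in> nodes N1"
  shows "{d \<in> dedges N2. tail N2 d = f v} = g ` {e \<in> dedges N1. tail N1 e = v}"
    "{d \<in> dedges N2. head N2 d = f v} = g ` {e \<in> dedges N1. head N1 e = v}"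
    "{d \<in> uedges N2. f v \<in> ends N2 d} = g ` {e \<in> uedges N1. v \<in> ends N1 e}"
proof -
  have D: "dedges N2 = g ` dedges N1" and U: "uedges N2 = g ` uedges N1" using gd gu
      by (auto simp: bij_betw_def)
  show "{d \<in> dedges N2. tail N2 d = f v} = g ` {e \<in> dedges N1. tail N1 e = v}"
    unfolding D using gd_ends f_inj[OF A.sn(7) v] by auto
  show "{d \<in> dedges N2. head N2 d = f v} = g ` {e \<in> dedges N1. head N1 e = v}"
    unfolding D using gd_ends f_inj[OF A.sn(8) v] by auto
  show "{d \<in> uedges N2. f v \<in> ends N2 d} = g ` {e \<in> uedges N1. v \<in> ends N1 e}"
    unfolding U using gu_ends f_in_ends[OF _ v] by (auto simp: edges_def)
qed

lemma degs:
  assumes v: "v \<in> nodes N1"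
  shows "deg_i N2 (f v) = deg_i N1 v" "deg_o N2 (f v) = deg_o N1 v" "deg_u N2 (f v) = deg_u N1 v"
  unfolding deg_i_def deg_o_def deg_u_def image_sets[OF v]
  by (rule card_image, rule inj_on_subset[OF g_inj], auto simp: edges_def)+

lemma leaf: "v \<in> nodes N1 \<Longrightarrow> is_leaf N2 (f v) \<longleftrightarrow> is_leaf N1 v"
  and hybrid: "v \<in> nodes N1 \<Longrightarrow> is_hybrid N2 (f v) \<longleftrightarrow> is_hybrid N1 v"
  using degs f_node by (auto simp: is_leaf_def is_hybrid_def)

lemma out: "v \<in> nodes N1 \<Longrightarrow> out_edges N2 (f v) = g ` out_edges N1 v"
  unfolding out_edges_def image_Un using image_sets by auto

lemma other_iso:
  assumes v: "v \<in> nodes N1" "e \<in> out_edges N1 v"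
  shows "other N2 (g e) (f v) = f (other N1 e v)"
proof (cases "e \<in> dedges N1")
  case True
  then have "tail N1 e = v" using v A.fin(5) by (auto simp: out_edges_def)
  then show ?thesis using gd_ends[OF True] by (simp add: other_def)
next
  case False
  then have e: "e \<in> uedges N1" "v \<in> ends N1 e" using v by (auto simp: out_edges_def)
  obtain w where w: "ends N1 e = {v, w}" "other N1 e v = w" using e
      by (auto simp: ends_def other_def insert_commute)
  have "{tail N2 (g e), head N2 (g e)} = {f v, f w}"
    using gu_ends[OF e(1)] unfolding w(1) by (simp add: ends_def)
  then show ?thesis using w by (auto simp: other_def doubleton_eq_iff)
qed

lemma own_iso: "v \<in> nodes N1 \<Longrightarrow> B.own (f v) = A.own v"
  using leaf hybrid lab by (simp add: A.own_def B.own_def)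

lemma ends_iso: "e \<in> edges N1 \<Longrightarrow> ends N2 (g e) = f ` ends N1 e"
  using gu_ends gd_ends by (auto simp: edges_def ends_def)

lemma m_iso:
  assumes "v \<in> nodes N1" "e \<in> edges N1" "v \<in> ends N1 e"
  shows "B.m (g e) (f v) = A.m e v"
  using assms
proof (induction "nat (A.reach e v)" arbitrary: e v rule: less_induct)
  case less
  have sub: "out_edges N1 v \<subseteq> edges N1" using A.out_edge_end(2) by blast
  have "out_edges N2 (f v) - {g e} = g ` (out_edges N1 v - {e})"
    unfolding out[OF less.prems(1)]
    using inj_on_image_set_diff[OF g_inj, of "out_edges N1 v" "{e}"] sub less.prems(2) by auto
  then have "(\<Sum>d \<in> out_edges N2 (f v) - {g e}. B.m d (other N2 d (f v))) =
      (\<Sum>d \<in> out_edges N1 v - {e}. B.m (g d) (other N2 (g d) (f v)))"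
    using sum.reindex[OF inj_on_subset[OF g_inj], of "out_edges N1 v - {e}"] sub
        by (auto simp: comp_def)
  also have "\<dots> = (\<Sum>d \<in> out_edges N1 v - {e}. A.m d (other N1 d v))"
  proof (rule sum.cong[OF refl])
    fix d assume d: "d \<in> out_edges N1 v - {e}"
    have "A.reach d (other N1 d v) < A.reach e v" using A.reach_less[of v e d] less.prems d by auto
    then have "B.m (g d) (f (other N1 d v)) = A.m d (other N1 d v)"
      using less.hyps[of d "other N1 d v"] A.reach_nonneg[of d
          "other N1 d v"] A.other_node[of d v] A.out_edge_end[of d v] d by auto
    then show "B.m (g d) (other N2 (g d) (f v)) = A.m d (other N1 d v)"
      using other_iso[OF less.prems(1)] d by simp
  qed
  finally show ?case
    using A.mu_rec[OF less.prems(1,3)] B.mu_rec[OF f_node[OF less.prems(1)], of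
        "g e"] ends_iso[OF less.prems(2)]
      less.prems(3) own_iso[OF less.prems(1)] by simp
qed

lemma P_iso:
  assumes v: "v \<in> nodes N1"
  shows "B.P (f v) = A.P v"
proof -
  have sub: "out_edges N1 v \<subseteq> edges N1" using A.out_edge_end(2) by blast
  have "(\<Sum>d \<in> out_edges N2 (f v). B.m d (other N2 d (f v))) = (\<Sum>d \<in> out_edges N1 v. B.m (g d) (other
      N2 (g d) (f v)))"
    unfolding out[OF v] using sum.reindex[OF inj_on_subset[OF g_inj sub]] by (simp add: comp_def)
  also have "\<dots> = (\<Sum>d \<in> out_edges N1 v. A.m d (other N1 d v))"
    by (rule sum.cong[OF refl]) (use m_iso A.other_node A.out_edge_end other_iso[OF v] in auto)
  finally show ?thesis using own_iso[OF v] by (simp add: A.P_def B.P_def)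
qed

lemma mu_edge_iso:
  assumes "e \<in> edges N1"
  shows "mu_edge n N2 (g e) = mu_edge n N1 e"
proof (cases "e \<in> dedges N1")
  case True
  have ge: "g e \<in> dedges N2" using gd True by (auto simp: bij_betw_def)
  have t: "tail N1 e \<in> nodes N1" "head N1 e \<in> nodes N1" using A.sn(7,8) True by auto
  have "B.m (g e) (f (head N1 e)) = A.m e (head N1 e)"
      by (rule m_iso) (use t assms in \<open>auto simp: ends_def\<close>)
  then show ?thesis
    unfolding A.mu_edge_directed[OF True] B.mu_edge_directed[OF ge] gd_ends[OF True]
    using degs[OF t(1)] P_iso[OF t(1)] hybrid[OF t(2)] by (simp del: minus_apply)
next
  case False
  then have e: "e \<in> uedges N1" using assms by (simp add: edges_def)
  have ge: "g e \<in> uedges N2" using gu e by (auto simp: bij_betw_def)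
  have t: "tail N1 e \<in> nodes N1" "head N1 e \<in> nodes N1" using A.sn(9,10) e by auto
  have "{tail N2 (g e), head N2 (g e)} = {f (tail N1 e), f (head N1 e)}" using gu_ends[OF e]
      by (simp add: ends_def)
  then consider "tail N2 (g e) = f (tail N1 e)" "head N2 (g e) = f (head N1 e)" |
      "tail N2 (g e) = f (head N1 e)" "head N2 (g e) = f (tail N1 e)"
    by (auto simp: doubleton_eq_iff)
  moreover have "B.m (g e) (f (head N1 e)) = A.m e (head N1 e)"
      "B.m (g e) (f (tail N1 e)) = A.m e (tail N1 e)"
    by (rule m_iso; use t assms in \<open>auto simp: ends_def\<close>)+
  ultimately show ?thesis using e ge by cases (simp_all add: mu_edge_def Let_def add_mset_commute)
qed

lemma class_iso:
  assumes v: "v \<in> nodes N1"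
  shows "undir_class N2 (f v) = f ` undir_class N1 v"
proof (intro equalityI subsetI)
  fix w assume "w \<in> undir_class N2 (f v)"
  then have "(f v, w) \<in> (undir_rel N2)\<^sup>*" by (simp add: undir_class_def)
  then show "w \<in> f ` undir_class N1 v"
  proof (induction rule: rtrancl_induct)
    case base
    show ?case using undir_class_self[of v N1] by (rule imageI)
  next
    case (step y z)
    then obtain x where x: "x \<in> undir_class N1 v" "y = f x" by blast
    obtain d where d: "d \<in> uedges N2" "ends N2 d = {y, z}" using step(2)
        by (auto simp: undir_rel_def)
    then obtain e where e: "e \<in> uedges N1" "d = g e" using gu by (auto simp: bij_betw_def)
    have fe: "f ` ends N1 e = {f x, z}" using d e gu_ends x by simp
    have xn: "x \<in> nodes N1" using A.class_nodes[OF v] x by blast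
    then have "x \<in> ends N1 e" using f_in_ends[of e x] fe e by (auto simp: edges_def)
    then obtain z' where z': "ends N1 e = {x, z'}" by (auto simp: ends_def)
    then have "z = f z'" using fe by (auto simp: doubleton_eq_iff)
    moreover have "z' \<in> undir_class N1 v" using x e(1) z' unfolding undir_class_def undir_rel_def
      by (auto intro: rtrancl_into_rtrancl)
    ultimately show ?case by blast
  qed
next
  fix w assume "w \<in> f ` undir_class N1 v"
  then obtain x where x: "(v, x) \<in> (undir_rel N1)\<^sup>*" "w = f x" by (auto simp: undir_class_def)
  from x(1) have "(f v, f x) \<in> (undir_rel N2)\<^sup>*"
  proof (induction rule: rtrancl_induct)
    case (step y z)
    then obtain e where e: "e \<in> uedges N1" "ends N1 e = {y, z}" by (auto simp: undir_rel_def)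
    then have "(f y, f z) \<in> undir_rel N2" using gu gu_ends[OF e(1)]
        by (auto simp: undir_rel_def bij_betw_def intro!: bexI[of _ "g e"])
    then show ?case using step.IH by simp
  qed simp
  then show "w \<in> undir_class N2 (f v)" using x by (simp add: undir_class_def)
qed

lemma root_components_iso: "root_components N2 = image f ` root_components N1"
proof -
  have sub: "undir_class N1 v \<subseteq> nodes N1" if "v \<in> nodes N1" for v using A.class_nodes[OF that] .
  have inj: "f ` X = f ` Y \<longleftrightarrow> X = Y" if "X \<subseteq> nodes N1" "Y \<subseteq> nodes N1" for X Y
    using that f inj_on_image_eq_iff by (metis bij_betw_def)
  have n2: "nodes N2 = f ` nodes N1" and d2: "dedges N2 = g ` dedges N1" using f gd
      by (auto simp: bij_betw_def)
  have c: "undir_class N2 ` nodes N2 = image f ` undir_class N1 ` nodes N1"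
    unfolding n2 image_image by (rule image_cong[OF refl]) (simp add: class_iso)
  have h: "undir_class N2 (head N2 (g e)) = f ` undir_class N1 (head N1 e)" if "e \<in> dedges N1" for e
    using gd_ends(2)[OF that] class_iso[OF A.sn(8)[OF that]] by simp
  have iff: "f ` undir_class N1 v \<in> root_components N2 \<longleftrightarrow> undir_class N1 v \<in> root_components N1"
      if v: "v \<in> nodes N1" for v
    unfolding root_component_iff[OF A.fin(3)] root_component_iff[OF B.fin(3)] c d2
    using v h inj[OF sub[OF A.sn(8)] sub[OF v]] by auto
  show ?thesis
  proof (intro equalityI subsetI)
    fix T assume T: "T \<in> root_components N2"
    then have "T \<in> image f ` undir_class N1 ` nodes N1" unfolding root_component_iff[OF B.fin(3)] c
        by simp
    then obtain v where v: "v \<in> nodes N1" "T = f ` undir_class N1 v" by auto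
    then have "undir_class N1 v \<in> root_components N1" using T iff by simp
    then show "T \<in> image f ` root_components N1" using v(2) by simp
  next
    fix T assume "T \<in> image f ` root_components N1"
    then obtain T1 where T1: "T1 \<in> root_components N1" "T = f ` T1" by auto
    then obtain v where v: "v \<in> nodes N1" "T1 = undir_class N1 v"
        unfolding root_component_iff[OF A.fin(3)] by auto
    then show "T \<in> root_components N2" using T1 iff by simp
  qed
qed

lemma mu_root_iso:
  assumes T: "T \<in> root_components N1"
  shows "mu_root n N2 (f ` T) = mu_root n N1 T"
proof -
  obtain v where v: "v \<in> T" using T undir_class_self
      by (metis imageE root_component_iff[OF A.fin(3)])
  note c = A.root_component_class[OF T v]
  have T2: "f ` T \<in> root_components N2" "f v \<in> f ` T" using T v root_components_iso by auto
  show ?thesis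
  proof (cases "is_leaf N1 v")
    case True
    then have "T = {v}" "deg N1 v = 0"
      using undir_class_singleton[OF A.fin(2), of v] A.sn(13) c(1,4)
          by (auto simp: is_leaf_def deg_def)
    then show ?thesis using degs[OF c(2)] lab[OF True]
        by (simp add: mu_root_def mu_root_vec_def deg_def)
  next
    case False
    then show ?thesis
      using A.mu_root_vec_eq[OF T v] B.mu_root_vec_eq[OF T2] leaf[OF c(2)] P_iso[OF c(2)]
          by (simp add: mu_root_def)
  qed
qed

lemma mu_rep_iso: "mu_rep n N2 = mu_rep n N1"
proof -
  have "mset_set (edges N2) = image_mset g (mset_set (edges N1))"
    using image_mset_mset_set[OF g_inj] g_edges by simp
  moreover have "inj_on (image f) (root_components N1)"
  proof (rule inj_onI)
    fix X Y assume *: "X \<in> root_components N1" "Y \<in> root_components N1" "f ` X = f ` Y"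
    then have "X \<subseteq> nodes N1" "Y \<subseteq> nodes N1" using A.class_nodes
        unfolding root_component_iff[OF A.fin(3)] by auto
    then show "X = Y" using *(3) f inj_on_image_eq_iff by (metis bij_betw_def)
  qed
  then have "mset_set (root_components N2) = image_mset (image f) (mset_set (root_components N1))"
    unfolding root_components_iso by (simp add: image_mset_mset_set)
  moreover have "image_mset (mu_edge n N2 \<circ> g) (mset_set (edges N1)) = image_mset (mu_edge n N1)
      (mset_set (edges N1))"
    by (rule image_mset_cong) (use A.fin(4) mu_edge_iso in auto)
  moreover have "image_mset (mu_root n N2 \<circ> image f) (mset_set (root_components N1)) = image_mset
      (mu_root n N1) (mset_set (root_components N1))"
    by (rule image_mset_cong) (use A.finite_root_components mu_root_iso in auto)
  ultimately show ?thesis by (simp add: mu_rep_def multiset.map_comp)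
qed

end

lemma isomorphic_mu_rep:
  assumes "network N1 n" "network N2 n" "isomorphic N1 N2"
  shows "mu_rep n N1 = mu_rep n N2"
proof -
  obtain f g where "bij_betw f (nodes N1) (nodes N2)" "bij_betw g (uedges N1) (uedges N2)"
      "bij_betw g (dedges N1) (dedges N2)"
    "\<forall>e \<in> uedges N1. ends N2 (g e) = f ` ends N1 e"
    "\<forall>e \<in> dedges N1. tail N2 (g e) = f (tail N1 e) \<and> head N2 (g e) = f (head N1 e)"
    "\<forall>v. is_leaf N1 v \<longrightarrow> label N2 (f v) = label N1 v"
    using assms(3) unfolding isomorphic_def by blast
  then have "network_iso N1 N2 n f g"
    using assms(1,2) by (simp add: network_iso_def network_iso_axioms_def)
  then show ?thesis using network_iso.mu_rep_iso by metis
qed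

lemma orchard_network_network: "orchard_network n N \<Longrightarrow> network N n"
  by (simp add: orchard_network_def network_def network_axioms_def acyclic_graph_def L_network_def)

lemma mu_rep_isomorphic:
  fixes N1 :: "('v, 'e) sd_net" and N2 :: "('w, 'd) sd_net"
  assumes N1: "orchard_network n N1" and N2: "network N2 n" and eq: "mu_rep n N1 = mu_rep n N2"
  shows "isomorphic N1 N2"
proof -
  have A: "network N1 n" using orchard_network_network[OF N1] .
  interpret A: network N1 n by fact
  interpret B: network N2 n by fact
  have "orchard N1" using N1 by (simp add: orchard_network_def)
  then obtain L' D' I' where "step\<^sup>*\<^sup>* (state_of {1..n} N1) (L', {}, D', I')"
    using orchard_steps[OF _ A.labelled_graph A.wf] by blast
  then have "determined TYPE('w) {1..n} (nonleaves N1) (arcs N1) (isolated_labels N1)"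
    unfolding state_of_def by (rule steps_determined)
  then have "state_iso (nonleaves N1) (arcs N1) (isolated_labels N1) (nonleaves N2) (arcs N2)
      (isolated_labels N2)"
    by (rule determinedD[OF _ A.valued_state B.valued_state]) (simp_all only: A.arc_entries_eq
        B.arc_entries_eq A.root_vectors_eq B.root_vectors_eq eq)
  then show ?thesis using state_iso_isomorphic[OF A N2] by blast
qed

lemma size_sym_diff_triangle:
  "size (multiset_sym_diff A C) \<le> size (multiset_sym_diff A B) + size (multiset_sym_diff B C)"
proof -
  have t: "X - Z \<subseteq># (X - Y) + (Y - Z)" for X Y Z :: "'a multiset"
    by (rule mset_subset_eqI) simp
  have "size (A - C) \<le> size (A - B) + size (B - C)" "size (C - A) \<le> size (C - B) + size (B - A)"
    using size_mset_mono[OF t[of A C B]] size_mset_mono[OF t[of C A B]] by simp_all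
  then show ?thesis by (simp add: multiset_sym_diff_def)
qed

lemma sym_diff_empty_iff: "multiset_sym_diff A B = {#} \<longleftrightarrow> A = B"
  by (auto simp: multiset_sym_diff_def Diff_eq_empty_iff_mset intro: subset_mset.antisym)

theorem theorem2:
  fixes n :: nat
    and N1 :: "('v1, 'e1) sd_net" and N2 :: "('v2, 'e2) sd_net" and N3 :: "('v3, 'e3) sd_net"
  assumes "orchard_network n N1" and "orchard_network n N2" and "orchard_network n N3"
  shows "d_mu n N1 N2 \<ge> 0 \<and>
         d_mu n N1 N2 = d_mu n N2 N1 \<and>
         d_mu n N1 N3 \<le> d_mu n N1 N2 + d_mu n N2 N3 \<and>
         (d_mu n N1 N2 = 0 \<longleftrightarrow> isomorphic N1 N2)"
proof (intro conjI)
  show "d_mu n N1 N2 \<ge> 0" by (simp add: d_mu_def)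
  show "d_mu n N1 N2 = d_mu n N2 N1" by (simp add: d_mu_def multiset_sym_diff_def add.commute)
  show "d_mu n N1 N3 \<le> d_mu n N1 N2 + d_mu n N2 N3"
    using size_sym_diff_triangle[of "mu_rep n N1" "mu_rep n N3" "mu_rep n N2"]
        by (simp add: d_mu_def)
  have "d_mu n N1 N2 = 0 \<longleftrightarrow> mu_rep n N1 = mu_rep n N2" by (simp add: d_mu_def sym_diff_empty_iff)
  then show "d_mu n N1 N2 = 0 \<longleftrightarrow> isomorphic N1 N2"
    using mu_rep_isomorphic[OF assms(1) orchard_network_network[OF assms(2)]]
      isomorphic_mu_rep[OF orchard_network_network[OF assms(1)]
          orchard_network_network[OF assms(2)]] by blast
qed

end
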